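(* Let $G$ be a discrete subgroup of $PSL(2,\mathbf{R})$ and let $h\in G$ be a primitive element of infinite order which is not conjugate to its inverse in $G$. Then for every finite set of elements $g_1,\dots,g_M\in G$, none of which is conjugate in $G$ to a power of $h$, there is a homogeneous quasi-morphism $r$ of $G$ such that $r(h)\neq 0$ while $r(g_1)=\dots=r(g_M)=0$.
   Context: Given a group $G$, a function $r:G\to\mathbf{R}$ is a quasi-morphism if the function $dr:G\times G\to\mathbf{R}$, $dr(g_1,g_2)=r(g_1g_2)-r(g_1)-r(g_2)$, is bounded. A quasi-morphism $r$ is homogeneous if in addition $r(g^n)=n\,r(g)$ for all $g\in G$, $n\in\mathbf{Z}$. An element $h\in G$ of infinite order is primitive if it is not a proper power in $G$, i.e. not of the form $g^k$ with $g\in G$ and $k\in\mathbf{Z}$, $|k|\ge 2$. Powers of $h$ are the elements $h^k$, $k\in\mathbf{Z}$. *)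

theory Defs
  imports "HOL-Analysis.Analysis" "HOL-Algebra.Coset" "HOL-Algebra.Multiplicative_Group"
begin

definition SL2R :: "(real^2^2) monoid" where
  "SL2R = \<lparr>carrier = {A. det A = 1}, mult = (**), one = mat 1\<rparr>"

definition PSL2R :: "(real^2^2) set monoid" where
  "PSL2R = SL2R Mod {mat 1, - mat 1}"

definition PSL2R_proj :: "real^2^2 \<Rightarrow> (real^2^2) set" where
  "PSL2R_proj A = {mat 1, - mat 1} #>\<^bsub>SL2R\<^esub> A"

text \<open>The quotient topology; see \<open>quotient_map_PSL2R_proj\<close> below.\<close>

definition PSL2R_topology :: "(real^2^2) set topology" where
  "PSL2R_topology = topology (\<lambda>U. U \<subseteq> carrier PSL2R \<and>
     openin (top_of_set (carrier SL2R)) {A \<in> carrier SL2R. PSL2R_proj A \<in> U})"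

definition discrete_subgroup_PSL2R :: "(real^2^2) set set \<Rightarrow> bool" where
  "discrete_subgroup_PSL2R G \<longleftrightarrow>
     subgroup G PSL2R \<and> subtopology PSL2R_topology G = discrete_topology G"

lemma group_SL2R: "group SL2R"
proof (rule groupI)
  fix A assume A: "A \<in> carrier SL2R"
  then have "det A \<noteq> 0" by (simp add: SL2R_def)
  then obtain B where B: "A ** B = mat 1" "B ** A = mat 1"
    by (metis invertible_det_nz invertible_def)
  then have "det B * det A = 1"
    by (metis det_mul det_I)
  then show "\<exists>B \<in> carrier SL2R. B \<otimes>\<^bsub>SL2R\<^esub> A = \<one>\<^bsub>SL2R\<^esub>"
    using A B by (auto simp: SL2R_def)
qed (auto simp: SL2R_def det_mul matrix_mul_assoc)

lemma det_uminus_2: "det (- A) = det (A :: real^2^2)"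
  by (simp add: det_2)

lemma matrix_mul_uminus:
  "(- A) ** B = - (A ** B)" "A ** (- B) = - (A ** B)" for A B :: "real^2^2"
  by (simp_all add: matrix_matrix_mult_def vec_eq_iff sum_negf)

lemma inv_SL2R_uminus_one: "inv\<^bsub>SL2R\<^esub> (- mat 1) = - mat 1"
  by (rule group.inv_equality[OF group_SL2R])
     (auto simp: SL2R_def det_uminus_2 matrix_mul_uminus)

lemma normal_center_SL2R: "{mat 1, - mat 1} \<lhd> SL2R"
proof -
  interpret group SL2R by (rule group_SL2R)
  have inv1: "inv\<^bsub>SL2R\<^esub> (mat 1) = mat 1"
    using inv_one by (simp add: SL2R_def)
  have sub: "subgroup {mat 1, - mat 1} SL2R"
    by (rule subgroupI) (auto simp: inv1 inv_SL2R_uminus_one,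
        auto simp: SL2R_def det_uminus_2 matrix_mul_uminus)
  show ?thesis
    by (rule normalI[OF sub])
       (auto simp: r_coset_def l_coset_def SL2R_def matrix_mul_uminus)
qed

lemma group_PSL2R: "group PSL2R"
  unfolding PSL2R_def by (rule normal.factorgroup_is_group[OF normal_center_SL2R])

lemma carrier_PSL2R: "carrier PSL2R = PSL2R_proj ` carrier SL2R"
  by (auto simp: PSL2R_def carrier_FactGroup PSL2R_proj_def)

lemma openin_PSL2R_topology:
  "openin PSL2R_topology U \<longleftrightarrow> U \<subseteq> carrier PSL2R \<and>
     openin (top_of_set (carrier SL2R)) {A \<in> carrier SL2R. PSL2R_proj A \<in> U}"
proof -
  let ?X = "top_of_set (carrier SL2R)"
  let ?P = "\<lambda>U. {A \<in> carrier SL2R. PSL2R_proj A \<in> U}"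
  have "istopology (\<lambda>U. U \<subseteq> carrier PSL2R \<and> openin ?X (?P U))"
    unfolding istopology_def
  proof (intro conjI allI impI)
    fix S T assume "S \<subseteq> carrier PSL2R \<and> openin ?X (?P S)" "T \<subseteq> carrier PSL2R \<and> openin ?X (?P T)"
    moreover have "?P (S \<inter> T) = ?P S \<inter> ?P T" by auto
    ultimately show "S \<inter> T \<subseteq> carrier PSL2R" "openin ?X (?P (S \<inter> T))"
      by (auto intro: openin_Int)
  next
    fix K assume K: "\<forall>U\<in>K. U \<subseteq> carrier PSL2R \<and> openin ?X (?P U)"
    have "?P (\<Union>K) = (\<Union>U\<in>K. ?P U)" by auto
    then show "openin ?X (?P (\<Union>K))" using K by (auto intro!: openin_Union)
    show "\<Union>K \<subseteq> carrier PSL2R" using K by auto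
  qed
  then show ?thesis by (simp add: PSL2R_topology_def)
qed

lemma topspace_PSL2R_topology: "topspace PSL2R_topology = carrier PSL2R"
proof -
  have "{A \<in> carrier SL2R. PSL2R_proj A \<in> carrier PSL2R} = carrier SL2R"
    by (auto simp: carrier_PSL2R)
  then have "openin PSL2R_topology (carrier PSL2R)"
    by (simp add: openin_PSL2R_topology)
  then show ?thesis
    by (metis openin_PSL2R_topology openin_subset openin_topspace subset_antisym)
qed

lemma quotient_map_PSL2R_proj:
  "quotient_map (top_of_set (carrier SL2R)) PSL2R_topology PSL2R_proj"
  by (auto simp: quotient_map_def topspace_PSL2R_topology openin_PSL2R_topology carrier_PSL2R)

definition quasi_morphism :: "('a, 'b) monoid_scheme \<Rightarrow> ('a \<Rightarrow> real) \<Rightarrow> bool" where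
  "quasi_morphism G r \<longleftrightarrow>
     (\<exists>C. \<forall>x\<in>carrier G. \<forall>y\<in>carrier G. \<bar>r (x \<otimes>\<^bsub>G\<^esub> y) - r x - r y\<bar> \<le> C)"

definition homogeneous_quasi_morphism :: "('a, 'b) monoid_scheme \<Rightarrow> ('a \<Rightarrow> real) \<Rightarrow> bool" where
  "homogeneous_quasi_morphism G r \<longleftrightarrow>
     quasi_morphism G r \<and> (\<forall>x\<in>carrier G. \<forall>n::int. r (x [^]\<^bsub>G\<^esub> n) = of_int n * r x)"

definition conjugate_in :: "('a, 'b) monoid_scheme \<Rightarrow> 'a \<Rightarrow> 'a \<Rightarrow> bool" where
  "conjugate_in G x y \<longleftrightarrow> (\<exists>c\<in>carrier G. c \<otimes>\<^bsub>G\<^esub> x \<otimes>\<^bsub>G\<^esub> inv\<^bsub>G\<^esub> c = y)"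

text \<open>\<^const>\<open>group.ord\<close> takes the value 0 exactly on the elements of infinite order.\<close>

definition primitive_element :: "('a, 'b) monoid_scheme \<Rightarrow> 'a \<Rightarrow> bool" where
  "primitive_element G h \<longleftrightarrow> h \<in> carrier G \<and> group.ord G h = 0 \<and>
     \<not> (\<exists>g\<in>carrier G. \<exists>k::int. \<bar>k\<bar> \<ge> 2 \<and> h = g [^]\<^bsub>G\<^esub> k)"

end

theory Submission
  imports Defs
begin

text \<open>
  A function \<open>R\<close> on pairs of points of the hyperbolic plane that is invariant under \<open>G\<close> and
  satisfies \<open>R(x,z) = R(x,y) + R(y,z)\<close> up to a bounded error gives a homogeneous
  quasi-morphism, whose value at \<open>g\<close> is the limit of \<open>R(x, g\<^sup>n x) / n\<close>.

  If \<open>h\<close> is hyperbolic, let \<open>D\<close> be the path metric in which the translates of a long segment of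
  the axis of \<open>h\<close>, run through in the direction of \<open>h\<close>, cost one less than their length, and
  let \<open>R(x,y) = D(x,y) - D(y,x)\<close>. Nearly optimal paths pass close to every point of the
  hyperbolic geodesic, so \<open>D\<close> is additive along geodesics up to a constant, and thin triangles
  give the cocycle estimate. Along the axis of \<open>h\<close> the shortcuts can be used in one
  direction only, because \<open>h\<close> is not conjugate to its inverse; along the axis of an element
  that is not conjugate to a power of \<open>h\<close> they cannot be used at all.

  If \<open>h\<close> is parabolic, \<open>R(x,y)\<close> is the sum, over all translates of the cusp of \<open>h\<close>, of the
  horocyclic displacement from \<open>x\<close> to \<open>y\<close> seen from that cusp, cut off below a large threshold.
  The displacements are additive, and only the cut-off contributes to the error; its
  contributions decay geometrically because the horoballs are uniformly separated.
\<close>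

subsection \<open>The upper half-plane\<close>

text \<open>An invariant quasi-cocycle that is bounded by the hyperbolic distance vanishes, after
  homogenization, on every parabolic element, because such an element moves suitable points
  arbitrarily little. This disposes of parabolic g when h is hyperbolic, but it also forces a
  different construction when h is parabolic: there the displacement is measured along horocycles,
  where it grows linearly. In both cases the finite set enters only through one parameter, the
  length of the shortcuts or the height of the cut-off. Each single g is killed by all sufficiently
  large values, so finitely many can be treated at once. No fundamental domain is at hand.
  Discreteness enters as finiteness of orbits in balls: by pigeonhole, two axes that run together
  for arbitrarily long belong to elements with conjugate powers; near a cusp it gives a smallest
  translation and a uniform lower bound for the lower left entries of matrices.\<close>

definition HP :: "complex set" where "HP = {z. Im z > 0}"

definition hcosh :: "complex \<Rightarrow> complex \<Rightarrow> real" where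
  "hcosh z w = 1 + (cmod (z - w))\<^sup>2 / (2 * Im z * Im w)"

definition hdist :: "complex \<Rightarrow> complex \<Rightarrow> real" where
  "hdist z w = arcosh (hcosh z w)"

lemma hcosh_ge_1: "z \<in> HP \<Longrightarrow> w \<in> HP \<Longrightarrow> hcosh z w \<ge> 1"
  by (simp add: hcosh_def HP_def)

lemma cosh_hdist: "z \<in> HP \<Longrightarrow> w \<in> HP \<Longrightarrow> cosh (hdist z w) = hcosh z w"
  by (simp add: hdist_def hcosh_ge_1)

lemma hdist_nonneg: "z \<in> HP \<Longrightarrow> w \<in> HP \<Longrightarrow> hdist z w \<ge> 0"
  by (simp add: hdist_def hcosh_ge_1)

lemma hdist_self [simp]: "hdist z z = 0"
  by (simp add: hdist_def hcosh_def)

lemma hdist_commute: "hdist z w = hdist w z"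
  by (simp add: hdist_def hcosh_def norm_minus_commute mult.commute mult.left_commute)

lemma hcosh_affine:
  assumes "t > 0"
  shows "hcosh (of_real t * z + of_real s) (of_real t * w + of_real s) = hcosh z w"
proof -
  have "of_real t * z + of_real s - (of_real t * w + of_real s) = of_real t * (z - w)"
    by (simp add: algebra_simps)
  then have "(cmod (of_real t * z + of_real s - (of_real t * w + of_real s)))\<^sup>2 = t\<^sup>2 * (cmod (z - w))\<^sup>2"
    by (simp add: norm_mult power_mult_distrib)
  then show ?thesis
    using assms by (simp add: hcosh_def power2_eq_square)
qed

lemma hdist_affine:
  "t > 0 \<Longrightarrow> hdist (of_real t * z + of_real s) (of_real t * w + of_real s) = hdist z w"
  by (simp add: hdist_def hcosh_affine)

text \<open>With the middle point at \<open>\<i>\<close>, the three numbers \<open>a, b, c\<close> below are the coordinates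
  in the hyperboloid model, where the inequality is Cauchy--Schwarz.\<close>

lemma hdist_triangle_ii:
  assumes z: "z \<in> HP" and w: "w \<in> HP"
  shows "hdist z w \<le> hdist z \<i> + hdist \<i> w"
proof -
  define a where "a z = ((cmod z)\<^sup>2 + 1) / (2 * Im z)" for z
  define b where "b z = ((cmod z)\<^sup>2 - 1) / (2 * Im z)" for z
  define c where "c z = Re z / Im z" for z
  have i: "\<i> \<in> HP" by (simp add: HP_def)
  have norm: "(a u)\<^sup>2 - 1 = (b u)\<^sup>2 + (c u)\<^sup>2" if "u \<in> HP" for u
    using that unfolding a_def b_def c_def HP_def cmod_power2
    by (simp add: field_simps power2_eq_square)
  have ai: "hcosh u \<i> = a u" "hcosh \<i> u = a u" if "u \<in> HP" for u
    using that unfolding hcosh_def a_def HP_def cmod_power2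
    by (simp_all add: field_simps power2_eq_square)
  have "hcosh z w = a z * a w - (b z * b w + c z * c w)"
    using z w unfolding hcosh_def a_def b_def c_def HP_def cmod_power2
    by (simp add: field_simps power2_eq_square)
  also have "\<dots> \<le> a z * a w + sqrt ((a z)\<^sup>2 - 1) * sqrt ((a w)\<^sup>2 - 1)"
  proof -
    have "(b z * b w + c z * c w)\<^sup>2 \<le> ((b z)\<^sup>2 + (c z)\<^sup>2) * ((b w)\<^sup>2 + (c w)\<^sup>2)"
      using zero_le_power2[of "b z * c w - c z * b w"] by (simp add: power2_eq_square algebra_simps)
    then have "\<bar>b z * b w + c z * c w\<bar> \<le> sqrt (((a z)\<^sup>2 - 1) * ((a w)\<^sup>2 - 1))"
      by (simp add: norm z w real_le_rsqrt)
    then show ?thesis by (simp add: real_sqrt_mult)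
  qed
  also have "\<dots> = cosh (hdist z \<i> + hdist \<i> w)"
    using hcosh_ge_1[OF z i] hcosh_ge_1[OF i w]
    by (simp add: cosh_add hdist_def sinh_arcosh_real ai z w)
  finally show ?thesis
    by (metis cosh_hdist z w cosh_real_nonneg_le_iff hdist_nonneg i add_nonneg_nonneg)
qed

text \<open>An affine map, an isometry by \<open>hdist_affine\<close>, carries the middle point to
  \<open>\<i>\<close>.\<close>

lemma hdist_triangle:
  assumes z: "z \<in> HP" and u: "u \<in> HP" and w: "w \<in> HP"
  shows "hdist z w \<le> hdist z u + hdist u w"
proof -
  define t where "t = 1 / Im u"
  define s where "s = - Re u / Im u"
  define f :: "complex \<Rightarrow> complex" where "f v = of_real t * v + of_real s" for v
  have t: "t > 0" using u by (simp add: t_def HP_def)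
  have fHP: "f v \<in> HP" if "v \<in> HP" for v using that t by (simp add: f_def HP_def)
  have fu: "f u = \<i>" using u by (auto simp: f_def t_def s_def HP_def complex_eq_iff field_simps)
  have "hdist (f v) (f v') = hdist v v'" for v v'
    unfolding f_def by (rule hdist_affine[OF t])
  then show ?thesis
    using hdist_triangle_ii[OF fHP[OF z] fHP[OF w]] fu by metis
qed

text \<open>Fermi coordinates along the imaginary axis: \<open>ln (cmod z)\<close> is the position of the
  foot of \<open>z\<close> and \<open>Re z / Im z\<close>, \<open>cmod z / Im z\<close> are the hyperbolic sine and cosine of the
  signed distance to it.\<close>

definition foot :: "complex \<Rightarrow> real" where "foot z = ln (cmod z)"

definition height :: "complex \<Rightarrow> real" where "height z = arcosh (cmod z / Im z)"

definition imag_axis :: "real \<Rightarrow> complex" where "imag_axis p = \<i> * of_real (exp p)"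

lemma axis_HP [simp]: "imag_axis p \<in> HP" by (simp add: imag_axis_def HP_def)

lemma foot_axis [simp]: "foot (imag_axis p) = p" by (simp add: imag_axis_def foot_def norm_mult)

lemma HP_cmod_pos: "z \<in> HP \<Longrightarrow> cmod z > 0" by (auto simp: HP_def)

lemma cmod_Im_ge_1: "z \<in> HP \<Longrightarrow> cmod z / Im z \<ge> 1"
  using abs_Im_le_cmod[of z] by (simp add: HP_def)

lemma cosh_height: "z \<in> HP \<Longrightarrow> cosh (height z) = cmod z / Im z"
  by (simp add: height_def cmod_Im_ge_1)

lemma height_nonneg: "z \<in> HP \<Longrightarrow> height z \<ge> 0"
  by (simp add: height_def cmod_Im_ge_1)

lemma height_axis [simp]: "height (imag_axis p) = 0"
  by (simp add: height_def imag_axis_def norm_mult)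

lemma cmod_foot: "z \<in> HP \<Longrightarrow> cmod z = exp (foot z)"
  using HP_cmod_pos by (simp add: foot_def)

text \<open>The relation cosh d = cosh a cosh b cosh l - sinh a sinh b, for signed distances a, b
  from the axis and feet at distance l.\<close>

lemma hcosh_fermi:
  assumes "z \<in> HP" "w \<in> HP"
  shows "hcosh z w = cmod z / Im z * (cmod w / Im w) * cosh (foot z - foot w)
           - Re z / Im z * (Re w / Im w)"
proof -
  have z: "Im z > 0" and w: "Im w > 0" using assms by (auto simp: HP_def)
  have "2 * (cmod z * cmod w * cosh (foot z - foot w)) = (cmod z)\<^sup>2 + (cmod w)\<^sup>2"
    using assms by (simp add: cosh_def cmod_foot exp_diff exp_minus power2_eq_square field_simps)
  then have *: "cmod z / Im z * (cmod w / Im w) * cosh (foot z - foot w)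
     = ((cmod z)\<^sup>2 + (cmod w)\<^sup>2) / (2 * Im z * Im w)"
    using z w by (simp add: field_simps)
  show ?thesis unfolding * hcosh_def cmod_power2 using z w
    by (simp add: field_simps power2_eq_square)
qed

text \<open>This uses cosh a cosh b - sinh a sinh b = cosh (a - b) \<ge> 1. The surviving factor
  \<open>cosh (height z) * cosh (height w)\<close> makes progress of the foot expensive far from the
  axis; the later contraction estimates rest on it.\<close>

lemma hcosh_fermi_ge:
  assumes "z \<in> HP" "w \<in> HP"
  shows "hcosh z w \<ge> 1 + cosh (height z) * cosh (height w) * (cosh (foot z - foot w) - 1)"
proof -
  have z: "Im z > 0" and w: "Im w > 0" using assms by (auto simp: HP_def)
  define s where "s = Re z / Im z" define s' where "s' = Re w / Im w"
  define C where "C = cmod z / Im z" define C' where "C' = cmod w / Im w"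
  have C: "C\<^sup>2 = s\<^sup>2 + 1" "C > 0" using z cmod_power2[of z]
    by (auto simp: C_def s_def power_divide field_simps)
  have C': "C'\<^sup>2 = s'\<^sup>2 + 1" "C' > 0" using w cmod_power2[of w]
    by (auto simp: C'_def s'_def power_divide field_simps)
  have "(1 + s * s')\<^sup>2 \<le> (C * C')\<^sup>2"
    using zero_le_power2[of "s - s'"] unfolding power_mult_distrib C(1) C'(1)
    by (simp add: power2_eq_square algebra_simps)
  then have "1 + s * s' \<le> C * C'"
    by (rule power2_le_imp_le) (use C C' in auto)
  then show ?thesis
    unfolding hcosh_fermi[OF assms] cosh_height[OF assms(1)] cosh_height[OF assms(2)]
    by (fold s_def s'_def C_def C'_def) (simp add: algebra_simps)
qed

lemma hdist_ge_foot:
  assumes "z \<in> HP" "w \<in> HP"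
  shows "\<bar>foot z - foot w\<bar> \<le> hdist z w"
proof -
  have "1 * (cosh (foot z - foot w) - 1)
     \<le> cosh (height z) * cosh (height w) * (cosh (foot z - foot w) - 1)"
    by (intro mult_right_mono) (auto simp: cosh_real_ge_1 mult_ge1_I)
  then have "cosh \<bar>foot z - foot w\<bar> \<le> cosh (hdist z w)"
    using hcosh_fermi_ge[OF assms] by (simp add: cosh_hdist[OF assms])
  then show ?thesis by (metis abs_ge_zero hdist_nonneg[OF assms] cosh_real_nonneg_le_iff)
qed

text \<open>Hyperbolic Pythagoras for the right triangle formed by z, its foot and the axis point at
  p.\<close>

lemma cosh_hdist_axis:
  assumes "z \<in> HP"
  shows "cosh (hdist z (imag_axis p)) = cosh (height z) * cosh (foot z - p)"
  using hcosh_fermi[OF assms axis_HP[of p]]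
  by (simp add: cosh_hdist assms cosh_height) (simp add: imag_axis_def norm_mult)

lemma hdist_foot: "z \<in> HP \<Longrightarrow> hdist z (imag_axis (foot z)) = height z"
  using cosh_hdist_axis[of z "foot z"] height_nonneg[of z] hdist_nonneg[of z "imag_axis (foot z)"]
  by (metis axis_HP cosh_0 cosh_real_nonneg_le_iff diff_self mult.right_neutral order_antisym order_refl)

lemma hdist_axis: "hdist (imag_axis p) (imag_axis q) = \<bar>p - q\<bar>"
proof -
  have "cosh (hdist (imag_axis p) (imag_axis q)) = cosh \<bar>p - q\<bar>"
    using cosh_hdist_axis[of "imag_axis p" q] by simp
  then show ?thesis using hdist_nonneg[of "imag_axis p" "imag_axis q"]
    by (metis abs_ge_zero axis_HP cosh_real_nonneg_le_iff order_antisym order_refl)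
qed

lemma hdist_axis_le: "z \<in> HP \<Longrightarrow> hdist z (imag_axis p) \<le> height z + \<bar>foot z - p\<bar>"
  using hdist_triangle[of z "imag_axis (foot z)" "imag_axis p"] by (simp add: hdist_foot hdist_axis)

lemma hdist_fermi_le:
  "z \<in> HP \<Longrightarrow> w \<in> HP \<Longrightarrow> hdist z w \<le> height z + \<bar>foot z - foot w\<bar> + height w"
  using hdist_triangle[of z "imag_axis (foot w)" w] hdist_axis_le[of z "foot w"]
  by (simp add: hdist_foot hdist_commute[of "imag_axis (foot w)" w])

lemma exp_le_2cosh: "exp \<bar>x\<bar> \<le> 2 * cosh (x::real)"
  by (auto simp: cosh_def abs_if)

text \<open>Two factors 2 from \<open>exp_le_2cosh\<close>, inserted into the Pythagorean relation,
  give the 4. Together with \<open>hdist_axis_le\<close>, the way through the foot is geodesic up to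
  \<open>ln 4\<close>, the thinness constant of the later estimates.\<close>

lemma hdist_axis_ge:
  assumes "z \<in> HP"
  shows "height z + \<bar>foot z - p\<bar> \<le> hdist z (imag_axis p) + ln 4"
proof -
  have "exp (height z + \<bar>foot z - p\<bar>) \<le> (2 * cosh (height z)) * (2 * cosh (foot z - p))"
    unfolding exp_add using exp_le_2cosh[of "height z"] exp_le_2cosh[of "foot z - p"]
      height_nonneg[OF assms] by (intro mult_mono) auto
  also have "\<dots> = 4 * cosh (hdist z (imag_axis p))" by (simp add: cosh_hdist_axis[OF assms])
  also have "\<dots> \<le> 4 * exp (hdist z (imag_axis p))"
    using hdist_nonneg[OF assms axis_HP[of p]] by (simp add: cosh_def)
  also have "\<dots> = exp (hdist z (imag_axis p) + ln 4)" by (simp add: exp_add)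
  finally show ?thesis by simp
qed

text \<open>Progress D \<ge> 1 gives cosh D - 1 \<ge> exp D / 8, so \<open>hcosh_fermi_ge\<close>
  bounds \<open>cosh (height z) * cosh (height w)\<close> by 8 e. A height h with cosh h \<le> 8 e
  satisfies exp h \<le> 16 e \<le> exp 6.\<close>

lemma height_bound_of_progress:
  assumes z: "z \<in> HP" and w: "w \<in> HP" and d: "hdist z w \<le> \<bar>foot z - foot w\<bar> + 1"
    and l: "\<bar>foot z - foot w\<bar> \<ge> 1"
  shows "height z \<le> 6" "height w \<le> 6"
proof -
  define D where "D = \<bar>foot z - foot w\<bar>"
  have e2: "exp 1 \<ge> (2::real)" using exp_ge_add_one_self[of "1::real"] by simp
  have "exp 1 \<le> exp D" using l by (simp add: D_def)
  with e2 have eD: "exp D \<ge> 2" by linarith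
  have "cosh D - 1 = exp D / 2 * (1 - exp (- D))\<^sup>2"
    by (simp add: cosh_def power2_eq_square field_simps exp_minus)
  moreover have "exp D / 2 * (1/2)\<^sup>2 \<le> exp D / 2 * (1 - exp (- D))\<^sup>2"
    using eD by (intro mult_left_mono power_mono) (auto simp: exp_minus field_simps)
  moreover have "exp D / 2 * (1/2)\<^sup>2 = exp D / 8" by (simp add: power2_eq_square)
  ultimately have cD: "cosh D - 1 \<ge> exp D / 8" by linarith
  have "cosh (height z) * cosh (height w) * (exp D / 8) \<le> cosh (height z) * cosh (height w) * (cosh D - 1)"
    using cD by (intro mult_left_mono) auto
  also have "\<dots> \<le> cosh (hdist z w)"
    using hcosh_fermi_ge[OF z w] by (simp add: D_def cosh_hdist z w)
  also have "\<dots> \<le> exp (hdist z w)"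
    using hdist_nonneg[OF z w] by (simp add: cosh_def)
  also have "\<dots> \<le> exp (D + 1)" using d by (simp add: D_def)
  finally have prod: "cosh (height z) * cosh (height w) \<le> 8 * exp 1"
    by (simp add: exp_add field_simps)
  have "exp (6::real) = exp 1 * (exp 1) ^ 5" by (simp flip: exp_of_nat_mult exp_add)
  moreover have "(exp 1 :: real) ^ 5 \<ge> 2 ^ 5" using e2 by (intro power_mono) auto
  ultimately have e6: "16 * exp 1 \<le> exp (6::real)" by simp
  have *: "h \<le> 6" if "cosh h \<le> 8 * exp 1" "h \<ge> 0" for h :: real
  proof -
    have "exp h \<le> 2 * cosh h" using exp_le_2cosh[of h] that by simp
    then have "exp h \<le> exp 6" using that e6 by linarith
    then show ?thesis by simp
  qed
  have "cosh (height z) * 1 \<le> cosh (height z) * cosh (height w)"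
    "1 * cosh (height w) \<le> cosh (height z) * cosh (height w)"
    by (intro mult_left_mono mult_right_mono; simp add: cosh_real_ge_1)+
  then have "cosh (height z) \<le> 8 * exp 1" "cosh (height w) \<le> 8 * exp 1"
    using prod by linarith+
  then show "height z \<le> 6" "height w \<le> 6"
    by (simp_all add: * height_nonneg z w)
qed

text \<open>The formula cosh x - 1 = 2 sinh^2 (x/2) turns \<open>hcosh_fermi_ge\<close> into a
  comparison of squares.\<close>

lemma foot_contraction:
  assumes z: "z \<in> HP" and w: "w \<in> HP" and K: "K \<ge> 1"
    and kz: "cosh (height z) \<ge> K" and kw: "cosh (height w) \<ge> K"
  shows "K * \<bar>foot z - foot w\<bar> \<le> 2 * sinh (hdist z w / 2)"
proof -
  define D where "D = \<bar>foot z - foot w\<bar>"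
  define d where "d = hdist z w"
  have half: "cosh x - 1 = 2 * (sinh (x/2))\<^sup>2" for x :: real
    using cosh_double[of "x/2"] cosh_square_eq[of "x/2"] by simp
  have d0: "d \<ge> 0" by (simp add: d_def hdist_nonneg z w)
  have "K * K * (cosh D - 1) \<le> cosh (height z) * cosh (height w) * (cosh D - 1)"
    using K kz kw by (intro mult_right_mono mult_mono) (auto simp: cosh_real_ge_1)
  also have "\<dots> \<le> cosh d - 1"
    using hcosh_fermi_ge[OF z w] by (simp add: D_def d_def cosh_hdist z w)
  finally have "(K * sinh (D/2))\<^sup>2 \<le> (sinh (d/2))\<^sup>2"
    by (simp add: half power_mult_distrib power2_eq_square mult_ac)
  then have "K * sinh (D/2) \<le> sinh (d/2)"
    by (rule power2_le_imp_le) (use d0 in auto)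
  moreover have "D/2 \<le> sinh (D/2)"
    using real_le_x_sinh[of "D/2"] by (simp add: D_def sinh_def exp_minus)
  ultimately have "K * (D/2) \<le> sinh (d/2)"
    using K by (meson mult_left_mono order_trans zero_le_one)
  then show ?thesis by (simp add: D_def d_def)
qed

lemma sinh_le_mult_exp: "x \<ge> 0 \<Longrightarrow> sinh x \<le> x * exp (x::real)"
proof -
  have "exp x * (1 - 2 * x) \<le> exp x * exp (- (2 * x))"
    using exp_ge_add_one_self[of "- (2*x)"] by (intro mult_left_mono) auto
  also have "\<dots> = exp (- x)" by (simp flip: exp_add)
  finally show ?thesis by (simp add: sinh_def algebra_simps)
qed

text \<open>At distance at most L the hyperbolic sine is linear up to the factor
  \<open>exp L\<close>. Steps of chains have bounded length, so this form can be summed along a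
  chain.\<close>

lemma foot_contraction_linear:
  assumes z: "z \<in> HP" and w: "w \<in> HP" and K: "K \<ge> 1"
    and kz: "cosh (height z) \<ge> K" and kw: "cosh (height w) \<ge> K" and L: "hdist z w \<le> L"
  shows "K * \<bar>foot z - foot w\<bar> \<le> exp L * hdist z w"
proof -
  have d0: "hdist z w \<ge> 0" by (rule hdist_nonneg[OF z w])
  have "K * \<bar>foot z - foot w\<bar> \<le> 2 * sinh (hdist z w / 2)"
    by (rule foot_contraction) (use assms in auto)
  also have "\<dots> \<le> 2 * (hdist z w / 2 * exp (hdist z w / 2))"
    using sinh_le_mult_exp[of "hdist z w / 2"] d0 by simp
  also have "\<dots> \<le> hdist z w * exp L"
    using d0 L by (auto intro!: mult_left_mono)
  finally show ?thesis by (simp add: mult.commute)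
qed

subsection \<open>The action of the group\<close>

abbreviation psl_mult (infixl "\<cdot>" 70) where "X \<cdot> Y \<equiv> X \<otimes>\<^bsub>PSL2R\<^esub> Y"
abbreviation psl_inv ("pinv _" [81] 80) where "pinv X \<equiv> inv\<^bsub>PSL2R\<^esub> X"
abbreviation psl_pow (infixr "\<^bold>^" 75) where "X \<^bold>^ n \<equiv> X [^]\<^bsub>PSL2R\<^esub> n"
abbreviation psl_one ("\<^bold>1") where "\<^bold>1 \<equiv> \<one>\<^bsub>PSL2R\<^esub>"

definition M2 :: "real \<Rightarrow> real \<Rightarrow> real \<Rightarrow> real \<Rightarrow> real^2^2" where
  "M2 a b c d = vector [vector [a, b], vector [c, d]]"

lemma M2_nth [simp]:
  "M2 a b c d $ 1 $ 1 = a" "M2 a b c d $ 1 $ 2 = b"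
  "M2 a b c d $ 2 $ 1 = c" "M2 a b c d $ 2 $ 2 = d"
  by (simp_all add: M2_def)

lemma M2_eta: "M2 (A $ 1 $ 1) (A $ 1 $ 2) (A $ 2 $ 1) (A $ 2 $ 2) = A"
  by (simp add: vec_eq_iff forall_2)

lemma M2_eq_iff: "M2 a b c d = M2 a' b' c' d' \<longleftrightarrow> a = a' \<and> b = b' \<and> c = c' \<and> d = d'"
  by (metis M2_nth)

lemma M2_mult: "M2 a b c d ** M2 a' b' c' d' =
    M2 (a * a' + b * c') (a * b' + b * d') (c * a' + d * c') (c * b' + d * d')"
  by (simp add: vec_eq_iff forall_2 matrix_matrix_mult_def sum_2)

lemma M2_uminus: "- M2 a b c d = M2 (- a) (- b) (- c) (- d)"
  by (simp add: vec_eq_iff forall_2)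

lemma mat_1_M2: "mat 1 = M2 1 0 0 1"
  by (simp add: vec_eq_iff forall_2 mat_def)

lemma carrier_SL2R_M2: "M2 a b c d \<in> carrier SL2R \<longleftrightarrow> a * d - b * c = 1"
  by (simp add: SL2R_def det_2 mult.commute)

text \<open>Coordinates for a class modulo sign: group identities become polynomial identities in
  four entries, and the sign is dealt with in \<open>P2_eq_iff\<close>.\<close>

definition P2 :: "real \<Rightarrow> real \<Rightarrow> real \<Rightarrow> real \<Rightarrow> (real^2^2) set" where
  "P2 a b c d = PSL2R_proj (M2 a b c d)"

lemma P2_eq: "P2 a b c d = {M2 a b c d, M2 (- a) (- b) (- c) (- d)}"
  by (auto simp: P2_def PSL2R_proj_def r_coset_def SL2R_def matrix_mul_uminus M2_uminus)

lemma P2_eq_iff: "P2 a b c d = P2 a' b' c' d' \<longleftrightarrow>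
    (a = a' \<and> b = b' \<and> c = c' \<and> d = d') \<or> (a = - a' \<and> b = - b' \<and> c = - c' \<and> d = - d')"
  unfolding P2_eq doubleton_eq_iff M2_eq_iff by auto

lemma carrier_PSL2R_P2: "carrier PSL2R = {P2 a b c d | a b c d. a * d - b * c = 1}"
proof -
  have "X \<in> carrier PSL2R \<longleftrightarrow> (\<exists>A \<in> carrier SL2R. X = PSL2R_proj A)" for X
    by (auto simp: carrier_PSL2R)
  then show ?thesis
    unfolding P2_def using carrier_SL2R_M2 M2_eta
    by (auto 0 3) metis
qed

lemma P2_carrier: "a * d - b * c = 1 \<Longrightarrow> P2 a b c d \<in> carrier PSL2R"
  by (auto simp: carrier_PSL2R_P2)

lemma PSL2R_cases:
  assumes "X \<in> carrier PSL2R"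
  obtains a b c d where "a * d - b * c = 1" "X = P2 a b c d"
  using assms by (auto simp: carrier_PSL2R_P2)

lemma P2_mult:
  assumes "a * d - b * c = 1" "a' * d' - b' * c' = 1"
  shows "P2 a b c d \<cdot> P2 a' b' c' d' =
    P2 (a * a' + b * c') (a * b' + b * d') (c * a' + d * c') (c * b' + d * d')"
  using normal.rcos_sum[OF normal_center_SL2R, of "M2 a b c d" "M2 a' b' c' d'"] assms
  by (simp add: PSL2R_def FactGroup_def P2_def PSL2R_proj_def carrier_SL2R_M2)
     (simp add: SL2R_def M2_mult)

lemma P2_one: "\<^bold>1 = P2 1 0 0 1"
  by (auto simp: PSL2R_def FactGroup_def P2_eq mat_1_M2 M2_uminus)

interpretation PSL: group PSL2R by (rule group_PSL2R)

lemma P2_inv: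
  assumes "a * d - b * c = 1"
  shows "pinv (P2 a b c d) = P2 d (- b) (- c) a"
  using assms
  by (intro PSL.inv_equality P2_carrier) (auto simp: P2_mult P2_one P2_eq_iff algebra_simps)

definition mob :: "real^2^2 \<Rightarrow> complex \<Rightarrow> complex" where
  "mob A z = (of_real (A$1$1) * z + of_real (A$1$2)) / (of_real (A$2$1) * z + of_real (A$2$2))"

text \<open>The two representatives of a class differ by a sign and act in the same way, so the
  choice is immaterial; see \<open>act_P2\<close>.\<close>

definition act :: "(real^2^2) set \<Rightarrow> complex \<Rightarrow> complex" where
  "act X = mob (SOME A. A \<in> X)"

lemma act_P2: "act (P2 a b c d) z = (of_real a * z + of_real b) / (of_real c * z + of_real d)"
proof -
  have "(SOME A. A \<in> P2 a b c d) \<in> P2 a b c d"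
    by (rule someI[of _ "M2 a b c d"]) (simp add: P2_eq)
  moreover have "(- (of_real a * z) - of_real b) / (- (of_real c * z) - of_real d) =
      (of_real a * z + of_real b) / (of_real c * z + of_real d)"
    by (metis minus_diff_eq minus_divide_divide diff_minus_eq_add minus_add_distrib uminus_add_conv_diff add.commute)
  ultimately show ?thesis
    by (auto simp: act_def P2_eq mob_def)
qed

lemma den_nonzero:
  assumes "z \<in> HP" "a * d - b * c = (1::real)"
  shows "of_real c * z + of_real d \<noteq> 0"
  using assms by (auto simp: HP_def complex_eq_iff)

lemma Im_act_P2:
  assumes z: "z \<in> HP" and 1: "a * d - b * c = 1"
  shows "Im (act (P2 a b c d) z) = Im z / (cmod (of_real c * z + of_real d))\<^sup>2"
proof -
  have "Im ((of_real a * z + of_real b) * cnj (of_real c * z + of_real d)) = (a * d - b * c) * Im z"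
    by (simp add: algebra_simps)
  then have "Im ((of_real a * z + of_real b) * cnj (of_real c * z + of_real d)) = Im z"
    by (simp add: 1)
  then show ?thesis
    unfolding act_P2 complex_div_cnj[of "of_real a * z + of_real b"]
    by (simp only: Im_divide_of_real flip: of_real_power)
qed

lemma act_diff_P2:
  assumes z: "z \<in> HP" and w: "w \<in> HP" and 1: "a * d - b * c = 1"
  shows "act (P2 a b c d) z - act (P2 a b c d) w
    = (z - w) / ((of_real c * z + of_real d) * (of_real c * w + of_real d))"
proof -
  have "(of_real a * z + of_real b) * (of_real c * w + of_real d)
      - (of_real a * w + of_real b) * (of_real c * z + of_real d)
    = of_real (a * d - b * c) * (z - w)"
    by (simp add: algebra_simps)
  then show ?thesis
    unfolding act_P2 using den_nonzero[OF z 1] den_nonzero[OF w 1]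
    by (simp add: diff_frac_eq 1)
qed

lemma act_HP: "X \<in> carrier PSL2R \<Longrightarrow> z \<in> HP \<Longrightarrow> act X z \<in> HP"
proof (elim PSL2R_cases)
  fix a b c d :: real assume "z \<in> HP" "a * d - b * c = 1" "X = P2 a b c d"
  then show "act X z \<in> HP"
    using den_nonzero[of z a d b c] by (simp add: HP_def Im_act_P2)
qed

lemma act_mult:
  assumes "X \<in> carrier PSL2R" "Y \<in> carrier PSL2R" "z \<in> HP"
  shows "act (X \<cdot> Y) z = act X (act Y z)"
proof -
  obtain a b c d where X: "a * d - b * c = 1" "X = P2 a b c d" using assms(1) by (rule PSL2R_cases)
  obtain a' b' c' d' where Y: "a' * d' - b' * c' = 1" "Y = P2 a' b' c' d'" using assms(2) by (rule PSL2R_cases)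
  have n: "of_real c' * z + of_real d' \<noteq> 0" by (rule den_nonzero[OF assms(3) Y(1)])
  have "act X (act Y z) = (of_real a * (of_real a' * z + of_real b') + of_real b * (of_real c' * z + of_real d'))
      / (of_real c * (of_real a' * z + of_real b') + of_real d * (of_real c' * z + of_real d'))"
    using n unfolding X Y act_P2 by (simp add: divide_simps) 
  then show ?thesis
    using X Y by (simp add: P2_mult act_P2 algebra_simps)
qed

lemma act_one [simp]: "act \<^bold>1 z = z"
  by (simp add: P2_one act_P2)

lemma act_inv_act [simp]: "X \<in> carrier PSL2R \<Longrightarrow> z \<in> HP \<Longrightarrow> act (pinv X) (act X z) = z"
  by (simp flip: act_mult)

lemma act_act_inv [simp]: "X \<in> carrier PSL2R \<Longrightarrow> z \<in> HP \<Longrightarrow> act X (act (pinv X) z) = z"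
  by (simp flip: act_mult)

lemma hdist_act:
  assumes "X \<in> carrier PSL2R" "z \<in> HP" "w \<in> HP"
  shows "hdist (act X z) (act X w) = hdist z w"
proof -
  obtain a b c d where X: "a * d - b * c = 1" "X = P2 a b c d" using assms(1) by (rule PSL2R_cases)
  define m where "m = cmod (of_real c * z + of_real d)"
  define n where "n = cmod (of_real c * w + of_real d)"
  have "m > 0" "n > 0" using den_nonzero[OF assms(2) X(1)] den_nonzero[OF assms(3) X(1)]
    by (auto simp: m_def n_def)
  then have "hcosh (act X z) (act X w) = hcosh z w"
    unfolding X(2) hcosh_def act_diff_P2[OF assms(2,3) X(1)] Im_act_P2[OF assms(2) X(1)]
      Im_act_P2[OF assms(3) X(1)] norm_divide norm_mult m_def[symmetric] n_def[symmetric]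
    by (simp add: power_divide power_mult_distrib)
  then show ?thesis by (simp add: hdist_def)
qed

text \<open>The values at \<open>\<i>\<close> and \<open>2 * \<i>\<close> suffice, because the
  coefficients are real.\<close>

lemma quadratic_root_free_eq_0:
  assumes "\<And>z. z \<in> HP \<Longrightarrow> of_real p * z\<^sup>2 + of_real q * z + of_real r = 0"
  shows "p = 0 \<and> q = 0 \<and> r = (0::real)"
proof -
  have "of_real p * \<i>\<^sup>2 + of_real q * \<i> + of_real r = 0"
    "of_real p * (2*\<i>)\<^sup>2 + of_real q * (2*\<i>) + of_real r = 0"
    by (intro assms; simp add: HP_def)+
  then show ?thesis by (auto simp: complex_eq_iff)
qed

text \<open>If the quotient of X and Y fixes every point, its fixed point equation is a quadratic
  that vanishes identically, so the quotient is the class of a scalar matrix. Identities in the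
  group can from here on be checked on points.\<close>

lemma act_eqI:
  assumes "X \<in> carrier PSL2R" "Y \<in> carrier PSL2R" and eq: "\<And>z. z \<in> HP \<Longrightarrow> act X z = act Y z"
  shows "X = Y"
proof -
  define Z where "Z = pinv Y \<cdot> X"
  have "Z \<in> carrier PSL2R" using assms by (simp add: Z_def)
  then obtain a b c d where Z: "a * d - b * c = 1" "Z = P2 a b c d" by (rule PSL2R_cases)
  have id: "act Z z = z" if "z \<in> HP" for z
    using that assms by (simp add: Z_def act_mult)
  have "c = 0 \<and> d - a = 0 \<and> - b = 0"
  proof (rule quadratic_root_free_eq_0)
    fix z assume z: "z \<in> HP"
    show "of_real c * z\<^sup>2 + of_real (d - a) * z + of_real (- b) = 0"
      using id[OF z] den_nonzero[OF z Z(1)]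
      by (simp add: Z act_P2 divide_eq_eq power2_eq_square algebra_simps)
  qed
  moreover then have "a * a = 1" using Z(1) by auto
  then have "a = 1 \<or> a = -1" by (simp add: square_eq_1_iff)
  ultimately have "Z = \<^bold>1" by (auto simp: Z P2_one P2_eq_iff)
  then show ?thesis using assms
    by (metis PSL.inv_closed PSL.inv_equality PSL.inv_inv Z_def)
qed

text \<open>The squared norm of the matrix measures the displacement of \<open>\<i>\<close>; bounds
  on matrices and bounds on distances thus become interchangeable.\<close>

lemma hcosh_act_ii:
  assumes "a * d - b * c = 1"
  shows "2 * hcosh (act (P2 a b c d) \<i>) \<i> = a\<^sup>2 + b\<^sup>2 + c\<^sup>2 + d\<^sup>2"
proof -
  have i: "\<i> \<in> HP" by (simp add: HP_def)
  have n: "(cmod (of_real c * \<i> + of_real d))\<^sup>2 = c\<^sup>2 + d\<^sup>2" by (simp add: cmod_power2)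
  have pos: "c\<^sup>2 + d\<^sup>2 > 0"
    using den_nonzero[OF i assms] n by (metis zero_less_power2 zero_less_norm_iff power_eq_0_iff norm_eq_zero)
  have im: "Im (act (P2 a b c d) \<i>) = 1 / (c\<^sup>2 + d\<^sup>2)"
    using Im_act_P2[OF i assms] n by simp
  have "act (P2 a b c d) \<i> - \<i> = (of_real a * \<i> + of_real b - \<i> * (of_real c * \<i> + of_real d)) / (of_real c * \<i> + of_real d)"
    using den_nonzero[OF i assms] by (simp add: act_P2 diff_divide_distrib)
  then have "(cmod (act (P2 a b c d) \<i> - \<i>))\<^sup>2 = ((b + c)\<^sup>2 + (a - d)\<^sup>2) / (c\<^sup>2 + d\<^sup>2)"
    by (simp add: norm_divide power_divide n) (simp add: cmod_power2 add.commute)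
  then have "2 * hcosh (act (P2 a b c d) \<i>) \<i> = 2 + ((b + c)\<^sup>2 + (a - d)\<^sup>2)"
    using pos by (simp add: hcosh_def im field_simps)
  also have "\<dots> = a\<^sup>2 + b\<^sup>2 + c\<^sup>2 + d\<^sup>2 + 2 * (1 - (a * d - b * c))"
    by (simp add: power2_eq_square algebra_simps)
  finally show ?thesis by (simp add: assms)
qed

section \<open>Classification of isometries by their fixed points\<close>

definition elliptic :: "(real^2^2) set \<Rightarrow> bool" where
  "elliptic X \<longleftrightarrow> (\<exists>z\<in>HP. act X z = z)"

definition parabolic_along :: "(real^2^2) set \<Rightarrow> real \<Rightarrow> (real^2^2) set \<Rightarrow> bool" where
  "parabolic_along k s X \<longleftrightarrow> k \<in> carrier PSL2R \<and> s \<noteq> 0 \<and>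
     (\<forall>z\<in>HP. act X (act k z) = act k (z + of_real s))"

text \<open>The condition \<open>\<mu> > 1\<close> orients the axis: \<open>act k\<close> carries
  the imaginary axis, run upwards, to the axis of X, run in the direction in which X
  translates.\<close>

definition hyperbolic_along :: "(real^2^2) set \<Rightarrow> real \<Rightarrow> (real^2^2) set \<Rightarrow> bool" where
  "hyperbolic_along k \<mu> X \<longleftrightarrow> k \<in> carrier PSL2R \<and> \<mu> > 1 \<and>
     (\<forall>z\<in>HP. act X (act k z) = act k (of_real \<mu> * z))"

lemma HP_translate [simp]: "z \<in> HP \<Longrightarrow> z + of_real s \<in> HP"
  by (simp add: HP_def)

lemma HP_scale [simp]: "z \<in> HP \<Longrightarrow> t > 0 \<Longrightarrow> of_real t * z \<in> HP"
  by (simp add: HP_def)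

lemma trichotomy_fixing_infinity:
  assumes 1: "a * d = 1" and X: "X = P2 a b 0 d"
  shows "elliptic X \<or> (\<exists>k s. parabolic_along k s X) \<or> (\<exists>k \<mu>. hyperbolic_along k \<mu> X)"
proof -
  have a0: "a \<noteq> 0" "d = 1 / a" using 1 by (auto simp: eq_divide_eq mult.commute)
  have act: "act X z = of_real (a\<^sup>2) * z + of_real (a * b)" for z
    using a0(1) unfolding X act_P2 a0(2) by (simp add: field_simps power2_eq_square)
  consider "a\<^sup>2 = 1" "b = 0" | "a\<^sup>2 = 1" "b \<noteq> 0" | "a\<^sup>2 > 1" | "a\<^sup>2 < 1" by linarith
  then show ?thesis
  proof cases
    case 1
    then have "act X \<i> = \<i>" by (simp add: act)
    then show ?thesis by (auto simp: elliptic_def HP_def)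
  next
    case 2
    then have "parabolic_along \<^bold>1 (a * b) X"
      using a0 by (simp add: parabolic_along_def act)
    then show ?thesis by blast
  next
    case 3
    \<comment> \<open>The finite fixed point of z -> a^2 z + a b.\<close>
    define p where "p = a * b / (1 - a\<^sup>2)"
    have "p * (1 - a\<^sup>2) = a * b" using 3 by (simp add: p_def)
    then have p: "a * b = p - a\<^sup>2 * p" by (simp add: algebra_simps)
    have "hyperbolic_along (P2 1 p 0 1) (a\<^sup>2) X"
      using 3 unfolding hyperbolic_along_def act act_P2 p by (auto intro!: P2_carrier simp: algebra_simps)
    then show ?thesis by blast
  next
    case 4
    define p where "p = a * b / (1 - a\<^sup>2)"
    have "p * (1 - a\<^sup>2) = a * b" using 4 by (simp add: p_def)
    then have p: "a * b = p - a\<^sup>2 * p" by (simp add: algebra_simps)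
    \<comment> \<open>Here p attracts and infinity repels. The map z -> p - 1/z sends infinity to p,
      which replaces the factor by its inverse and makes it exceed 1.\<close>
    have "act X (act (P2 p (-1) 1 0) z) = act (P2 p (-1) 1 0) (of_real (1 / a\<^sup>2) * z)" if "z \<in> HP" for z
    proof -
      have "z \<noteq> 0" using that by (auto simp: HP_def)
      then show ?thesis using a0 unfolding act act_P2 p by (simp add: field_simps power2_eq_square)
    qed
    moreover have "1 / a\<^sup>2 > 1" using 4 a0 by (simp add: field_simps)
    ultimately have "hyperbolic_along (P2 p (-1) 1 0) (1 / a\<^sup>2) X"
      unfolding hyperbolic_along_def by (auto intro!: P2_carrier)
    then show ?thesis by blast
  qed
qed

lemma act_conj:
  assumes "k \<in> carrier PSL2R" "X \<in> carrier PSL2R" "z \<in> HP"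
  shows "act X (act k z) = act k (act (pinv k \<cdot> X \<cdot> k) z)"
  using assms by (simp add: act_mult act_HP)

text \<open>The fixed point equation c z^2 + (d - a) z - b = 0 has discriminant (a + d)^2 - 4. If it
  is negative, a root lies in the upper half-plane; otherwise a real root is conjugated to infinity
  and the matrix becomes triangular. The identity counts as elliptic.\<close>

lemma trichotomy:
  assumes "X \<in> carrier PSL2R"
  shows "elliptic X \<or> (\<exists>k s. parabolic_along k s X) \<or> (\<exists>k \<mu>. hyperbolic_along k \<mu> X)"
proof -
  obtain a b c d where 1: "a * d - b * c = 1" and X: "X = P2 a b c d" using assms by (rule PSL2R_cases)
  consider "c = 0" | "c \<noteq> 0" "(a + d)\<^sup>2 < 4" | "c \<noteq> 0" "(a + d)\<^sup>2 \<ge> 4" by linarith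
  then show ?thesis
  proof cases
    case 1
    then show ?thesis using trichotomy_fixing_infinity[of a d X b] \<open>a * d - b * c = 1\<close> X by simp
  next
    case 2
    define q where "q = sqrt (4 - (a + d)\<^sup>2)"
    have q: "q > 0" "q\<^sup>2 = 4 - (a + d)\<^sup>2" using 2 by (auto simp: q_def)
    define z where "z = Complex ((a - d) / (2 * c)) (q / (2 * \<bar>c\<bar>))"
    have z: "z \<in> HP" using q 2 by (simp add: z_def HP_def)
    have "of_real a * z + of_real b = z * (of_real c * z + of_real d)"
    proof (rule complex_eqI)
      have cc: "\<bar>c\<bar> * \<bar>c\<bar> = c * c" by simp
      have bc: "b * c = a * d - 1" using 1 by simp
      have "4 * c * (a * ((a-d)/(2*c)) + b) = 2 * a * (a - d) + 4 * (b * c)"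
        using 2 by (simp add: field_simps)
      also have "\<dots> = (a - d) * (a - d) + 2 * d * (a - d) - q\<^sup>2"
        unfolding bc q(2) by (simp add: power2_eq_square algebra_simps)
      also have "\<dots> = 4 * c * (((a-d)/(2*c)) * (c * ((a-d)/(2*c)) + d) - (q / (2 * \<bar>c\<bar>)) * (c * (q / (2 * \<bar>c\<bar>))))"
        using 2 cc by (simp add: field_simps power2_eq_square)
      finally show "Re (of_real a * z + of_real b) = Re (z * (of_real c * z + of_real d))"
        using 2 by (simp add: z_def)
      show "Im (of_real a * z + of_real b) = Im (z * (of_real c * z + of_real d))"
        using 2 by (simp add: z_def field_simps)
    qed
    then have "act X z = z"
      using den_nonzero[OF z \<open>a * d - b * c = 1\<close>] by (simp add: X act_P2 divide_eq_eq)
    with z show ?thesis by (auto simp: elliptic_def)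
  next
    case 3
    define p where "p = ((a - d) + sqrt ((a + d)\<^sup>2 - 4)) / (2 * c)"
    have "(2 * c * p - (a - d))\<^sup>2 = (a + d)\<^sup>2 - 4" using 3 by (simp add: p_def)
    then have "4 * c * (c * p * p + (d - a) * p - b) = 4 * (a * d - b * c) - 4"
      by (simp add: power2_eq_square algebra_simps)
    then have root: "c * p * p + (d - a) * p - b = 0" using 1 3 by simp
    \<comment> \<open>The map z -> p - 1/z takes infinity to the fixed point p.\<close>
    define k where "k = P2 p (-1) 1 0"
    have k: "k \<in> carrier PSL2R" by (simp add: k_def P2_carrier)
    define Y where "Y = pinv k \<cdot> X \<cdot> k"
    have "pinv k \<cdot> X = P2 c d (p * c - a) (p * d - b)"
      using 1 by (simp add: k_def X P2_inv P2_mult algebra_simps)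
    moreover have "c * (p * d - b) - d * (p * c - a) = 1" using 1 by (simp add: algebra_simps)
    ultimately have Y: "Y = P2 (c * p + d) (- c) 0 (a - p * c)"
      using root by (simp add: Y_def k_def P2_mult algebra_simps)
    have "(c * p + d) * (a - p * c) = (a * d - b * c) - c * (c * p * p + (d - a) * p - b)"
      by (simp add: algebra_simps)
    then have det: "(c * p + d) * (a - p * c) = 1" using root \<open>a * d - b * c = 1\<close> by simp
    have conj: "act X (act k z) = act k (act Y z)" if "z \<in> HP" for z
      using act_conj[OF k assms that] by (simp add: Y_def)
    have kk: "act (k \<cdot> l) z = act k (act l z)" if "z \<in> HP" "l \<in> carrier PSL2R" for l z
      using that k by (simp add: act_mult)
    from trichotomy_fixing_infinity[OF det Y] show ?thesis
    proof (elim disjE exE)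
      assume "elliptic Y"
      then obtain z where z: "z \<in> HP" "act Y z = z" by (auto simp: elliptic_def)
      have "act X (act k z) = act k z" using conj[OF z(1)] z(2) by simp
      then show ?thesis using act_HP[OF k z(1)] by (auto simp: elliptic_def)
    next
      fix l s assume l: "parabolic_along l s Y"
      then have "parabolic_along (k \<cdot> l) s X"
        using k by (auto simp: parabolic_along_def kk conj act_HP)
      then show ?thesis by blast
    next
      fix l \<mu> assume l: "hyperbolic_along l \<mu> Y"
      then have "hyperbolic_along (k \<cdot> l) \<mu> X"
        using k by (auto simp: hyperbolic_along_def kk conj act_HP)
      then show ?thesis by blast
    qed
  qed
qed

lemma affine_map_exists:
  assumes "t > 0" shows "\<exists>k\<in>carrier PSL2R. \<forall>z. act k z = of_real t * z + of_real s"
proof (rule bexI[of _ "P2 (sqrt t) (s / sqrt t) 0 (1 / sqrt t)"])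
  show "\<forall>z. act (P2 (sqrt t) (s / sqrt t) 0 (1 / sqrt t)) z = of_real t * z + of_real s"
    using assms by (auto simp: act_P2 field_simps simp flip: of_real_mult)
  show "P2 (sqrt t) (s / sqrt t) 0 (1 / sqrt t) \<in> carrier PSL2R" using assms by (simp add: P2_carrier)
qed

text \<open>The geodesic through two points is moved to the imaginary axis, so that estimates about
  two points reduce to Fermi coordinates.\<close>

lemma common_axis:
  assumes x: "x \<in> HP" and y: "y \<in> HP"
  shows "\<exists>k\<in>carrier PSL2R. \<exists>p q. act k x = imag_axis p \<and> act k y = imag_axis q \<and> p \<le> q"
proof -
  have on_axis: "z = imag_axis (ln (Im z))" if "z \<in> HP" "Re z = 0" for z
    using that by (auto simp: imag_axis_def HP_def complex_eq_iff)
  have "\<exists>k\<in>carrier PSL2R. Re (act k x) = 0 \<and> Re (act k y) = 0"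
  proof (cases "Re x = Re y")
    case True
    obtain k where "k \<in> carrier PSL2R" "\<And>z. act k z = of_real 1 * z + of_real (- Re x)"
      using affine_map_exists[of 1 "- Re x"] by auto
    then show ?thesis using True by (intro bexI[of _ k]) auto
  next
    case False
    \<comment> \<open>The real point at equal Euclidean distance from x and y, the centre of the
      semicircle through them.\<close>
    define m where "m = ((cmod x)\<^sup>2 - (cmod y)\<^sup>2) / (2 * (Re x - Re y))"
    define \<rho> where "\<rho> = cmod (x - of_real m)"
    have m: "2 * m * (Re x - Re y) = (cmod x)\<^sup>2 - (cmod y)\<^sup>2"
    proof -
      have "2 * (N / (2 * D)) * D = N" if "D \<noteq> 0" for N D :: real using that by simp
      then show ?thesis using False unfolding m_def by (metis eq_iff_diff_eq_0)
    qed
    have "x \<noteq> of_real m" using x by (auto simp: HP_def)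
    then have \<rho>: "\<rho> > 0" by (simp add: \<rho>_def)
    have \<rho>x: "(Re x - m)\<^sup>2 + (Im x)\<^sup>2 = \<rho>\<^sup>2" by (simp add: \<rho>_def cmod_power2)
    have \<rho>y: "(Re y - m)\<^sup>2 + (Im y)\<^sup>2 = \<rho>\<^sup>2"
      using m \<rho>x unfolding cmod_power2 by (simp add: power2_eq_square algebra_simps)
    define r where "r = sqrt (2 * \<rho>)"
    have r: "r > 0" "r * r = 2 * \<rho>" using \<rho> by (auto simp: r_def)
    \<comment> \<open>Sends the end m - \<rho> of the semicircle to 0 and the end m + \<rho> to
      infinity; r normalizes the determinant.\<close>
    define k where "k = P2 (1/r) ((\<rho> - m)/r) (- 1/r) ((\<rho> + m)/r)"
    have "1/r * ((\<rho> + m)/r) - (\<rho> - m)/r * (- 1/r) = (2 * \<rho>) / (r * r)"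
      by (simp add: add_divide_distrib diff_divide_distrib)
    then have k: "k \<in> carrier PSL2R" unfolding k_def
      using r \<rho> by (intro P2_carrier) simp
    have Re0: "Re (act k z) = 0" if "(Re z - m)\<^sup>2 + (Im z)\<^sup>2 = \<rho>\<^sup>2" "z \<in> HP" for z
    proof -
      have "Re ((of_real (1/r) * z + of_real ((\<rho> - m)/r)) * cnj (of_real (- 1/r) * z + of_real ((\<rho> + m)/r)))
         = (\<rho>\<^sup>2 - ((Re z - m)\<^sup>2 + (Im z)\<^sup>2)) / r\<^sup>2"
        using r(1) by (simp add: field_simps power2_eq_square)
      then show ?thesis unfolding k_def act_P2 complex_div_cnj[of "of_real (1/r) * z + _"]
        using that(1) by (simp only: Re_divide_of_real flip: of_real_power) simp
    qed
    show ?thesis by (rule bexI[OF _ k]) (use Re0 \<rho>x \<rho>y x y in auto)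
  qed
  then obtain k where k: "k \<in> carrier PSL2R" "Re (act k x) = 0" "Re (act k y) = 0" by blast
  obtain p q where pq: "act k x = imag_axis p" "act k y = imag_axis q"
    using on_axis[OF act_HP[OF k(1) x] k(2)] on_axis[OF act_HP[OF k(1) y] k(3)] by blast
  show ?thesis
  proof (cases "p \<le> q")
    case True
    then show ?thesis using k pq by blast
  next
    case False
    \<comment> \<open>The map z -> -1/z reverses the axis and so restores the order of p and
      q.\<close>
    define j where "j = P2 0 (-1) 1 0"
    have j: "j \<in> carrier PSL2R" by (simp add: j_def P2_carrier)
    have "act j (imag_axis u) = imag_axis (- u)" for u
      by (simp add: j_def act_P2 imag_axis_def exp_minus field_simps)
    then have "act (j \<cdot> k) x = imag_axis (-p)" "act (j \<cdot> k) y = imag_axis (-q)"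
      using j k x y pq by (simp_all add: act_mult)
    then show ?thesis using False j k by (intro bexI[of _ "j \<cdot> k"]) force+
  qed
qed

subsection \<open>Discrete groups and homogenization\<close>

text \<open>A limit point need not belong to S, so it is replaced by a member of S within
  \<delta>/2. Quotients by the centre can then be formed inside the group.\<close>

lemma infinite_bounded_accumulates:
  fixes S :: "'a::heine_borel set"
  assumes "bounded S" "infinite S" "\<delta> > 0"
  obtains x where "x \<in> S" "infinite (S \<inter> ball x \<delta>)"
proof -
  obtain l where "l islimpt S" using bounded_infinite_imp_islimpt[of S S] assms by blast
  then have inf: "infinite (S \<inter> ball l (\<delta>/2))" using assms by (simp add: islimpt_eq_infinite_ball)
  then obtain x where x: "x \<in> S" "x \<in> ball l (\<delta>/2)" by (metis Int_iff all_not_in_conv finite.emptyI)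
  have "ball l (\<delta>/2) \<subseteq> ball x \<delta>"
  proof
    fix y assume "y \<in> ball l (\<delta>/2)"
    then show "y \<in> ball x \<delta>" using x(2) dist_triangle[of x y l] by (auto simp: dist_commute)
  qed
  then have "S \<inter> ball l (\<delta>/2) \<subseteq> S \<inter> ball x \<delta>" by blast
  then have "infinite (S \<inter> ball x \<delta>)" using inf finite_subset by blast
  then show thesis using that x(1) by blast
qed

lemma norm_M2_le: "norm (M2 a b c d) \<le> \<bar>a\<bar> + \<bar>b\<bar> + \<bar>c\<bar> + \<bar>d\<bar>"
proof -
  have "norm (M2 a b c d) \<le> norm (M2 a b c d $ 1) + norm (M2 a b c d $ 2)"
    unfolding norm_vec_def[of "M2 a b c d"] using L2_set_le_sum[of UNIV "\<lambda>i. norm (M2 a b c d $ i)"]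
    by (simp add: sum_2)
  also have "norm (M2 a b c d $ 1) \<le> \<bar>a\<bar> + \<bar>b\<bar>"
    using norm_le_l1_cart[of "M2 a b c d $ 1"] by (simp add: sum_2)
  also have "norm (M2 a b c d $ 2) \<le> \<bar>c\<bar> + \<bar>d\<bar>"
    using norm_le_l1_cart[of "M2 a b c d $ 2"] by (simp add: sum_2)
  finally show ?thesis by simp
qed

lemma abs_entry_le_norm: "\<bar>A $ i $ j\<bar> \<le> norm (A :: real^2^2)"
  using component_le_norm_cart[of "A $ i" j] Finite_Cartesian_Product.norm_nth_le[of A i] by simp

lemma subgroup_PSL2R_of_discrete: "discrete_subgroup_PSL2R G \<Longrightarrow> subgroup G PSL2R"
  by (simp add: discrete_subgroup_PSL2R_def)

text \<open>An open set that meets G only in the identity is pulled back along the quotient map to a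
  neighbourhood of \<open>mat 1\<close>.\<close>

lemma discrete_isolated_one:
  assumes "discrete_subgroup_PSL2R G"
  obtains e where "e > 0"
    "\<And>A. A \<in> carrier SL2R \<Longrightarrow> PSL2R_proj A \<in> G \<Longrightarrow> norm (A - mat 1) < e \<Longrightarrow> PSL2R_proj A = \<^bold>1"
proof -
  have sub: "subgroup G PSL2R" using assms by (rule subgroup_PSL2R_of_discrete)
  have one: "\<^bold>1 = PSL2R_proj (mat 1)" by (simp add: P2_one P2_def mat_1_M2)
  have "openin (subtopology PSL2R_topology G) {\<^bold>1}"
    using assms subgroup.one_closed[OF sub] by (simp add: discrete_subgroup_PSL2R_def)
  then obtain U where U: "openin PSL2R_topology U" "{\<^bold>1} = U \<inter> G"
    by (auto simp: openin_subtopology)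
  then obtain W where W: "open W" "{A \<in> carrier SL2R. PSL2R_proj A \<in> U} = carrier SL2R \<inter> W"
    by (auto simp: openin_PSL2R_topology openin_open)
  have "mat 1 \<in> carrier SL2R" by (simp add: mat_1_M2 carrier_SL2R_M2)
  then have "mat 1 \<in> W" using W(2) U(2) one by blast
  then obtain e where e: "e > 0" "ball (mat 1) e \<subseteq> W" using W(1) open_contains_ball by blast
  show thesis
  proof (rule that[OF e(1)])
    fix A assume A: "A \<in> carrier SL2R" "PSL2R_proj A \<in> G" "norm (A - mat 1) < e"
    then have "A \<in> W" using e(2) by (auto simp: dist_norm norm_minus_commute)
    then show "PSL2R_proj A = \<^bold>1" using A(1,2) W(2) U(2) by blast
  qed
qed

text \<open>Infinitely many bounded matrices would contain two, A and A', in different classes and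
  so close that the quotient of A' by A falls into the isolating neighbourhood of the
  identity.\<close>

lemma discrete_finite_bounded:
  assumes "discrete_subgroup_PSL2R G"
  shows "finite {A \<in> carrier SL2R. PSL2R_proj A \<in> G \<and> norm A \<le> B}"
proof (rule ccontr)
  let ?S = "{A \<in> carrier SL2R. PSL2R_proj A \<in> G \<and> norm A \<le> B}"
  have sub: "subgroup G PSL2R" using assms by (rule subgroup_PSL2R_of_discrete)
  obtain e where e: "e > 0"
    "\<And>A. A \<in> carrier SL2R \<Longrightarrow> PSL2R_proj A \<in> G \<Longrightarrow> norm (A - mat 1) < e \<Longrightarrow> PSL2R_proj A = \<^bold>1"
    using discrete_isolated_one[OF assms] by blast
  define B' where "B' = max B 1"
  \<comment> \<open>Each of the four entries of the quotient differs from that of the identity by at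
    most 2 B' \<delta>; the sum 8 B' \<delta> is e/2.\<close>
  define \<delta> where "\<delta> = e / (16 * B')"
  have \<delta>: "\<delta> > 0" using e(1) by (simp add: \<delta>_def B'_def)
  assume "infinite ?S"
  moreover have "bounded ?S" by (auto simp: bounded_iff)
  ultimately obtain A where A: "A \<in> ?S" "infinite (?S \<inter> ball A \<delta>)"
    using infinite_bounded_accumulates[OF _ _ \<delta>] by blast
  obtain a b c d where Am: "A = M2 a b c d" using M2_eta[of A] by metis
  have 1: "a * d - b * c = 1" using A(1) by (simp add: Am carrier_SL2R_M2)
  \<comment> \<open>Both representatives of the class of A are removed, so that A' defines a
    different element of the group.\<close>
  have "infinite (?S \<inter> ball A \<delta> - {M2 a b c d, M2 (-a) (-b) (-c) (-d)})" using A(2) by simp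
  then obtain A' where A': "A' \<in> ?S" "A' \<in> ball A \<delta>" "A' \<noteq> M2 a b c d" "A' \<noteq> M2 (-a) (-b) (-c) (-d)"
    using infinite_imp_nonempty by blast
  obtain a' b' c' d' where Am': "A' = M2 a' b' c' d'" using M2_eta[of A'] by metis
  have det': "a' * d' - b' * c' = 1" using A'(1) by (simp add: Am' carrier_SL2R_M2)
  have "\<bar>a\<bar> \<le> B" "\<bar>b\<bar> \<le> B" "\<bar>c\<bar> \<le> B" "\<bar>d\<bar> \<le> B"
    using A(1) abs_entry_le_norm[of A 1 1] abs_entry_le_norm[of A 1 2] abs_entry_le_norm[of A 2 1]
      abs_entry_le_norm[of A 2 2] by (auto simp: Am)
  then have small: "\<bar>a\<bar> \<le> B'" "\<bar>b\<bar> \<le> B'" "\<bar>c\<bar> \<le> B'" "\<bar>d\<bar> \<le> B'" by (auto simp: B'_def)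
  have "norm (A' - A) < \<delta>" using A'(2) by (simp add: dist_norm norm_minus_commute)
  then have close: "\<bar>a' - a\<bar> \<le> \<delta>" "\<bar>b' - b\<bar> \<le> \<delta>" "\<bar>c' - c\<bar> \<le> \<delta>" "\<bar>d' - d\<bar> \<le> \<delta>"
    using abs_entry_le_norm[of "A' - A" 1 1] abs_entry_le_norm[of "A' - A" 1 2]
      abs_entry_le_norm[of "A' - A" 2 1] abs_entry_le_norm[of "A' - A" 2 2] by (auto simp: Am Am')
  \<comment> \<open>Q is the inverse of A times A'.\<close>
  define Q where "Q = M2 (d * a' - b * c') (d * b' - b * d') (a * c' - c * a') (a * d' - c * b')"
  have "(d * a' - b * c') * (a * d' - c * b') - (d * b' - b * d') * (a * c' - c * a')
      = (a * d - b * c) * (a' * d' - b' * c')"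
    by (simp add: algebra_simps)
  then have Q: "Q \<in> carrier SL2R" using 1 det' unfolding Q_def carrier_SL2R_M2 by simp
  have PQ: "PSL2R_proj Q = pinv (P2 a b c d) \<cdot> P2 a' b' c' d'"
    using P2_mult[of d a "- b" "- c" a' d' b' c'] 1 det'
    by (simp add: P2_inv Q_def P2_def[symmetric] mult.commute)
  have "P2 a b c d \<in> G" "P2 a' b' c' d' \<in> G" using A(1) A'(1) by (simp_all add: Am Am' P2_def)
  then have PQG: "PSL2R_proj Q \<in> G" unfolding PQ using sub
    by (simp add: subgroup.m_closed subgroup.m_inv_closed)
  have *: "\<bar>x * u - y * v\<bar> \<le> 2 * B' * \<delta>" if "\<bar>x\<bar> \<le> B'" "\<bar>y\<bar> \<le> B'" "\<bar>u\<bar> \<le> \<delta>" "\<bar>v\<bar> \<le> \<delta>" for x y u v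
  proof -
    have "\<bar>x * u\<bar> \<le> B' * \<delta>" "\<bar>y * v\<bar> \<le> B' * \<delta>"
      unfolding abs_mult using that by (intro mult_mono; simp)+
    then show ?thesis by linarith
  qed
  have eq: "Q - mat 1 = M2 (d * (a' - a) - b * (c' - c)) (d * (b' - b) - b * (d' - d))
      (a * (c' - c) - c * (a' - a)) (a * (d' - d) - c * (b' - b))"
    using 1 by (simp add: vec_eq_iff forall_2 Q_def mat_1_M2) (simp add: algebra_simps)
  have "norm (Q - mat 1) \<le> 2 * B' * \<delta> + 2 * B' * \<delta> + 2 * B' * \<delta> + 2 * B' * \<delta>"
    unfolding eq using norm_M2_le[of "d * (a' - a) - b * (c' - c)" "d * (b' - b) - b * (d' - d)"
      "a * (c' - c) - c * (a' - a)" "a * (d' - d) - c * (b' - b)"]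
      *[OF small(4,2) close(1,3)] *[OF small(4,2) close(2,4)] *[OF small(1,3) close(3,1)] *[OF small(1,3) close(4,2)]
    by linarith
  also have "\<dots> < e" using e(1) by (simp add: \<delta>_def B'_def)
  finally have "PSL2R_proj Q = \<^bold>1" by (rule e(2)[OF Q PQG])
  then have "pinv (P2 a b c d) \<cdot> P2 a b c d = pinv (P2 a b c d) \<cdot> P2 a' b' c' d'"
    by (simp add: PQ P2_carrier 1)
  then have "P2 a b c d = P2 a' b' c' d'"
    using PSL.Units_l_cancel[of "pinv (P2 a b c d)" "P2 a b c d" "P2 a' b' c' d'"]
    by (simp add: P2_carrier 1 det')
  then show False using A'(3,4) by (auto simp: P2_eq_iff Am')
qed

text \<open>Proper discontinuity of the action is the only form in which discreteness is used from
  here on.\<close>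

locale fuchsian =
  fixes G :: "(real^2^2) set set"
  assumes subgroup: "subgroup G PSL2R"
    and finite_orbit: "\<And>z w B. z \<in> HP \<Longrightarrow> w \<in> HP \<Longrightarrow> finite {X \<in> G. hdist (act X z) w \<le> B}"

text \<open>By the triangle inequality a bound on the distance from X z to w bounds the displacement
  of \<open>\<i>\<close>, hence, by \<open>hcosh_act_ii\<close>, the entries of X.\<close>

lemma fuchsian_of_discrete:
  assumes "discrete_subgroup_PSL2R G"
  shows "fuchsian G"
proof (rule fuchsian.intro)
  show sub: "subgroup G PSL2R" using assms by (rule subgroup_PSL2R_of_discrete)
  fix z w B assume z: "z \<in> HP" and w: "w \<in> HP"
  have i: "\<i> \<in> HP" by (simp add: HP_def)
  define B' where "B' = hdist \<i> z + B + hdist w \<i>"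
  define C where "C = 4 * (2 * cosh B' + 1)"
  have "{X \<in> G. hdist (act X z) w \<le> B} \<subseteq> PSL2R_proj ` {A \<in> carrier SL2R. PSL2R_proj A \<in> G \<and> norm A \<le> C}"
  proof clarify
    fix X assume X: "X \<in> G" "hdist (act X z) w \<le> B"
    have XP: "X \<in> carrier PSL2R" by (rule subgroup.mem_carrier[OF sub X(1)])
    obtain a b c d where 1: "a * d - b * c = 1" and Xm: "X = P2 a b c d" using XP by (rule PSL2R_cases)
    note HP = act_HP[OF XP i] act_HP[OF XP z]
    have "hdist (act X \<i>) \<i> \<le> B'"
      using hdist_triangle[OF HP(1) HP(2) i] hdist_triangle[OF HP(2) w i] hdist_act[OF XP i z] X(2)
      by (simp add: B'_def)
    then have "cosh (hdist (act X \<i>) \<i>) \<le> cosh B'"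
      using hdist_nonneg[OF HP(1) i] cosh_real_nonneg_le_iff by (meson order_trans)
    then have "hcosh (act X \<i>) \<i> \<le> cosh B'" by (simp add: cosh_hdist HP i)
    then have "a\<^sup>2 + b\<^sup>2 + c\<^sup>2 + d\<^sup>2 \<le> 2 * cosh B'"
      using hcosh_act_ii[OF 1] by (simp add: Xm)
    then have sq: "a\<^sup>2 \<le> 2 * cosh B'" "b\<^sup>2 \<le> 2 * cosh B'" "c\<^sup>2 \<le> 2 * cosh B'" "d\<^sup>2 \<le> 2 * cosh B'"
      using zero_le_power2[of a] zero_le_power2[of b] zero_le_power2[of c] zero_le_power2[of d] by linarith+
    have le: "\<bar>x\<bar> \<le> x\<^sup>2 + 1" for x :: real
    proof -
      have "0 \<le> (\<bar>x\<bar> - 1)\<^sup>2 + \<bar>x\<bar>" by simp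
      then show ?thesis by (simp add: power2_eq_square algebra_simps)
    qed
    have "norm (M2 a b c d) \<le> C"
      using norm_M2_le[of a b c d] sq le[of a] le[of b] le[of c] le[of d] by (simp add: C_def)
    then show "X \<in> PSL2R_proj ` {A \<in> carrier SL2R. PSL2R_proj A \<in> G \<and> norm A \<le> C}"
      using X(1) 1 by (auto simp: Xm P2_def carrier_SL2R_M2 intro!: imageI)
  qed
  then show "finite {X \<in> G. hdist (act X z) w \<le> B}"
    using discrete_finite_bounded[OF assms] finite_subset by blast
qed

section \<open>Homogenization of quasi-morphisms\<close>

lemma (in group) homogenization:
  assumes f: "\<And>x y. x \<in> carrier G \<Longrightarrow> y \<in> carrier G \<Longrightarrow> \<bar>f (x \<otimes> y) - f x - f y\<bar> \<le> C"
  obtains r where "homogeneous_quasi_morphism G r" "\<And>x. x \<in> carrier G \<Longrightarrow> \<bar>r x - f x\<bar> \<le> C"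
proof -
  have C0: "C \<ge> 0" using f[OF one_closed one_closed] by linarith
  have mult: "\<bar>f (x [^] (m * Suc n)) - real (Suc n) * f (x [^] m)\<bar> \<le> real n * C"
    if x: "x \<in> carrier G" for x and m n :: nat
  proof (induction n)
    case (Suc n)
    have "x [^] (m * Suc (Suc n)) = x [^] (m * Suc n) \<otimes> x [^] m"
      using x by (simp add: nat_pow_mult add.commute add.left_commute)
    then show ?case using f[of "x [^] (m * Suc n)" "x [^] m"] Suc x
      by (simp add: algebra_simps)
  qed simp
  \<comment> \<open>Both quotients are compared with the one for the exponent m n. With n = 1 this
    bounds the distance from f itself, after the limit in m.\<close>
  have close: "\<bar>f (x [^] m) / m - f (x [^] n) / n\<bar> \<le> C / m + C / n"
    if x: "x \<in> carrier G" and "m > 0" "n > 0" for x and m n :: nat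
  proof -
    have half: "\<bar>f (x [^] (m * n)) / (m * n) - f (x [^] m) / m\<bar> \<le> C / m" if "m > 0" "n > 0" for m n :: nat
    proof -
      have "\<bar>f (x [^] (m * n)) - real n * f (x [^] m)\<bar> \<le> real n * C"
        using mult[OF x, of m "n - 1"] that C0 mult_right_mono[of "real n - 1" "real n" C] by (simp add: of_nat_diff)
      moreover have "f (x [^] (m * n)) / (m * n) - f (x [^] m) / m = (f (x [^] (m * n)) - real n * f (x [^] m)) / (m * n)"
        using that by (simp add: field_simps)
      moreover have "real n * C / (real m * real n) = C / m" using that by simp
      ultimately show ?thesis
        using divide_right_mono[of "\<bar>f (x [^] (m * n)) - real n * f (x [^] m)\<bar>" "real n * C" "real m * real n"]
        by (simp add: abs_divide)
    qed
    show ?thesis using half[of m n] half[of n m] that by (simp add: mult.commute)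
  qed
  have conv: "convergent (\<lambda>n. f (x [^] Suc n) / Suc n)" if x: "x \<in> carrier G" for x
  proof (rule Cauchy_convergent, rule metric_CauchyI)
    fix e :: real assume e: "e > 0"
    obtain N :: nat where N: "2 * C / e < N" using reals_Archimedean2 by blast
    have N0: "N > 0"
    proof (rule ccontr)
      assume "\<not> N > 0"
      then show False using N C0 e by (simp add: divide_less_0_iff)
    qed
    have small: "C / Suc n < e / 2" if "n \<ge> N" for n
    proof -
      have "2 * C < e * N" using N e by (simp add: field_simps)
      also have "\<dots> \<le> e * Suc n" using that e by simp
      finally show ?thesis by (simp add: field_simps)
    qed
    show "\<exists>M. \<forall>m\<ge>M. \<forall>n\<ge>M. dist (f (x [^] Suc m) / Suc m) (f (x [^] Suc n) / Suc n) < e"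
    proof (intro exI allI impI)
      fix m n assume "m \<ge> N" "n \<ge> N"
      then show "dist (f (x [^] Suc m) / Suc m) (f (x [^] Suc n) / Suc n) < e"
        using close[OF x, of "Suc m" "Suc n"] small[of m] small[of n] unfolding dist_real_def by linarith
    qed
  qed
  \<comment> \<open>The exponent \<open>Suc n\<close> avoids division by zero.\<close>
  define r where "r x = lim (\<lambda>n. f (x [^] Suc n) / Suc n)" for x
  have lim: "(\<lambda>n. f (x [^] Suc n) / Suc n) \<longlonglongrightarrow> r x" if "x \<in> carrier G" for x
    using conv[OF that] by (simp add: r_def convergent_LIMSEQ_iff)
  have rf: "\<bar>r x - f x\<bar> \<le> C" if x: "x \<in> carrier G" for x
  proof -
    have "(\<lambda>n. \<bar>f (x [^] Suc n) / Suc n - f x\<bar>) \<longlonglongrightarrow> \<bar>r x - f x\<bar>"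
      by (intro tendsto_intros lim x)
    moreover have "(\<lambda>n. C / Suc n + C) \<longlonglongrightarrow> 0 + C"
      by (intro tendsto_intros LIMSEQ_Suc lim_const_over_n)
    ultimately show ?thesis
      using close[OF x, of "Suc n" 1 for n] x by (auto intro!: LIMSEQ_le)
  qed
  have pow: "r (x [^] k) = real k * r x" if x: "x \<in> carrier G" for x and k :: nat
  proof (cases "k = 0")
    case True
    have "(\<lambda>n. f \<one> / Suc n) \<longlonglongrightarrow> 0" by (intro LIMSEQ_Suc lim_const_over_n)
    then show ?thesis using LIMSEQ_unique[OF _ lim[OF one_closed]] True by simp
  next
    case False
    \<comment> \<open>The exponents k (n + 1), shifted by one to match \<open>Suc\<close> in the
      definition of r.\<close>
    define m where "m n = k * Suc n - 1" for n
    have m: "Suc (m n) = k * Suc n" for n using False by (simp add: m_def)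
    have "strict_mono m"
      by (rule strict_monoI_Suc) (use False in \<open>simp add: m_def\<close>)
    from LIMSEQ_subseq_LIMSEQ[OF lim[OF x] this]
    have "(\<lambda>n. real k * (f (x [^] Suc (m n)) / Suc (m n))) \<longlonglongrightarrow> real k * r x"
      by (intro tendsto_intros) (simp add: o_def)
    moreover have "real k * (f (x [^] Suc (m n)) / Suc (m n)) = f ((x [^] k) [^] Suc n) / Suc n" for n
      unfolding m nat_pow_pow[OF x] using False by (simp del: of_nat_Suc mult_Suc_right)
    ultimately have "(\<lambda>n. f ((x [^] k) [^] Suc n) / Suc n) \<longlonglongrightarrow> real k * r x"
      by (simp only:)
    then show ?thesis using LIMSEQ_unique[OF lim] x nat_pow_closed by blast
  qed
  \<comment> \<open>f at the n-th power of x and at its inverse add up to a bounded number.\<close>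
  have inv: "r (inv x) = - r x" if x: "x \<in> carrier G" for x
  proof -
    have "(\<lambda>n. f (x [^] Suc n) / Suc n + f (inv x [^] Suc n) / Suc n) \<longlonglongrightarrow> r x + r (inv x)"
      using x by (intro tendsto_intros lim) auto
    moreover have "(\<lambda>n. f (x [^] Suc n) / Suc n + f (inv x [^] Suc n) / Suc n) \<longlonglongrightarrow> 0"
    proof (rule tendsto_rabs_zero_cancel, rule tendsto_sandwich)
      show "(\<lambda>n. 0::real) \<longlonglongrightarrow> 0" by simp
      show "(\<lambda>n. (C + \<bar>f \<one>\<bar>) / Suc n) \<longlonglongrightarrow> 0" by (intro LIMSEQ_Suc lim_const_over_n)
      have "\<bar>f (x [^] n) / n + f (inv x [^] n) / n\<bar> \<le> (C + \<bar>f \<one>\<bar>) / n" for n :: nat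
      proof -
        have "x [^] n \<otimes> inv x [^] n = \<one>" using x by (simp add: nat_pow_inv)
        then have "\<bar>f (x [^] n) + f (inv x [^] n)\<bar> \<le> C + \<bar>f \<one>\<bar>"
          using f[of "x [^] n" "inv x [^] n"] x by auto
        then have "\<bar>f (x [^] n) + f (inv x [^] n)\<bar> / n \<le> (C + \<bar>f \<one>\<bar>) / n"
          by (rule divide_right_mono) simp
        then show ?thesis by (simp add: add_divide_distrib[symmetric] abs_divide)
      qed
      then show "\<forall>\<^sub>F n in sequentially. \<bar>f (x [^] Suc n) / Suc n + f (inv x [^] Suc n) / Suc n\<bar> \<le> (C + \<bar>f \<one>\<bar>) / Suc n"
        by (intro always_eventually allI)
    qed simp
    ultimately show ?thesis using LIMSEQ_unique by fastforce
  qed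
  have "r (x [^] (n::int)) = of_int n * r x" if x: "x \<in> carrier G" for x n
  proof (cases n rule: int_cases2)
    case (nonneg k)
    then show ?thesis using pow[OF x] by (simp add: int_pow_int)
  next
    case (nonpos k)
    then show ?thesis using pow[OF x] inv x by (simp add: int_pow_neg_int)
  qed
  moreover have "\<bar>r (x \<otimes> y) - r x - r y\<bar> \<le> 4 * C" if "x \<in> carrier G" "y \<in> carrier G" for x y
    using rf[OF that(1)] rf[OF that(2)] rf[OF m_closed[OF that]] f[OF that] by linarith
  ultimately have "homogeneous_quasi_morphism G r"
    unfolding homogeneous_quasi_morphism_def quasi_morphism_def by blast
  then show thesis using that rf by blast
qed

context fuchsian
begin

abbreviation Gamma :: "(real^2^2) set monoid" ("\<Gamma>") where
  "\<Gamma> \<equiv> PSL2R\<lparr>carrier := G\<rparr>"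

lemma group_Gamma: "group \<Gamma>"
  using subgroup group_PSL2R by (rule subgroup.subgroup_is_group)

lemma G_PSL: "X \<in> G \<Longrightarrow> X \<in> carrier PSL2R"
  using subgroup by (rule subgroup.mem_carrier)

lemma mult_G: "X \<in> G \<Longrightarrow> Y \<in> G \<Longrightarrow> X \<cdot> Y \<in> G"
  using subgroup by (rule subgroup.m_closed)

lemma inv_G: "X \<in> G \<Longrightarrow> pinv X \<in> G"
  using subgroup by (rule subgroup.m_inv_closed)

lemma one_G: "\<^bold>1 \<in> G"
  using subgroup by (rule subgroup.one_closed)

lemma int_pow_G: "X \<in> G \<Longrightarrow> X \<^bold>^ (n::int) \<in> G"
  using subgroup by (rule PSL.subgroup_int_pow_closed)

lemma nat_pow_G: "X \<in> G \<Longrightarrow> X \<^bold>^ (n::nat) \<in> G"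
  using int_pow_G[of X "int n"] by (simp add: int_pow_int)

text \<open>By invariance \<open>R \<i> (act g \<i>)\<close> is a quasi-morphism in g. The growth
  estimate holds from every base point, so each g can be evaluated where it acts most simply: at a
  fixed point, on its axis, or high above its cusp.\<close>

lemma quasi_cocycle_homogenization:
  assumes inv: "\<And>g x y. g \<in> G \<Longrightarrow> x \<in> HP \<Longrightarrow> y \<in> HP \<Longrightarrow> R (act g x) (act g y) = R x y"
    and cocycle: "\<And>x y z. x \<in> HP \<Longrightarrow> y \<in> HP \<Longrightarrow> z \<in> HP \<Longrightarrow> \<bar>R x z - R x y - R y z\<bar> \<le> C"
  obtains r where "homogeneous_quasi_morphism \<Gamma> r"
    "\<And>g x. g \<in> G \<Longrightarrow> x \<in> HP \<Longrightarrow>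
      \<exists>B. \<forall>n::nat. \<bar>R x (act (g \<^bold>^ n) x) - real n * r g\<bar> \<le> B"
proof -
  have i: "\<i> \<in> HP" by (simp add: HP_def)
  define f where "f g = R \<i> (act g \<i>)" for g
  have "\<bar>f (g \<otimes>\<^bsub>\<Gamma>\<^esub> k) - f g - f k\<bar> \<le> C" if "g \<in> carrier \<Gamma>" "k \<in> carrier \<Gamma>" for g k
  proof -
    have gk: "g \<in> G" "k \<in> G" using that by simp_all
    show ?thesis using cocycle[OF i act_HP[OF G_PSL[OF gk(1)] i] act_HP[OF G_PSL[OF gk(1)] act_HP[OF G_PSL[OF gk(2)] i]]]
      inv[OF gk(1) i act_HP[OF G_PSL[OF gk(2)] i]] gk
      by (simp add: f_def act_mult G_PSL i)
  qed
  then obtain r where r: "homogeneous_quasi_morphism \<Gamma> r" "\<And>x. x \<in> G \<Longrightarrow> \<bar>r x - f x\<bar> \<le> C"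
    using group.homogenization[OF group_Gamma, of f C] by auto
  show thesis
  proof (rule that[OF r(1)])
    fix g x assume g: "g \<in> G" and x: "x \<in> HP"
    have "\<bar>R x (act (g \<^bold>^ n) x) - real n * r g\<bar> \<le> \<bar>R x \<i>\<bar> + \<bar>R \<i> x\<bar> + 3 * C" for n :: nat
    proof -
      define k where "k = g \<^bold>^ n"
      have k: "k \<in> G" using g by (simp add: k_def nat_pow_G)
      have "k = g [^]\<^bsub>\<Gamma>\<^esub> (int n)"
        using PSL.int_pow_consistent[OF subgroup g, of "int n"] by (simp add: k_def int_pow_int)
      then have "r k = n * r g" using r(1) g by (simp add: homogeneous_quasi_morphism_def)
      then have "\<bar>f k - n * r g\<bar> \<le> C" using r(2)[OF k] by (simp add: abs_minus_commute)
      moreover have ki: "act k \<i> \<in> HP" and kx: "act k x \<in> HP" using G_PSL[OF k] i x by (auto intro: act_HP)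
      ultimately show ?thesis
        using cocycle[OF x i kx] cocycle[OF i ki kx] inv[OF k i x]
        by (simp add: f_def flip: k_def)
    qed
    then show "\<exists>B. \<forall>n::nat. \<bar>R x (act (g \<^bold>^ n) x) - real n * r g\<bar> \<le> B" by blast
  qed
qed

end

subsection \<open>A path metric with shortcuts\<close>

text \<open>Pairs are directed. The bound \<open>L \<ge> 2\<close> makes the reduced cost
  \<open>L - 1\<close> at least half of the length, so cost and length of a move are
  comparable.\<close>

definition shortcut_set :: "real \<Rightarrow> (complex \<times> complex) set \<Rightarrow> bool" where
  "shortcut_set L E \<longleftrightarrow> L \<ge> 2 \<and> (\<forall>(u, v)\<in>E. u \<in> HP \<and> v \<in> HP \<and> hdist u v = L)"

definition move :: "(complex \<times> complex) set \<Rightarrow> complex \<Rightarrow> complex \<Rightarrow> bool" where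
  "move E u v \<longleftrightarrow> u \<in> HP \<and> v \<in> HP \<and> ((u, v) \<in> E \<or> hdist u v \<le> 1)"

definition move_cost :: "real \<Rightarrow> (complex \<times> complex) set \<Rightarrow> complex \<Rightarrow> complex \<Rightarrow> real" where
  "move_cost L E u v = (if (u, v) \<in> E then L - 1 else hdist u v)"

definition move_chain :: "(complex \<times> complex) set \<Rightarrow> complex \<Rightarrow> complex \<Rightarrow> (nat \<Rightarrow> complex) \<Rightarrow> nat \<Rightarrow> bool" where
  "move_chain E x y f n \<longleftrightarrow> f 0 = x \<and> f n = y \<and> (\<forall>k<n. move E (f k) (f (Suc k)))"

definition chain_cost :: "real \<Rightarrow> (complex \<times> complex) set \<Rightarrow> (nat \<Rightarrow> complex) \<Rightarrow> nat \<Rightarrow> real" where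
  "chain_cost L E f n = (\<Sum>k<n. move_cost L E (f k) (f (Suc k)))"

definition sdist :: "real \<Rightarrow> (complex \<times> complex) set \<Rightarrow> complex \<Rightarrow> complex \<Rightarrow> real" where
  "sdist L E x y = Inf {chain_cost L E f n | f n. move_chain E x y f n}"

lemma shortcut_setD:
  assumes "shortcut_set L E" "(u, v) \<in> E"
  shows "u \<in> HP" "v \<in> HP" "hdist u v = L"
  using assms by (auto simp: shortcut_set_def)

lemma step_bounds:
  assumes S: "shortcut_set L E" and st: "move E u v"
  shows "u \<in> HP" "v \<in> HP" "hdist u v \<le> L" "0 \<le> move_cost L E u v" "move_cost L E u v \<le> hdist u v"
    "hdist u v \<le> 2 * move_cost L E u v"
proof -
  show u: "u \<in> HP" and v: "v \<in> HP" using st by (auto simp: move_def)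
  show "hdist u v \<le> L" "0 \<le> move_cost L E u v" "move_cost L E u v \<le> hdist u v" "hdist u v \<le> 2 * move_cost L E u v"
    using S st hdist_nonneg[OF u v] by (auto simp: shortcut_set_def move_def move_cost_def)
qed

lemma chain_HP:
  assumes "move_chain E x y f n" "n > 0" "k \<le> n"
  shows "f k \<in> HP"
proof (cases "k < n")
  case True
  then show ?thesis using assms by (auto simp: move_chain_def move_def)
next
  case False
  then have "k - 1 < n" "Suc (k - 1) = k" using assms by auto
  then have "move E (f (k - 1)) (f k)" using assms(1) unfolding move_chain_def by metis
  then show ?thesis by (simp add: move_def)
qed

lemma chain_cost_nonneg:
  assumes "shortcut_set L E" "move_chain E x y f n"
  shows "chain_cost L E f n \<ge> 0"
  unfolding chain_cost_def
  using step_bounds(4)[OF assms(1)] assms(2) by (auto intro!: sum_nonneg simp: move_chain_def)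

lemma chain_append:
  assumes f: "move_chain E x y f n" and g: "move_chain E y z g m"
  obtains h where "move_chain E x z h (n + m)"
    "chain_cost L E h (n + m) = chain_cost L E f n + chain_cost L E g m"
proof -
  define h where "h k = (if k \<le> n then f k else g (k - n))" for k
  have hf: "h k = f k" if "k \<le> n" for k using that by (simp add: h_def)
  have hg: "h (n + k) = g k" for k using f g by (cases k) (auto simp: h_def move_chain_def)
  have "move E (h k) (h (Suc k))" if "k < n + m" for k
  proof (cases "k < n")
    case True
    then show ?thesis using f by (simp add: hf move_chain_def)
  next
    case False
    define j where "j = k - n"
    have "k = n + j" "j < m" using that False by (auto simp: j_def)
    then show ?thesis using g hg[of j] hg[of "Suc j"] by (simp add: move_chain_def)
  qed
  then have "move_chain E x z h (n + m)" using f g hf[of 0] hg[of m] by (simp add: move_chain_def)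
  moreover have "chain_cost L E h (n + m) = chain_cost L E f n + chain_cost L E g m"
  proof -
    have "(\<Sum>k<n + m. move_cost L E (h k) (h (Suc k)))
      = (\<Sum>k<n. move_cost L E (h k) (h (Suc k))) + (\<Sum>k<m. move_cost L E (h (n + k)) (h (n + Suc k)))"
      by (induction m) (simp_all add: add.assoc)
    then show ?thesis unfolding hg chain_cost_def by (simp add: hf)
  qed
  ultimately show thesis by (rule that)
qed

lemma chain_segment:
  assumes "move_chain E x y f n" "i \<le> j" "j \<le> n"
  shows "move_chain E (f i) (f j) (\<lambda>k. f (i + k)) (j - i)"
    "chain_cost L E (\<lambda>k. f (i + k)) (j - i) = (\<Sum>k=i..<j. move_cost L E (f k) (f (Suc k)))"
proof -
  show "move_chain E (f i) (f j) (\<lambda>k. f (i + k)) (j - i)"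
    using assms by (auto simp: move_chain_def)
  show "chain_cost L E (\<lambda>k. f (i + k)) (j - i) = (\<Sum>k=i..<j. move_cost L E (f k) (f (Suc k)))"
    unfolding chain_cost_def using assms(2)
    by (intro sum.reindex_bij_witness[of _ "\<lambda>k. k - i" "\<lambda>k. k + i"]) (auto simp: add.commute)
qed

lemma chain_geodesic:
  assumes S: "shortcut_set L E" and x: "x \<in> HP" and y: "y \<in> HP"
  obtains f n where "move_chain E x y f n" "chain_cost L E f n \<le> hdist x y"
proof -
  obtain k p q where k: "k \<in> carrier PSL2R" "act k x = imag_axis p" "act k y = imag_axis q" "p \<le> q"
    using common_axis[OF x y] by blast
  have d: "hdist x y = q - p" using hdist_act[OF k(1) x y] k by (simp add: hdist_axis)
  \<comment> \<open>One is added to keep N positive when the two points coincide.\<close>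
  define N where "N = nat \<lceil>q - p\<rceil> + 1"
  have N: "real N \<ge> q - p" "N > 0" by (auto simp: N_def) linarith
  define h where "h = (q - p) / N"
  have h: "0 \<le> h" "h \<le> 1" using N k(4) by (auto simp: h_def)
  define f where "f j = act (pinv k) (imag_axis (p + real j * h))" for j :: nat
  have kk: "pinv k \<in> carrier PSL2R" using k(1) by simp
  have fHP: "f j \<in> HP" for j unfolding f_def by (intro act_HP kk axis_HP)
  have dist: "hdist (f j) (f (Suc j)) = h" for j
    unfolding f_def hdist_act[OF kk axis_HP axis_HP] using h by (simp add: hdist_axis algebra_simps)
  have st: "move E (f j) (f (Suc j))" for j using fHP dist h by (simp add: move_def)
  have "f 0 = x" using k x by (simp add: f_def flip: k(2))
  moreover have "f N = y" using k y N by (simp add: f_def h_def flip: k(3))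
  ultimately have ch: "move_chain E x y f N" using st by (simp add: move_chain_def)
  have "chain_cost L E f N \<le> (\<Sum>j<N. h)"
    unfolding chain_cost_def using step_bounds(5)[OF S st] by (intro sum_mono) (simp add: dist)
  also have "\<dots> = hdist x y" using N by (simp add: d h_def)
  finally show thesis using that ch by blast
qed

lemma sdist_le_chain:
  assumes "shortcut_set L E" "move_chain E x y f n"
  shows "sdist L E x y \<le> chain_cost L E f n"
  unfolding sdist_def
proof (rule cInf_lower)
  show "chain_cost L E f n \<in> {chain_cost L E f n |f n. move_chain E x y f n}" using assms(2) by blast
  show "bdd_below {chain_cost L E f n |f n. move_chain E x y f n}"
    using chain_cost_nonneg[OF assms(1)] by (auto intro!: bdd_belowI[of _ 0])
qed

lemma sdist_greatest:
  assumes "shortcut_set L E" "x \<in> HP" "y \<in> HP"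
    and "\<And>f n. move_chain E x y f n \<Longrightarrow> b \<le> chain_cost L E f n"
  shows "b \<le> sdist L E x y"
  unfolding sdist_def
proof (rule cInf_greatest)
  obtain f n where f: "move_chain E x y f n" by (rule chain_geodesic[OF assms(1-3)])
  then show "{chain_cost L E f n |f n. move_chain E x y f n} \<noteq> {}" by blast
  fix c assume "c \<in> {chain_cost L E f n |f n. move_chain E x y f n}"
  then show "b \<le> c" using assms(4) by auto
qed

lemma sdist_le_hdist:
  assumes S: "shortcut_set L E" and x: "x \<in> HP" and y: "y \<in> HP"
  shows "sdist L E x y \<le> hdist x y"
proof -
  obtain f n where f: "move_chain E x y f n" "chain_cost L E f n \<le> hdist x y"
    by (rule chain_geodesic[OF S x y])
  show ?thesis using sdist_le_chain[OF S f(1)] f(2) by simp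
qed

lemma sdist_nonneg:
  assumes S: "shortcut_set L E" and x: "x \<in> HP" and y: "y \<in> HP"
  shows "0 \<le> sdist L E x y"
  by (rule sdist_greatest[OF S x y], rule chain_cost_nonneg[OF S])

lemma sdist_triangle:
  assumes S: "shortcut_set L E" and x: "x \<in> HP" and y: "y \<in> HP" and z: "z \<in> HP"
  shows "sdist L E x z \<le> sdist L E x y + sdist L E y z"
proof -
  have "sdist L E x z - sdist L E y z \<le> sdist L E x y"
  proof (rule sdist_greatest[OF S x y])
    fix f n assume f: "move_chain E x y f n"
    have "sdist L E x z - chain_cost L E f n \<le> sdist L E y z"
    proof (rule sdist_greatest[OF S y z])
      fix g m assume "move_chain E y z g m"
      with f obtain h where "move_chain E x z h (n + m)"
        "chain_cost L E h (n + m) = chain_cost L E f n + chain_cost L E g m"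
        by (rule chain_append)
      then show "sdist L E x z - chain_cost L E f n \<le> chain_cost L E g m"
        using sdist_le_chain[OF S] by fastforce
    qed
    then show "sdist L E x z - sdist L E y z \<le> chain_cost L E f n" by simp
  qed
  then show ?thesis by simp
qed

lemma sdist_shortcut:
  assumes S: "shortcut_set L E" and "(u, v) \<in> E"
  shows "sdist L E u v \<le> L - 1"
proof -
  have "move_chain E u v (\<lambda>k. if k = 0 then u else v) 1"
    using shortcut_setD[OF assms] assms(2) by (simp add: move_chain_def move_def)
  from sdist_le_chain[OF S this] show ?thesis using assms(2) by (simp add: chain_cost_def move_cost_def)
qed

text \<open>The increments of \<phi> telescope along a chain. Applied with the position of the foot
  on an axis, this is the means of excluding gains by shortcuts.\<close>

lemma sdist_ge_potential:
  assumes S: "shortcut_set L E" and x: "x \<in> HP" and y: "y \<in> HP"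
    and \<phi>: "\<And>u v. move E u v \<Longrightarrow> \<phi> v - \<phi> u \<le> move_cost L E u v"
  shows "\<phi> y - \<phi> x \<le> sdist L E x y"
proof (rule sdist_greatest[OF S x y])
  fix f n assume f: "move_chain E x y f n"
  have "\<phi> y - \<phi> x = (\<Sum>k<n. \<phi> (f (Suc k)) - \<phi> (f k))"
    using f sum_lessThan_telescope[of "\<lambda>k. \<phi> (f k)" n] by (simp add: move_chain_def)
  also have "\<dots> \<le> chain_cost L E f n"
    unfolding chain_cost_def using f \<phi> by (intro sum_mono) (auto simp: move_chain_def)
  finally show "\<phi> y - \<phi> x \<le> chain_cost L E f n" .
qed

definition act_pairs :: "(real^2^2) set \<Rightarrow> (complex \<times> complex) set \<Rightarrow> (complex \<times> complex) set" where
  "act_pairs k E = (\<lambda>(u, v). (act k u, act k v)) ` E"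

lemma shortcut_set_act_pairs:
  "shortcut_set L E \<Longrightarrow> k \<in> carrier PSL2R \<Longrightarrow> shortcut_set L (act_pairs k E)"
  by (auto simp: shortcut_set_def act_pairs_def hdist_act act_HP split: prod.splits)

lemma act_pairs_inv:
  assumes "shortcut_set L E" "k \<in> carrier PSL2R"
  shows "act_pairs (pinv k) (act_pairs k E) = E"
proof -
  have "(\<lambda>(u, v). (act (pinv k) (act k u), act (pinv k) (act k v))) ` E = (\<lambda>e. e) ` E"
    using assms by (intro image_cong) (auto simp: shortcut_set_def)
  then show ?thesis by (simp add: act_pairs_def image_image case_prod_beta)
qed

lemma sdist_act_le:
  assumes S: "shortcut_set L E" and k: "k \<in> carrier PSL2R" and x: "x \<in> HP" and y: "y \<in> HP"
  shows "sdist L (act_pairs k E) (act k x) (act k y) \<le> sdist L E x y"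
proof (rule sdist_greatest[OF S x y])
  fix f n assume f: "move_chain E x y f n"
  have st: "move (act_pairs k E) (act k u) (act k v) \<and> move_cost L (act_pairs k E) (act k u) (act k v) \<le> move_cost L E u v"
    if "move E u v" for u v
  proof -
    have HP: "u \<in> HP" "v \<in> HP" using that by (auto simp: move_def)
    have "(act k u, act k v) \<in> act_pairs k E" if "(u, v) \<in> E"
      using that by (force simp: act_pairs_def)
    moreover have "(u, v) \<in> E" if "(act k u, act k v) \<in> act_pairs k E"
      using that act_inv_act[OF k] HP shortcut_setD(1,2)[OF S] unfolding act_pairs_def
      by (smt (verit) Pair_inject case_prod_beta image_iff prod.collapse)
    ultimately show ?thesis using that k HP by (auto simp: move_def move_cost_def act_HP hdist_act)
  qed
  have "move_chain (act_pairs k E) (act k x) (act k y) (\<lambda>j. act k (f j)) n"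
    using f st by (simp add: move_chain_def)
  then have "sdist L (act_pairs k E) (act k x) (act k y) \<le> chain_cost L (act_pairs k E) (\<lambda>j. act k (f j)) n"
    by (rule sdist_le_chain[OF shortcut_set_act_pairs[OF S k]])
  also have "\<dots> \<le> chain_cost L E f n"
    unfolding chain_cost_def using f st by (intro sum_mono) (auto simp: move_chain_def)
  finally show "sdist L (act_pairs k E) (act k x) (act k y) \<le> chain_cost L E f n" .
qed

lemma sdist_act:
  assumes S: "shortcut_set L E" and k: "k \<in> carrier PSL2R" and x: "x \<in> HP" and y: "y \<in> HP"
  shows "sdist L (act_pairs k E) (act k x) (act k y) = sdist L E x y"
  using sdist_act_le[OF S k x y]
    sdist_act_le[OF shortcut_set_act_pairs[OF S k] PSL.inv_closed[OF k] act_HP[OF k x] act_HP[OF k y]]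
  by (simp add: act_pairs_inv[OF S k] k x y)

section \<open>Nearly optimal chains pass close to geodesics\<close>

definition strip_height :: "real \<Rightarrow> real" where
  "strip_height L = arcosh (8 * exp L)"

text \<open>The solution of s \<le> 2 R + s/4 + 2 L + 1 with R the strip height: the cost of an
  excursion exceeds the distance of its ends by at most 1, and the progress of its foot is at most
  s/4 + 2 L.\<close>

definition excursion_cost :: "real \<Rightarrow> real" where
  "excursion_cost L = 4 / 3 * (2 * strip_height L + 1 + 2 * L)"

text \<open>Large enough for both cases of \<open>chain_passes_near\<close>: crossing m inside the
  strip gives R + L, crossing it during an excursion gives R plus twice the excursion cost.\<close>

definition detour :: "real \<Rightarrow> real" where
  "detour L = strip_height L + L + 2 * excursion_cost L"

lemma eight_exp_ge_1: "L \<ge> 0 \<Longrightarrow> 8 * exp L \<ge> (1::real)"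
  using exp_ge_add_one_self[of L] by linarith

lemma cosh_strip_height: "L \<ge> 0 \<Longrightarrow> cosh (strip_height L) = 8 * exp L"
  using eight_exp_ge_1[of L] by (simp add: strip_height_def)

lemma strip_height_nonneg: "L \<ge> 0 \<Longrightarrow> strip_height L \<ge> 0"
  using eight_exp_ge_1[of L] by (simp add: strip_height_def)

text \<open>The strip height satisfies cosh R = 8 exp L. The factor \<open>exp L\<close> cancels the
  one in \<open>foot_contraction_linear\<close>, and of the remaining 8 a factor 2 is lost in
  passing from length to cost.\<close>

lemma foot_step_outside_strip:
  assumes S: "shortcut_set L E" and st: "move E u v"
    and hu: "height u > strip_height L" and hv: "height v > strip_height L"
  shows "\<bar>foot v - foot u\<bar> \<le> move_cost L E u v / 4"
proof -
  have L: "L \<ge> 2" using S by (simp add: shortcut_set_def)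
  note b = step_bounds[OF S st]
  have K: "8 * exp L \<ge> 1" using L exp_ge_add_one_self[of L] by linarith
  have "cosh (height u) \<ge> 8 * exp L" "cosh (height v) \<ge> 8 * exp L"
    using hu hv L strip_height_nonneg[of L]
    by (simp_all add: cosh_real_nonneg_le_iff flip: cosh_strip_height)
  from foot_contraction_linear[OF b(1,2) K this b(3)]
  have "exp L * (8 * \<bar>foot u - foot v\<bar>) \<le> exp L * hdist u v" by (simp add: mult_ac)
  then have "8 * \<bar>foot u - foot v\<bar> \<le> hdist u v" by simp
  then show ?thesis using b(6) by (simp add: abs_minus_commute)
qed

text \<open>A nearly optimal chain between two points of the imaginary axis cannot avoid the
  neighbourhood of an intermediate point: outside a wide strip its steps make almost no
  progress along the axis, so a long excursion would be more expensive than returning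
  to the axis.\<close>

lemma chain_passes_near:
  assumes S: "shortcut_set L E" and pm: "p \<le> m" and mq: "m \<le> q"
    and f: "move_chain E (imag_axis p) (imag_axis q) f n"
    and opt: "chain_cost L E f n \<le> sdist L E (imag_axis p) (imag_axis q) + 1"
  shows "\<exists>k\<le>n. hdist (f k) (imag_axis m) \<le> detour L"
proof -
  define R where "R = strip_height L"
  define c where "c k = move_cost L E (f k) (f (Suc k))" for k
  have L: "L \<ge> 2" using S by (simp add: shortcut_set_def)
  have R0: "R \<ge> 0" using L by (simp add: R_def strip_height_nonneg)
  have f0: "f 0 = imag_axis p" and fn: "f n = imag_axis q" and st: "\<And>k. k < n \<Longrightarrow> move E (f k) (f (Suc k))"
    using f by (auto simp: move_chain_def)
  have HP: "f k \<in> HP" if "k \<le> n" for k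
    using chain_HP[OF f _ that] f0 that by (cases "n = 0") auto
  have c: "c k \<ge> 0" "hdist (f k) (f (Suc k)) \<le> 2 * c k" "hdist (f k) (f (Suc k)) \<le> L" if "k < n" for k
    using step_bounds[OF S st[OF that]] by (auto simp: c_def)
  have dist_le: "hdist (f i) (f j) \<le> 2 * sum c {i..<j}" if "i \<le> j" "j \<le> n" for i j
    using that
  proof (induction j rule: dec_induct)
    case (step j)
    then show ?case using hdist_triangle[of "f i" "f j" "f (Suc j)"] HP[of i] HP[of j] HP[of "Suc j"] c(2)[of j]
      by simp
  qed simp
  \<comment> \<open>Every piece of a nearly optimal chain is nearly optimal: replacing it by a
    geodesic saves at most 1.\<close>
  have opt_seg: "sum c {i..<j} \<le> hdist (f i) (f j) + 1" if "i \<le> j" "j \<le> n" for i j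
  proof -
    have "sdist L E (imag_axis p) (f i) \<le> sum c {0..<i}"
      using sdist_le_chain[OF S chain_segment(1)[OF f, of 0 i]] chain_segment(2)[OF f, of 0 i L] that f0
      by (simp add: c_def)
    moreover have "sdist L E (f j) (imag_axis q) \<le> sum c {j..<n}"
      using sdist_le_chain[OF S chain_segment(1)[OF f, of j n]] chain_segment(2)[OF f, of j n L] that fn
      by (simp add: c_def)
    moreover have "sdist L E (imag_axis p) (imag_axis q) \<le> sdist L E (imag_axis p) (f i) + hdist (f i) (f j) + sdist L E (f j) (imag_axis q)"
      using sdist_triangle[OF S axis_HP[of p] HP[of i] axis_HP[of q]] sdist_triangle[OF S HP[of i] HP[of j] axis_HP[of q]]
        sdist_le_hdist[OF S HP[of i] HP[of j]] that by simp
    moreover have "chain_cost L E f n = sum c {0..<i} + sum c {i..<j} + sum c {j..<n}"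
      using that by (simp add: chain_cost_def c_def sum.atLeastLessThan_concat lessThan_atLeast0)
    ultimately show ?thesis using opt by linarith
  qed
  \<comment> \<open>The first point whose foot has reached m; one step moves the foot by at most
    L.\<close>
  define k0 where "k0 = (LEAST k. foot (f k) \<ge> m)"
  have "foot (f n) \<ge> m" using mq fn by simp
  then have k0: "foot (f k0) \<ge> m" "k0 \<le> n"
    unfolding k0_def by (rule LeastI, rule Least_le)
  have before: "foot (f k) < m" if "k < k0" for k
    using not_less_Least[of k "\<lambda>k. foot (f k) \<ge> m"] that by (simp add: k0_def)
  have S0: "excursion_cost L \<ge> 0" using L R0 by (simp add: excursion_cost_def R_def)
  show ?thesis
  proof (cases "height (f k0) \<le> R")
    case True
    have "\<bar>foot (f k0) - m\<bar> \<le> L"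
    proof (cases k0)
      case 0
      then show ?thesis using k0 pm f0 L by simp
    next
      case (Suc k)
      then have "foot (f k) < m" "k < n" using before k0 by auto
      then show ?thesis
        using hdist_ge_foot[OF HP[of k] HP[of "Suc k"]] c(3)[of k] k0 Suc by simp
    qed
    then have "hdist (f k0) (imag_axis m) \<le> R + L"
      using hdist_axis_le[OF HP[OF k0(2)], of m] True by linarith
    then show ?thesis using k0 S0 by (intro exI[of _ k0]) (auto simp: detour_def R_def)
  next
    case False
    \<comment> \<open>The excursion around k0: i is the last index before it inside the strip, j the
      first one after it. Both exist because the chain starts and ends on the axis.\<close>
    define i where "i = Max {k. k \<le> k0 \<and> height (f k) \<le> R}"
    define j where "j = (LEAST k. k \<ge> k0 \<and> height (f k) \<le> R)"
    have fin: "finite {k. k \<le> k0 \<and> height (f k) \<le> R}" by simp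
    have "0 \<in> {k. k \<le> k0 \<and> height (f k) \<le> R}" using f0 R0 by simp
    then have "i \<in> {k. k \<le> k0 \<and> height (f k) \<le> R}" unfolding i_def using fin by (intro Max_in) auto
    then have i: "i \<le> k0" "height (f i) \<le> R" by auto
    have i_max: "k \<le> i" if "k \<le> k0" "height (f k) \<le> R" for k
      unfolding i_def using that fin by (intro Max_ge) auto
    have "n \<ge> k0 \<and> height (f n) \<le> R" using k0 fn R0 by simp
    then have "j \<ge> k0 \<and> height (f j) \<le> R" and "j \<le> n"
      unfolding j_def by (rule LeastI, rule Least_le)
    then have j: "j \<ge> k0" "height (f j) \<le> R" "j \<le> n" by simp_all
    have j_min: "j \<le> k" if "k \<ge> k0" "height (f k) \<le> R" for k
      unfolding j_def using that by (intro Least_le) auto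
    have ik: "i < k0" using i False by (cases "i = k0") auto
    have kj: "k0 < j" using j False by (cases "j = k0") auto
    have high: "height (f k) > R" if "i < k" "k < j" for k
      using i_max[of k] j_min[of k] that by (cases "k \<le> k0") force+
    \<comment> \<open>The first and the last step of the excursion have one end inside the strip and
      are only known to move the foot by at most L.\<close>
    have prog: "\<bar>foot (f (Suc k)) - foot (f k)\<bar> \<le> c k / 4 + ((if k = i then L else 0) + (if k = j - 1 then L else 0))"
      if "i \<le> k" "k < j" for k
    proof (cases "k = i \<or> k = j - 1")
      case True
      then have "\<bar>foot (f (Suc k)) - foot (f k)\<bar> \<le> L"
        using hdist_ge_foot[OF HP[of k] HP[of "Suc k"]] c(3)[of k] that j(3) by simp
      then show ?thesis using True c(1)[of k] that j(3) L by auto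
    next
      case False
      then have "Suc k < j" "i < k" using that by auto
      then show ?thesis
        using foot_step_outside_strip[OF S st[of k]] high[of k] high[of "Suc k"] False that j(3)
        by (simp add: c_def R_def)
    qed
    have "\<bar>foot (f j) - foot (f i)\<bar> = \<bar>\<Sum>k=i..<j. foot (f (Suc k)) - foot (f k)\<bar>"
      using sum_Suc_diff'[of i j "\<lambda>k. foot (f k)"] ik kj by simp
    also have "\<dots> \<le> (\<Sum>k=i..<j. \<bar>foot (f (Suc k)) - foot (f k)\<bar>)" by (rule sum_abs)
    also have "\<dots> \<le> (\<Sum>k=i..<j. c k / 4 + ((if k = i then L else 0) + (if k = j - 1 then L else 0)))"
      by (intro sum_mono prog) auto
    also have "\<dots> = sum c {i..<j} / 4 + 2 * L"
      using ik kj by (simp add: sum.distrib sum.delta sum_divide_distrib)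
    finally have disp: "\<bar>foot (f j) - foot (f i)\<bar> \<le> sum c {i..<j} / 4 + 2 * L" .
    have ij: "i \<le> j" using ik kj by simp
    have "sum c {i..<j} \<le> height (f i) + \<bar>foot (f i) - foot (f j)\<bar> + height (f j) + 1"
      using opt_seg[OF ij j(3)] hdist_fermi_le[OF HP[of i] HP[of j]] ij j(3) by simp
    then have move_cost: "sum c {i..<j} \<le> excursion_cost L"
      using disp i(2) j(2) by (simp add: excursion_cost_def R_def abs_minus_commute)
    have "sum c {i..<k0} \<le> sum c {i..<j}"
      using kj j(3) c(1) by (intro sum_mono2) auto
    then have "hdist (f i) (f k0) \<le> 2 * excursion_cost L"
      using dist_le[of i k0] move_cost ik k0(2) by simp
    \<comment> \<open>The foot of \<open>f i\<close> is before m and that of \<open>f k0\<close> is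
      not, so m lies between them.\<close>
    then have "\<bar>foot (f i) - m\<bar> \<le> 2 * excursion_cost L"
      using hdist_ge_foot[OF HP[of i] HP[of k0]] before[OF ik] k0 ik by simp
    then have "hdist (f i) (imag_axis m) \<le> detour L"
      using hdist_axis_le[OF HP[of i], of m] i(2) ik k0(2) L by (simp add: detour_def R_def)
    then show ?thesis using ik k0(2) by (intro exI[of _ i]) auto
  qed
qed

text \<open>A chain that is optimal up to 1 is cut at its point near \<open>imag_axis m\<close>;
  joining that point to m costs at most \<open>detour L\<close> for each of the two parts.\<close>

lemma sdist_axis_additive:
  assumes S: "shortcut_set L E" and pm: "p \<le> m" and mq: "m \<le> q"
  shows "sdist L E (imag_axis p) (imag_axis m) + sdist L E (imag_axis m) (imag_axis q)
    \<le> sdist L E (imag_axis p) (imag_axis q) + (1 + 2 * detour L)"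
proof -
  have "\<exists>f n. move_chain E (imag_axis p) (imag_axis q) f n \<and> chain_cost L E f n < sdist L E (imag_axis p) (imag_axis q) + 1"
  proof (rule ccontr)
    assume "\<not> ?thesis"
    then have "sdist L E (imag_axis p) (imag_axis q) + 1 \<le> sdist L E (imag_axis p) (imag_axis q)"
      by (intro sdist_greatest[OF S axis_HP axis_HP]) force
    then show False by simp
  qed
  then obtain f n where f: "move_chain E (imag_axis p) (imag_axis q) f n"
    and opt: "chain_cost L E f n < sdist L E (imag_axis p) (imag_axis q) + 1" by blast
  obtain k where k: "k \<le> n" "hdist (f k) (imag_axis m) \<le> detour L"
    using chain_passes_near[OF S pm mq f] opt by auto
  have f0: "f 0 = imag_axis p" and fn: "f n = imag_axis q" using f by (auto simp: move_chain_def)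
  have HP: "f k \<in> HP" using chain_HP[OF f _ k(1)] f0 k(1) by (cases "n = 0") auto
  have "sdist L E (imag_axis p) (f k) \<le> (\<Sum>k=0..<k. move_cost L E (f k) (f (Suc k)))"
    using sdist_le_chain[OF S chain_segment(1)[OF f, of 0 k]] chain_segment(2)[OF f, of 0 k L] k f0
    by simp
  moreover have "sdist L E (f k) (imag_axis q) \<le> (\<Sum>k=k..<n. move_cost L E (f k) (f (Suc k)))"
    using sdist_le_chain[OF S chain_segment(1)[OF f, of k n]] chain_segment(2)[OF f, of k n L] k fn
    by simp
  moreover have "chain_cost L E f n = (\<Sum>k=0..<k. move_cost L E (f k) (f (Suc k))) + (\<Sum>k=k..<n. move_cost L E (f k) (f (Suc k)))"
    using k by (simp add: chain_cost_def sum.atLeastLessThan_concat lessThan_atLeast0)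
  moreover have "sdist L E (imag_axis p) (imag_axis m) \<le> sdist L E (imag_axis p) (f k) + hdist (f k) (imag_axis m)"
    using sdist_triangle[OF S axis_HP HP axis_HP, of p m] sdist_le_hdist[OF S HP axis_HP, of m] by simp
  moreover have "sdist L E (imag_axis m) (imag_axis q) \<le> hdist (imag_axis m) (f k) + sdist L E (f k) (imag_axis q)"
    using sdist_triangle[OF S axis_HP HP axis_HP, of m q] sdist_le_hdist[OF S axis_HP HP, of m] by simp
  ultimately show ?thesis using k(2) opt by (simp add: hdist_commute[of "imag_axis m"])
qed

definition defect :: "real \<Rightarrow> real" where
  "defect L = 1 + 2 * detour L + 6 * ln 4"

text \<open>Two uses of \<open>hdist_axis_ge\<close> show that c lies within 3 ln 4 / 2 of the point
  m obtained by clamping its foot to the segment. Replacing c by m in both terms is covered by the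
  summand \<open>6 * ln 4\<close> of \<open>defect\<close>.\<close>

lemma sdist_additive:
  assumes S: "shortcut_set L E" and x: "x \<in> HP" and y: "y \<in> HP" and c: "c \<in> HP"
    and mid: "hdist x c + hdist c y \<le> hdist x y + ln 4"
  shows "sdist L E x c + sdist L E c y \<le> sdist L E x y + defect L"
proof -
  obtain k p q where k: "k \<in> carrier PSL2R" and kx: "act k x = imag_axis p" and ky: "act k y = imag_axis q" and pq: "p \<le> q"
    using common_axis[OF x y] by blast
  define E' where "E' = act_pairs k E"
  have S': "shortcut_set L E'" unfolding E'_def by (rule shortcut_set_act_pairs[OF S k])
  define c' where "c' = act k c"
  have c': "c' \<in> HP" unfolding c'_def by (rule act_HP[OF k c])
  have eq: "sdist L E x c = sdist L E' (imag_axis p) c'" "sdist L E c y = sdist L E' c' (imag_axis q)"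
    "sdist L E x y = sdist L E' (imag_axis p) (imag_axis q)"
    unfolding E'_def c'_def using sdist_act[OF S k] x y c kx ky by metis+
  have "hdist (imag_axis p) c' + hdist c' (imag_axis q) \<le> q - p + ln 4"
    using mid hdist_act[OF k x c] hdist_act[OF k c y] hdist_act[OF k x y] pq
    by (simp add: c'_def kx ky hdist_axis)
  then have sum: "2 * height c' + \<bar>foot c' - p\<bar> + \<bar>foot c' - q\<bar> \<le> q - p + 3 * ln 4"
    using hdist_axis_ge[OF c', of p] hdist_axis_ge[OF c', of q] by (simp add: hdist_commute[of "imag_axis p"])
  define m where "m = max p (min q (foot c'))"
  have m: "p \<le> m" "m \<le> q" using pq by (auto simp: m_def)
  have d: "hdist c' (imag_axis m) \<le> 3 * ln 4 / 2"
    using hdist_axis_le[OF c', of m] sum pq by (auto simp: m_def max_def min_def abs_if split: if_splits)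
  have "sdist L E' (imag_axis p) c' \<le> sdist L E' (imag_axis p) (imag_axis m) + hdist c' (imag_axis m)"
    using sdist_triangle[OF S' axis_HP[of p] axis_HP[of m] c'] sdist_le_hdist[OF S' axis_HP[of m] c']
    by (simp add: hdist_commute[of c'])
  moreover have "sdist L E' c' (imag_axis q) \<le> hdist c' (imag_axis m) + sdist L E' (imag_axis m) (imag_axis q)"
    using sdist_triangle[OF S' c' axis_HP[of m] axis_HP[of q]] sdist_le_hdist[OF S' c' axis_HP[of m]] by simp
  moreover have "ln (4::real) \<ge> 0" by simp
  ultimately show ?thesis
    unfolding eq defect_def using sdist_axis_additive[OF S' m] d by linarith
qed

text \<open>Thin triangles: the centre is the projection of y to the side from x to z. By
  \<open>hdist_axis_ge\<close> the ways from y through it to x and to z are geodesic up to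
  \<open>ln 4\<close>.\<close>

lemma triangle_center:
  assumes x: "x \<in> HP" and y: "y \<in> HP" and z: "z \<in> HP"
  obtains c where "c \<in> HP" "hdist x c + hdist c z \<le> hdist x z + ln 4"
    "hdist x c + hdist c y \<le> hdist x y + ln 4" "hdist y c + hdist c z \<le> hdist y z + ln 4"
proof -
  obtain k p q where k: "k \<in> carrier PSL2R" and kx: "act k x = imag_axis p" and kz: "act k z = imag_axis q" and pq: "p \<le> q"
    using common_axis[OF x z] by blast
  define y' where "y' = act k y"
  have y': "y' \<in> HP" unfolding y'_def by (rule act_HP[OF k y])
  define m where "m = max p (min q (foot y'))"
  define c where "c = act (pinv k) (imag_axis m)"
  have c: "c \<in> HP" unfolding c_def using k by (intro act_HP) auto
  have kc: "act k c = imag_axis m" by (simp add: c_def k)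
  have eq: "hdist x c = hdist (imag_axis p) (imag_axis m)" "hdist c z = hdist (imag_axis m) (imag_axis q)"
    "hdist x z = hdist (imag_axis p) (imag_axis q)" "hdist x y = hdist y' (imag_axis p)" "hdist y z = hdist y' (imag_axis q)"
    "hdist y c = hdist y' (imag_axis m)" "hdist c y = hdist y' (imag_axis m)"
    using hdist_act[OF k] x y z c kc kx kz by (metis hdist_commute y'_def)+
  show thesis
    using hdist_axis_le[OF y', of m] hdist_axis_ge[OF y', of p] hdist_axis_ge[OF y', of q] pq
    by (intro that[OF c]; unfold eq hdist_axis) (auto simp: m_def max_def min_def abs_if split: if_splits)
qed

definition asym :: "real \<Rightarrow> (complex \<times> complex) set \<Rightarrow> complex \<Rightarrow> complex \<Rightarrow> real" where
  "asym L E x y = sdist L E x y - sdist L E y x"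

text \<open>Each of the three values splits at the centre c up to one defect, and the six resulting
  terms cancel by antisymmetry.\<close>

lemma asym_cocycle:
  assumes S: "shortcut_set L E" and x: "x \<in> HP" and y: "y \<in> HP" and z: "z \<in> HP"
  shows "\<bar>asym L E x z - asym L E x y - asym L E y z\<bar> \<le> 3 * defect L"
proof -
  obtain c where c: "c \<in> HP" and mid: "hdist x c + hdist c z \<le> hdist x z + ln 4"
    "hdist x c + hdist c y \<le> hdist x y + ln 4" "hdist y c + hdist c z \<le> hdist y z + ln 4"
    by (rule triangle_center[OF x y z])
  have "\<bar>asym L E u v - (asym L E u c + asym L E c v)\<bar> \<le> defect L"
    if "u \<in> HP" "v \<in> HP" "hdist u c + hdist c v \<le> hdist u v + ln 4" for u v
  proof -
    have "hdist v c + hdist c u \<le> hdist v u + ln 4"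
      using that(3) by (simp add: hdist_commute)
    then show ?thesis
      using sdist_additive[OF S that(1,2) c that(3)] sdist_additive[OF S that(2,1) c]
        sdist_triangle[OF S that(1) c that(2)] sdist_triangle[OF S that(2) c that(1)]
      by (simp add: asym_def)
  qed
  from this[OF x z mid(1)] this[OF x y mid(2)] this[OF y z mid(3)] show ?thesis
    by (simp add: asym_def)
qed

subsection \<open>The case of a hyperbolic element\<close>

lemma hyperbolic_along_int_pow:
  assumes X: "X \<in> carrier PSL2R" and hyp: "hyperbolic_along k \<mu> X" and z: "z \<in> HP"
  shows "act (X \<^bold>^ (n::int)) (act k z) = act k (of_real (exp (of_int n * ln \<mu>)) * z)"
proof -
  have k: "k \<in> carrier PSL2R" and \<mu>: "\<mu> > 1" and act: "\<And>z. z \<in> HP \<Longrightarrow> act X (act k z) = act k (of_real \<mu> * z)"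
    using hyp by (auto simp: hyperbolic_along_def)
  have nat: "act (X \<^bold>^ m) (act k z) = act k (of_real (exp (real m * ln \<mu>)) * z)"
    if "z \<in> HP" for m :: nat and z
    using that
  proof (induction m arbitrary: z)
    case (Suc m)
    have "act (X \<^bold>^ Suc m) (act k z) = act (X \<^bold>^ m) (act k (of_real \<mu> * z))"
      using Suc.prems X k by (simp add: act_mult act_HP act)
    also have "\<dots> = act k (of_real (exp (real m * ln \<mu>)) * (of_real \<mu> * z))"
      using Suc.prems \<mu> by (intro Suc.IH) simp
    also have "of_real (exp (real m * ln \<mu>)) * (of_real \<mu> * z) = of_real (exp (real (Suc m) * ln \<mu>)) * z"
      using \<mu> by (simp add: algebra_simps exp_add)
    finally show ?case .
  qed simp
  show ?thesis
  proof (cases n rule: int_cases2)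
    case (nonneg m)
    then show ?thesis using nat[OF z] by (simp add: int_pow_int)
  next
    case (nonpos m)
    define w where "w = of_real (exp (- real m * ln \<mu>)) * z"
    have w: "w \<in> HP" using z by (simp add: w_def)
    have "act (X \<^bold>^ m) (act k w) = act k z"
      using nat[OF w] by (simp add: w_def exp_minus flip: of_real_mult mult.assoc)
    then have "act (pinv (X \<^bold>^ m)) (act k z) = act k w"
      using act_inv_act[of "X \<^bold>^ m" "act k w"] X k w by (simp add: act_HP)
    then show ?thesis using nonpos X by (simp add: PSL.int_pow_neg_int w_def)
  qed
qed

text \<open>The half-turn about \<open>\<i>\<close>. It reverses the imaginary axis, so k followed
  on the right by it describes the axis k run backwards.\<close>

definition inversion :: "(real^2^2) set" where "inversion = P2 0 (-1) 1 0"

lemma inversion_carrier [simp]: "inversion \<in> carrier PSL2R"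
  by (simp add: inversion_def P2_carrier)

lemma act_inversion: "act inversion z = - 1 / z"
  by (simp add: inversion_def act_P2)

lemma inv_inversion [simp]: "pinv inversion = inversion"
  by (simp add: inversion_def P2_inv P2_eq_iff)

lemma foot_inversion: "z \<in> HP \<Longrightarrow> foot (act inversion z) = - foot z"
  by (simp add: foot_def act_inversion norm_divide ln_div HP_cmod_pos)

lemma hyperbolic_along_inv:
  assumes X: "X \<in> carrier PSL2R" and hyp: "hyperbolic_along k \<mu> X"
  shows "hyperbolic_along (k \<cdot> inversion) \<mu> (pinv X)"
proof -
  have k: "k \<in> carrier PSL2R" and \<mu>: "\<mu> > 1" using hyp by (auto simp: hyperbolic_along_def)
  have "act (pinv X) (act (k \<cdot> inversion) z) = act (k \<cdot> inversion) (of_real \<mu> * z)"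
    if z: "z \<in> HP" for z
  proof -
    have Jz: "act inversion z \<in> HP" using z by (simp add: act_HP)
    have "act (X \<^bold>^ (-1::int)) (act k (act inversion z)) = act k (of_real (1 / \<mu>) * act inversion z)"
      using hyperbolic_along_int_pow[OF X hyp Jz, of "-1"] \<mu> by (simp add: exp_minus field_simps)
    moreover have "of_real (1 / \<mu>) * act inversion z = act inversion (of_real \<mu> * z)"
      by (simp add: act_inversion)
    moreover have "X \<^bold>^ (-1::int) = pinv X"
      using X PSL.int_pow_neg[of X 1] by simp
    ultimately show ?thesis using k z \<mu> by (simp add: act_mult)
  qed
  then show ?thesis using k \<mu> by (simp add: hyperbolic_along_def)
qed

text \<open>Y must carry the fixed points 0 and infinity of one homothety to those of the other, and
  as both expand it cannot exchange them. The coefficients of the intertwining relation, a quadratic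
  in z, express this.\<close>

lemma intertwines_homotheties:
  assumes Y: "Y \<in> carrier PSL2R" and \<mu>: "\<mu> > 1" and \<nu>: "\<nu> > 1"
    and eq: "\<And>z. z \<in> HP \<Longrightarrow> act Y (of_real \<mu> * z) = of_real \<nu> * act Y z"
  obtains \<beta> where "\<beta> > 0" "\<And>z. z \<in> HP \<Longrightarrow> act Y z = of_real \<beta> * z"
proof -
  obtain a b c d where 1: "a * d - b * c = 1" and Ym: "Y = P2 a b c d" using Y by (rule PSL2R_cases)
  have "(1 - \<nu>) * (a * c * \<mu>) = 0 \<and> a * d * (\<mu> - \<nu>) + b * c * (1 - \<nu> * \<mu>) = 0 \<and> (1 - \<nu>) * (b * d) = 0"
  proof (rule quadratic_root_free_eq_0)
    fix z assume z: "z \<in> HP"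
    have n: "of_real c * (of_real \<mu> * z) + of_real d \<noteq> 0" "of_real c * z + of_real d \<noteq> 0"
      using den_nonzero[OF _ 1] z \<mu> by (auto simp del: mult.assoc)
    have "(of_real a * (of_real \<mu> * z) + of_real b) * (of_real c * z + of_real d)
        = of_real \<nu> * (of_real a * z + of_real b) * (of_real c * (of_real \<mu> * z) + of_real d)"
      using eq[OF z] n unfolding Ym act_P2 by (simp add: divide_simps)
    then show "of_real ((1 - \<nu>) * (a * c * \<mu>)) * z\<^sup>2 + of_real (a * d * (\<mu> - \<nu>) + b * c * (1 - \<nu> * \<mu>)) * z
        + of_real ((1 - \<nu>) * (b * d)) = 0"
      by (simp add: power2_eq_square algebra_simps)
  qed
  then have ac: "a * c = 0" and bd: "b * d = 0" and m: "a * d * (\<mu> - \<nu>) + b * c * (1 - \<nu> * \<mu>) = 0"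
    using \<mu> \<nu> by auto
  \<comment> \<open>For a = 0 the ends would be exchanged, which forces \<nu> \<mu> = 1.\<close>
  have "a \<noteq> 0"
  proof
    assume "a = 0"
    then have "b * c = -1" using 1 by simp
    then have "\<nu> * \<mu> = 1" using m \<open>a = 0\<close> by simp
    then show False using \<mu> \<nu> less_1_mult[of \<nu> \<mu>] by simp
  qed
  then have c0: "c = 0" using ac by simp
  then have ad: "a * d = 1" using 1 by simp
  then have "d \<noteq> 0" by auto
  then have b0: "b = 0" using bd by simp
  have da: "d = 1 / a" using ad \<open>a \<noteq> 0\<close> by (simp add: eq_divide_eq mult.commute)
  show thesis
  proof (rule that)
    show "a\<^sup>2 > 0" using \<open>a \<noteq> 0\<close> by simp
    show "act Y z = of_real (a\<^sup>2) * z" for z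
      using \<open>a \<noteq> 0\<close> by (simp add: Ym act_P2 b0 c0 da power2_eq_square)
  qed
qed

text \<open>Division with remainder by the smallest positive element b; since a is a multiple of b
  and not a proper one, a = b. Applied to translation lengths along an axis and to translations at a
  cusp.\<close>

lemma discrete_real_subgroup:
  fixes T :: "real set"
  assumes diff: "\<And>s t. s \<in> T \<Longrightarrow> t \<in> T \<Longrightarrow> s - t \<in> T"
    and a: "a \<in> T" "a > 0" and fin: "finite {t \<in> T. 0 < t \<and> t \<le> a}"
    and prim: "\<And>b n. b \<in> T \<Longrightarrow> a = of_int n * b \<Longrightarrow> \<bar>n\<bar> < 2"
    and t: "t \<in> T"
  shows "\<exists>n. t = of_int n * a"
proof -
  have zero: "0 \<in> T" using diff[OF a(1) a(1)] by simp
  have neg: "- s \<in> T" if "s \<in> T" for s using diff[OF zero that] by simp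
  have add: "s + u \<in> T" if "s \<in> T" "u \<in> T" for s u using diff[OF that(1) neg[OF that(2)]] by simp
  have natmult: "of_nat n * s \<in> T" if "s \<in> T" for s and n :: nat
    by (induction n) (auto simp: zero algebra_simps intro: add that)
  have intmult: "of_int n * s \<in> T" if "s \<in> T" for s and n :: int
    using natmult[OF that] neg by (cases n rule: int_cases2) auto
  define b where "b = Min {t \<in> T. 0 < t \<and> t \<le> a}"
  have "b \<in> {t \<in> T. 0 < t \<and> t \<le> a}" unfolding b_def using fin a by (intro Min_in) auto
  then have b: "b \<in> T" "0 < b" "b \<le> a" by auto
  have multiple: "s = of_int \<lfloor>s / b\<rfloor> * b" if "s \<in> T" for s
  proof (rule ccontr)
    assume ne: "s \<noteq> of_int \<lfloor>s / b\<rfloor> * b"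
    define u where "u = s - of_int \<lfloor>s / b\<rfloor> * b"
    have "of_int \<lfloor>s / b\<rfloor> * b \<le> s" "s < (of_int \<lfloor>s / b\<rfloor> + 1) * b"
      using floor_correct[of "s / b"] by (simp_all only: pos_le_divide_eq[OF b(2)] pos_divide_less_eq[OF b(2)] of_int_add of_int_1)
    then have "0 < u" "u < b" using ne by (auto simp: u_def algebra_simps)
    moreover have "u \<in> T" unfolding u_def by (intro diff that intmult b)
    ultimately show False using Min_le[OF fin, of u] b by (auto simp: b_def)
  qed
  define n where "n = \<lfloor>a / b\<rfloor>"
  have n: "a = of_int n * b" using multiple[OF a(1)] by (simp add: n_def)
  then have "\<bar>n\<bar> < 2" using prim b(1) by blast
  moreover have "n > 0" using a(2) b(2) n by (simp add: zero_less_mult_iff)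
  ultimately have "n = 1" by simp
  then show ?thesis using n multiple[OF t] by auto
qed

text \<open>With d = 0 this yields r = 0; with d the displacement of a point it bounds the
  homogeneous value by that displacement.\<close>

lemma zero_of_linear_bound:
  fixes r d B :: real
  assumes "\<And>n::nat. \<bar>real n * r\<bar> \<le> B + real n * d"
  shows "\<bar>r\<bar> \<le> d"
proof (rule ccontr)
  assume "\<not> \<bar>r\<bar> \<le> d"
  then have pos: "\<bar>r\<bar> - d > 0" by simp
  obtain n :: nat where "B / (\<bar>r\<bar> - d) < n" using reals_Archimedean2 by blast
  then have "B < real n * (\<bar>r\<bar> - d)" using pos by (simp add: field_simps)
  then show False using assms[of n] by (simp add: abs_mult algebra_simps)
qed

section \<open>Long common pieces of two axes\<close>

context fuchsian
begin

text \<open>The shadow of a long piece of a translate of the axis \<open>k\<close> on the axis \<open>l\<close> is almost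
  as long as the piece.\<close>

definition aligned :: "(real^2^2) set \<Rightarrow> real \<Rightarrow> (real^2^2) set \<Rightarrow> nat \<Rightarrow> bool" where
  "aligned k \<tau> l N \<longleftrightarrow> (\<exists>c\<in>G.
     foot (act (pinv l) (act c (act k (imag_axis (real N * \<tau>))))) - foot (act (pinv l) (act c (act k (imag_axis 0))))
       \<ge> real N * \<tau> - 1)"

lemma shadow_le:
  assumes "c \<in> G" "k \<in> carrier PSL2R" "l \<in> carrier PSL2R"
  shows "\<bar>foot (act (pinv l) (act c (act k (imag_axis p)))) - foot (act (pinv l) (act c (act k (imag_axis q))))\<bar> \<le> \<bar>p - q\<bar>"
    "hdist (act (pinv l) (act c (act k (imag_axis p)))) (act (pinv l) (act c (act k (imag_axis q)))) = \<bar>p - q\<bar>"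
proof -
  have il: "pinv l \<in> carrier PSL2R" using assms by simp
  note HP = act_HP[OF assms(2) axis_HP] act_HP[OF G_PSL[OF assms(1)] act_HP[OF assms(2) axis_HP]]
  show *: "hdist (act (pinv l) (act c (act k (imag_axis p)))) (act (pinv l) (act c (act k (imag_axis q)))) = \<bar>p - q\<bar>"
    by (simp add: hdist_act[OF il] hdist_act[OF G_PSL[OF assms(1)]] hdist_act[OF assms(2)] HP hdist_axis)
  show "\<bar>foot (act (pinv l) (act c (act k (imag_axis p)))) - foot (act (pinv l) (act c (act k (imag_axis q))))\<bar> \<le> \<bar>p - q\<bar>"
    using hdist_ge_foot[OF act_HP[OF il HP(2)[of p]] act_HP[OF il HP(2)[of q]]] * by simp
qed

text \<open>Projection does not increase distances, so the initial part of a piece loses no more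
  length than the whole. Failure of alignment hence persists for all larger N.\<close>

lemma aligned_mono:
  assumes k: "k \<in> carrier PSL2R" and l: "l \<in> carrier PSL2R" and \<tau>: "\<tau> \<ge> 0"
    and al: "aligned k \<tau> l N" and MN: "M \<le> N"
  shows "aligned k \<tau> l M"
proof -
  obtain c where c: "c \<in> G" "foot (act (pinv l) (act c (act k (imag_axis (real N * \<tau>))))) - foot (act (pinv l) (act c (act k (imag_axis 0))))
       \<ge> real N * \<tau> - 1" using al by (auto simp: aligned_def)
  have "real M * \<tau> \<le> real N * \<tau>" using MN \<tau> by (intro mult_right_mono) auto
  then show ?thesis
    unfolding aligned_def using shadow_le(1)[OF c(1) k l, of "real N * \<tau>" "real M * \<tau>"] c
    by (intro bexI[of _ c]) auto
qed

text \<open>Pigeonhole: marks at regular distances on a long aligned piece lie close to the axis l,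
  and powers of g move them close to one point of it. The group elements doing so lie in the finite
  set F; with more marks than elements of F two coincide, which relates a power of h to a power of
  g.\<close>

lemma aligned_imp_conjugate_powers:
  assumes h: "h \<in> G" "hyperbolic_along k \<mu> h" and g: "g \<in> G" "hyperbolic_along l \<nu> g"
    and al: "\<And>N. aligned k (ln \<mu>) l N"
  obtains c m I where "c \<in> G" "m > (0::int)" "I > (0::int)"
    "c \<cdot> h \<^bold>^ m = g \<^bold>^ I \<cdot> c"
proof -
  define \<tau> where "\<tau> = ln \<mu>" define \<sigma> where "\<sigma> = ln \<nu>"
  have k: "k \<in> carrier PSL2R" and l: "l \<in> carrier PSL2R" and \<tau>: "\<tau> > 0" and \<sigma>: "\<sigma> > 0"
    using h g by (auto simp: hyperbolic_along_def \<tau>_def \<sigma>_def)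
  have il: "pinv l \<in> carrier PSL2R" using l by simp
  note hP = G_PSL[OF h(1)] and gP = G_PSL[OF g(1)]
  define x where "x = act k (imag_axis 0)" define y where "y = act l (imag_axis 0)"
  have x: "x \<in> HP" and y: "y \<in> HP" unfolding x_def y_def by (simp_all add: act_HP k l)
  have hx: "act (h \<^bold>^ n) x = act k (imag_axis (of_int n * \<tau>))" for n :: int
    using hyperbolic_along_int_pow[OF hP h(2) axis_HP[of 0], of n] by (simp add: x_def \<tau>_def imag_axis_def mult.commute)
  \<comment> \<open>6 bounds the height of the marks, \<sigma> the distance of their feet from 0
    after reduction by powers of g.\<close>
  define F where "F = {X \<in> G. hdist (act X x) y \<le> 6 + \<sigma>}"
  have F: "finite F" unfolding F_def by (rule finite_orbit[OF x y])
  \<comment> \<open>Consecutive marks are more than 2 apart; after the loss of 1 allowed by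
    \<open>aligned\<close> their feet still advance by more than 1, as the height bound
    requires.\<close>
  obtain q :: nat where "2 / \<tau> < q" using reals_Archimedean2 by blast
  then have q: "real q * \<tau> > 2" "q > 0" using \<tau> by (auto simp: field_simps intro!: gr0I)
  define M where "M = card F + 1"
  obtain c where c: "c \<in> G" and cN: "foot (act (pinv l) (act c (act k (imag_axis (real (q * M) * \<tau>)))))
      - foot (act (pinv l) (act c (act k (imag_axis 0)))) \<ge> real (q * M) * \<tau> - 1"
    using al[of "q * M"] by (auto simp: aligned_def \<tau>_def)
  note cP = G_PSL[OF c]
  define v where "v j = act (pinv l) (act c (act k (imag_axis (real (q * j) * \<tau>))))" for j :: nat
  have v: "v j \<in> HP" for j unfolding v_def by (intro act_HP il cP k axis_HP)
  have mono: "real (q * i) * \<tau> \<le> real (q * j) * \<tau>" if "i \<le> j" for i j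
    using that \<tau> by (intro mult_right_mono) (auto intro!: mult_left_mono)
  have v0: "v 0 = act (pinv l) (act c (act k (imag_axis 0)))" by (simp add: v_def)
  have prog: "foot (v j) - foot (v i) \<ge> real (q * j) * \<tau> - real (q * i) * \<tau> - 1" if "i \<le> j" "j \<le> M" for i j
    using shadow_le(1)[OF c k l, of "real (q * M) * \<tau>" "real (q * j) * \<tau>"]
      shadow_le(1)[OF c k l, of "real (q * i) * \<tau>" 0] cN mono[OF that(1)] mono[OF that(2)] mono[of 0 i]
    unfolding v0[symmetric] v_def[symmetric] by simp
  have gap: "real (q * j) * \<tau> - real (q * i) * \<tau> > 2" if "i < j" for i j
  proof -
    have "real (q * j) * \<tau> - real (q * i) * \<tau> = real (j - i) * (real q * \<tau>)"
      using that by (simp add: of_nat_diff algebra_simps)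
    also have "\<dots> \<ge> 1 * (real q * \<tau>)" using that q \<tau> by (intro mult_right_mono) auto
    finally show ?thesis using q by simp
  qed
  have height: "height (v j) \<le> 6" if "0 < j" "j \<le> M" for j
  proof (rule height_bound_of_progress(2)[OF v v])
    show "hdist (v 0) (v j) \<le> \<bar>foot (v 0) - foot (v j)\<bar> + 1" "1 \<le> \<bar>foot (v 0) - foot (v j)\<bar>"
      using shadow_le(2)[OF c k l, of 0 "real (q * j) * \<tau>"] prog[of 0 j] gap[of 0 j] that
      unfolding v0[symmetric] v_def[symmetric] by simp_all
  qed
  \<comment> \<open>The number of full periods of g below the foot of the mark.\<close>
  define \<iota> where "\<iota> j = \<lfloor>foot (v j) / \<sigma>\<rfloor>" for j
  define X where "X j = g \<^bold>^ (- \<iota> j) \<cdot> (c \<cdot> h \<^bold>^ int (q * j))" for j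
  have gl: "act (g \<^bold>^ n) (act l w) = act l (of_real (exp (of_int n * \<sigma>)) * w)" if "w \<in> HP" for n w
    using hyperbolic_along_int_pow[OF gP g(2) that] by (simp add: \<sigma>_def)
  have chx: "act (c \<cdot> h \<^bold>^ int (q * j)) x = act l (v j)" for j
    using cP hP x l by (simp add: act_mult hx v_def act_HP k)
  have XF: "X j \<in> F" if "0 < j" "j \<le> M" for j
  proof -
    have XG: "X j \<in> G" unfolding X_def by (intro mult_G int_pow_G c h g)
    define w where "w = of_real (exp (of_int (- \<iota> j) * \<sigma>)) * v j"
    have w: "w \<in> HP" unfolding w_def using v by simp
    have "act (X j) x = act (g \<^bold>^ (- \<iota> j)) (act l (v j))"
      unfolding X_def chx[symmetric] using gP cP hP x by (intro act_mult) auto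
    then have "act (X j) x = act l w" using gl[OF v] by (simp add: w_def)
    then have "hdist (act (X j) x) y = hdist w (imag_axis 0)" by (simp add: y_def hdist_act[OF l w])
    also have "\<dots> \<le> height w + \<bar>foot w\<bar>" using hdist_axis_le[OF w, of 0] by simp
    also have "height w = height (v j)"
      by (simp add: w_def height_def norm_mult)
    also have "foot w = foot (v j) - of_int (\<iota> j) * \<sigma>"
      using HP_cmod_pos[OF v[of j]] by (simp add: w_def foot_def norm_mult ln_mult)
    also have "\<bar>foot (v j) - of_int (\<iota> j) * \<sigma>\<bar> \<le> \<sigma>"
    proof -
      have "of_int (\<iota> j) \<le> foot (v j) / \<sigma>" "foot (v j) / \<sigma> < of_int (\<iota> j) + 1"
        unfolding \<iota>_def by linarith+
      then have "of_int (\<iota> j) * \<sigma> \<le> foot (v j)" "foot (v j) < (of_int (\<iota> j) + 1) * \<sigma>"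
        using \<sigma> by (simp_all add: pos_le_divide_eq pos_divide_less_eq)
      then show ?thesis by (simp add: algebra_simps)
    qed
    finally show ?thesis using height[OF that] XG by (simp add: F_def)
  qed
  have "\<not> inj_on X {1..M}"
  proof
    assume "inj_on X {1..M}"
    then have "card {1..M} \<le> card F" using XF F by (intro card_inj_on_le) auto
    then show False by (simp add: M_def)
  qed
  then obtain i' j' where "i' \<in> {1..M}" "j' \<in> {1..M}" "i' \<noteq> j'" "X i' = X j'" by (auto simp: inj_on_def)
  then obtain i j where ij: "1 \<le> i" "i < j" "j \<le> M" "X i = X j"
    by (metis atLeastAtMost_iff nat_neq_iff)
  define I where "I = \<iota> j - \<iota> i"
  define m where "m = int (q * (j - i))"
  have a: "c \<cdot> h \<^bold>^ int (q * j) = g \<^bold>^ I \<cdot> (c \<cdot> h \<^bold>^ int (q * i))"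
  proof -
    have cancel: "g \<^bold>^ \<iota> j \<cdot> (g \<^bold>^ n \<cdot> Z) = g \<^bold>^ (\<iota> j + n) \<cdot> Z"
      if "Z \<in> carrier PSL2R" for n Z
      using gP that by (simp add: PSL.int_pow_mult PSL.m_assoc)
    have "g \<^bold>^ \<iota> j \<cdot> X j = g \<^bold>^ \<iota> j \<cdot> X i" using ij by simp
    then show ?thesis unfolding X_def using cancel gP cP hP by (simp add: I_def)
  qed
  have conj: "c \<cdot> h \<^bold>^ m = g \<^bold>^ I \<cdot> c"
  proof -
    have "h \<^bold>^ int (q * j) = h \<^bold>^ m \<cdot> h \<^bold>^ int (q * i)"
      using hP ij by (simp add: m_def of_nat_diff algebra_simps flip: PSL.int_pow_mult)
    with a have "(c \<cdot> h \<^bold>^ m) \<cdot> h \<^bold>^ int (q * i)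
        = (g \<^bold>^ I \<cdot> c) \<cdot> h \<^bold>^ int (q * i)"
      using hP cP gP by (simp add: PSL.m_assoc)
    then show ?thesis using hP cP gP by (simp add: PSL.right_cancel)
  qed
  have "act l (v j) = act (g \<^bold>^ I) (act l (v i))"
    unfolding chx[symmetric] a using gP cP hP x by (intro act_mult) auto
  also have "\<dots> = act l (of_real (exp (of_int I * \<sigma>)) * v i)" by (rule gl[OF v])
  finally have "v j = of_real (exp (of_int I * \<sigma>)) * v i"
    using act_inv_act[OF l] v by (metis HP_scale exp_gt_zero)
  then have "foot (v j) = foot (v i) + of_int I * \<sigma>"
    using HP_cmod_pos[OF v[of i]] by (simp add: foot_def norm_mult ln_mult)
  \<comment> \<open>The feet advance from mark i to mark j, so the two axes agree in direction and
    not only as lines.\<close>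
  then have "of_int I * \<sigma> > 0" using prog[of i j] gap[of i j] ij by simp
  then have "I > 0" using \<sigma> by (simp add: zero_less_mult_iff)
  moreover have "m > 0" using q ij by (simp add: m_def)
  ultimately show thesis using that c conj by blast
qed

text \<open>In the coordinates of the two axes, c intertwines the homotheties of the powers, so it
  is a homothety itself and carries the axis k to the axis l with its direction.\<close>

lemma conjugate_powers_imp_common_axis:
  fixes m I :: int
  assumes h: "h \<in> G" "hyperbolic_along k \<mu> h" and g: "g \<in> G" "hyperbolic_along l \<nu> g" and c: "c \<in> G"
    and mI: "m > 0" "I > 0" "c \<cdot> h \<^bold>^ m = g \<^bold>^ I \<cdot> c"
  shows "hyperbolic_along k \<nu> (pinv c \<cdot> g \<cdot> c)"
proof -
  have k: "k \<in> carrier PSL2R" and l: "l \<in> carrier PSL2R" and \<mu>: "\<mu> > 1" and \<nu>: "\<nu> > 1"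
    using h g by (auto simp: hyperbolic_along_def)
  note hP = G_PSL[OF h(1)] and gP = G_PSL[OF g(1)] and cP = G_PSL[OF c]
  have gl: "act g (act l w) = act l (of_real \<nu> * w)" if "w \<in> HP" for w
    using g(2) that by (simp add: hyperbolic_along_def)
  define Y where "Y = pinv l \<cdot> (c \<cdot> k)"
  have Y: "Y \<in> carrier PSL2R" using k l cP by (simp add: Y_def)
  have lY: "act l (act Y z) = act c (act k z)" if "z \<in> HP" for z
    using that k l cP by (simp add: Y_def act_mult act_HP)
  have "act Y (of_real (exp (of_int m * ln \<mu>)) * z) = of_real (exp (of_int I * ln \<nu>)) * act Y z"
    if z: "z \<in> HP" for z
  proof -
    have "act l (act Y (of_real (exp (of_int m * ln \<mu>)) * z)) = act c (act (h \<^bold>^ m) (act k z))"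
      using z by (simp add: lY hyperbolic_along_int_pow[OF hP h(2)])
    also have "\<dots> = act (c \<cdot> h \<^bold>^ m) (act k z)"
      using z cP hP k by (simp add: act_mult act_HP)
    also have "\<dots> = act (g \<^bold>^ I) (act l (act Y z))"
      unfolding mI(3) using z cP gP k by (simp add: act_mult act_HP lY)
    also have "\<dots> = act l (of_real (exp (of_int I * ln \<nu>)) * act Y z)"
      by (rule hyperbolic_along_int_pow[OF gP g(2) act_HP[OF Y z]])
    finally show ?thesis
      using act_inv_act[OF l] act_HP[OF Y] z by (metis HP_scale exp_gt_zero)
  qed
  then obtain \<beta> where \<beta>: "\<beta> > 0" "\<And>z. z \<in> HP \<Longrightarrow> act Y z = of_real \<beta> * z"
    using intertwines_homotheties[OF Y, of "exp (of_int m * ln \<mu>)" "exp (of_int I * ln \<nu>)"] \<mu> \<nu> mI(1,2)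
    by (auto simp: one_less_exp_iff)
  have "act (pinv c \<cdot> g \<cdot> c) (act k z) = act k (of_real \<nu> * z)" if z: "z \<in> HP" for z
  proof -
    have nz: "of_real \<nu> * z \<in> HP" using z \<nu> by simp
    have "act (pinv c \<cdot> g \<cdot> c) (act k z) = act (pinv c) (act g (act l (act Y z)))"
      using z cP gP k by (simp add: act_mult act_HP lY)
    also have "act g (act l (act Y z)) = act l (of_real \<nu> * act Y z)"
      using act_HP[OF Y z] by (rule gl)
    also have "of_real \<nu> * act Y z = act Y (of_real \<nu> * z)"
      using \<beta>(2)[OF z] \<beta>(2)[OF nz] by simp
    also have "act l (act Y (of_real \<nu> * z)) = act c (act k (of_real \<nu> * z))" by (rule lY[OF nz])
    finally show ?thesis using cP k nz by (simp add: act_HP)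
  qed
  then show ?thesis using k \<nu> by (simp add: hyperbolic_along_def)
qed

lemma hyperbolic_along_eqI:
  assumes "X \<in> G" "hyperbolic_along k \<mu> X" "Y \<in> G" "hyperbolic_along k \<mu> Y"
  shows "X = Y"
proof (rule act_eqI[OF G_PSL[OF assms(1)] G_PSL[OF assms(3)]])
  fix z assume z: "z \<in> HP"
  have k: "k \<in> carrier PSL2R" using assms by (simp add: hyperbolic_along_def)
  have w: "act (pinv k) z \<in> HP" using k z by (simp add: act_HP)
  show "act X z = act Y z"
    using assms(2,4) w k z unfolding hyperbolic_along_def by (metis act_act_inv)
qed

text \<open>Elements translating along the axis k are determined by their signed length, and the
  lengths form a discrete group of reals. Primitivity makes the length of h a generator.\<close>

lemma primitive_hyperbolic_centralizer:
  assumes prim: "primitive_element \<Gamma> h" and h: "hyperbolic_along k \<mu> h"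
    and g: "g \<in> G" "hyperbolic_along k \<nu> g"
  shows "\<exists>n::int. g = h \<^bold>^ n"
proof -
  have hG: "h \<in> G" using prim by (simp add: primitive_element_def)
  note hP = G_PSL[OF hG] and gP = G_PSL[OF g(1)]
  have k: "k \<in> carrier PSL2R" and \<mu>: "\<mu> > 1" and \<nu>: "\<nu> > 1" using h g by (auto simp: hyperbolic_along_def)
  \<comment> \<open>Unlike \<open>hyperbolic_along\<close> this admits zero and negative lengths, so
    that T becomes a group.\<close>
  define dil where "dil X t \<longleftrightarrow> X \<in> G \<and> (\<forall>z\<in>HP. act X (act k z) = act k (of_real (exp t) * z))" for X t
  define T where "T = {t. \<exists>X. dil X t}"
  have dil_eq: "X = Y" if "dil X t" "dil Y t" for X Y t
  proof (rule act_eqI)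
    show "X \<in> carrier PSL2R" "Y \<in> carrier PSL2R" using that G_PSL by (auto simp: dil_def)
    fix z assume z: "z \<in> HP"
    then have "act (pinv k) z \<in> HP" using k by (simp add: act_HP)
    then show "act X z = act Y z" using that k z unfolding dil_def by (metis act_act_inv)
  qed
  have hpow: "dil (h \<^bold>^ n) (of_int n * ln \<mu>)" for n :: int
    unfolding dil_def using hyperbolic_along_int_pow[OF hP h] hG int_pow_G by blast
  have dil_mult: "dil (X \<cdot> Y) (s + t)" if "dil X s" "dil Y t" for X Y s t
    using that G_PSL k by (auto simp: dil_def mult_G act_mult act_HP exp_add mult.assoc)
  have dil_inv: "dil (pinv X) (- t)" if X: "dil X t" for X t
    unfolding dil_def
  proof (intro conjI ballI)
    show "pinv X \<in> G" using X by (simp add: dil_def inv_G)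
    fix z assume z: "z \<in> HP"
    define w where "w = of_real (exp (- t)) * z"
    have w: "w \<in> HP" using z by (simp add: w_def)
    have "act X (act k w) = act k z" using X w by (simp add: dil_def w_def exp_minus flip: of_real_mult mult.assoc)
    then have "act (pinv X) (act k z) = act k w"
      using act_inv_act[of X "act k w"] X w k G_PSL by (auto simp: dil_def act_HP)
    then show "act (pinv X) (act k z) = act k (of_real (exp (- t)) * z)" by (simp add: w_def)
  qed
  have diff: "s - t \<in> T" if "s \<in> T" "t \<in> T" for s t
    using that dil_mult[OF _ dil_inv] by (force simp: T_def)
  have T_mu: "ln \<mu> \<in> T" using hpow[of 1] by (auto simp: T_def)
  have "dil g (ln \<nu>)" using g \<nu> by (auto simp: dil_def hyperbolic_along_def)
  then have T_nu: "ln \<nu> \<in> T" by (auto simp: T_def)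
  define x where "x = act k (imag_axis 0)"
  have x: "x \<in> HP" unfolding x_def by (simp add: act_HP k)
  have dx: "act X x = act k (imag_axis t)" if "dil X t" for X t
    using that axis_HP[of 0] by (simp add: dil_def x_def imag_axis_def mult.commute)
  have "finite {t \<in> T. 0 < t \<and> t \<le> ln \<mu>}"
  proof (rule finite_subset)
    show "{t \<in> T. 0 < t \<and> t \<le> ln \<mu>} \<subseteq> (\<lambda>X. foot (act (pinv k) (act X x))) ` {X \<in> G. hdist (act X x) x \<le> ln \<mu>}"
    proof
      fix t assume t: "t \<in> {t \<in> T. 0 < t \<and> t \<le> ln \<mu>}"
      then obtain X where X: "dil X t" by (auto simp: T_def)
      have "hdist (act X x) x = t"
        using t unfolding dx[OF X] unfolding x_def by (simp add: hdist_act[OF k] hdist_axis)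
      moreover have "t = foot (act (pinv k) (act X x))" by (simp add: dx[OF X] k)
      ultimately show "t \<in> (\<lambda>X. foot (act (pinv k) (act X x))) ` {X \<in> G. hdist (act X x) x \<le> ln \<mu>}"
        using t X by (intro image_eqI[of _ _ X]) (auto simp: dil_def)
    qed
    show "finite ((\<lambda>X. foot (act (pinv k) (act X x))) ` {X \<in> G. hdist (act X x) x \<le> ln \<mu>})"
      by (intro finite_imageI finite_orbit x)
  qed
  moreover have "\<bar>n\<bar> < 2" if "b \<in> T" "ln \<mu> = of_int n * b" for b and n :: int
  proof (rule ccontr)
    assume n: "\<not> \<bar>n\<bar> < 2"
    obtain X where X: "dil X b" using \<open>b \<in> T\<close> by (auto simp: T_def)
    then have XG: "X \<in> G" by (simp add: dil_def)
    have pow: "dil (X \<^bold>^ m) (real m * b)" for m :: nat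
    proof (induction m)
      case 0
      then show ?case by (simp add: dil_def one_G)
    next
      case (Suc m)
      then show ?case using dil_mult[OF Suc X] by (simp add: algebra_simps)
    qed
    have "dil (X \<^bold>^ n) (of_int n * b)"
    proof (cases n rule: int_cases2)
      case (nonneg m)
      then show ?thesis using pow by (simp add: int_pow_int)
    next
      case (nonpos m)
      then show ?thesis using dil_inv[OF pow[of m]] G_PSL[OF XG] by (simp add: PSL.int_pow_neg_int)
    qed
    then have "h = X \<^bold>^ n" using dil_eq hpow[of 1] that(2) hP by simp
    then have "h = X [^]\<^bsub>\<Gamma>\<^esub> n" using PSL.int_pow_consistent[OF subgroup XG] by simp
    moreover have "\<bar>n\<bar> \<ge> 2" using n by simp
    ultimately show False using prim XG unfolding primitive_element_def by auto
  qed
  ultimately obtain n :: int where "ln \<nu> = of_int n * ln \<mu>"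
    using discrete_real_subgroup[of T "ln \<mu>" "ln \<nu>"] diff T_mu T_nu \<mu> by auto
  then have "g = h \<^bold>^ n" using dil_eq hpow[of n] \<open>dil g (ln \<nu>)\<close> by simp
  then show ?thesis by blast
qed

end

lemma PSL_cancel:
  assumes "x \<in> carrier PSL2R" "y \<in> carrier PSL2R"
  shows "x \<cdot> (pinv x \<cdot> y) = y"
    "pinv x \<cdot> (x \<cdot> y) = y"
  using assms by (simp_all flip: PSL.m_assoc)

section \<open>Shortcuts along the translates of an axis\<close>

context fuchsian
begin

lemma conjugate_in_Gamma:
  "conjugate_in \<Gamma> x y \<longleftrightarrow> (\<exists>c\<in>G. c \<cdot> x \<cdot> pinv c = y)"
  unfolding conjugate_in_def using PSL.m_inv_consistent[OF subgroup] by auto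

lemma int_pow_Gamma: "X \<in> G \<Longrightarrow> X [^]\<^bsub>\<Gamma>\<^esub> (n::int) = X \<^bold>^ n"
  using PSL.int_pow_consistent[OF subgroup] by simp

text \<open>Alignment for all N would conjugate g to an element with the oriented axis of h, which
  is a power of h by primitivity.\<close>

lemma not_aligned_of_not_conjugate:
  assumes prim: "primitive_element \<Gamma> h" and h: "hyperbolic_along k \<mu> h"
    and g: "g \<in> G" "hyperbolic_along l \<nu> g"
    and nconj: "\<And>n::int. \<not> conjugate_in \<Gamma> g (h [^]\<^bsub>\<Gamma>\<^esub> n)"
  shows "\<exists>N. \<not> aligned k (ln \<mu>) l N"
proof (rule ccontr)
  assume "\<not> ?thesis"
  then have al: "\<And>N. aligned k (ln \<mu>) l N" by blast
  have hG: "h \<in> G" using prim by (simp add: primitive_element_def)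
  obtain c and m I :: int where c: "c \<in> G" "m > 0" "I > 0"
    "c \<cdot> h \<^bold>^ m = g \<^bold>^ I \<cdot> c"
    using aligned_imp_conjugate_powers[OF hG h g al] by blast
  define g' where "g' = pinv c \<cdot> g \<cdot> c"
  have "hyperbolic_along k \<nu> g'"
    unfolding g'_def by (rule conjugate_powers_imp_common_axis[OF hG h g c])
  moreover have "g' \<in> G" unfolding g'_def by (intro mult_G inv_G c g)
  ultimately obtain n :: int where "g' = h \<^bold>^ n"
    using primitive_hyperbolic_centralizer[OF prim h] by blast
  then have "conjugate_in \<Gamma> g (h [^]\<^bsub>\<Gamma>\<^esub> n)"
    unfolding conjugate_in_Gamma int_pow_Gamma[OF hG] using c(1) G_PSL
    by (intro bexI[of _ "pinv c"]) (auto simp: g'_def inv_G)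
  then show False using nconj by blast
qed

text \<open>The reversed axis belongs to the inverse of h. Alignment with it would conjugate that
  inverse to an element with the same axis, direction and factor as h, that is, to h itself.\<close>

lemma not_aligned_inverse:
  assumes hG: "h \<in> G" and h: "hyperbolic_along k \<mu> h"
    and nconj: "\<not> conjugate_in \<Gamma> h (inv\<^bsub>\<Gamma>\<^esub> h)"
  shows "\<exists>N. \<not> aligned k (ln \<mu>) (k \<cdot> inversion) N"
proof (rule ccontr)
  assume "\<not> ?thesis"
  then have al: "\<And>N. aligned k (ln \<mu>) (k \<cdot> inversion) N" by blast
  note hP = G_PSL[OF hG]
  note hinv = inv_G[OF hG] hyperbolic_along_inv[OF hP h]
  obtain c and m I :: int where c: "c \<in> G" "m > 0" "I > 0"
    "c \<cdot> h \<^bold>^ m = (pinv h) \<^bold>^ I \<cdot> c"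
    using aligned_imp_conjugate_powers[OF hG h hinv al] by blast
  note cP = G_PSL[OF c(1)]
  have "hyperbolic_along k \<mu> (pinv c \<cdot> pinv h \<cdot> c)"
    by (rule conjugate_powers_imp_common_axis[OF hG h hinv c])
  then have "h = pinv c \<cdot> pinv h \<cdot> c"
    using hyperbolic_along_eqI[OF hG h] by (simp add: mult_G inv_G c hG)
  then have "c \<cdot> h \<cdot> pinv c
      = c \<cdot> (pinv c \<cdot> pinv h \<cdot> c) \<cdot> pinv c"
    by simp
  also have "\<dots> = pinv h" using cP hP by (simp add: PSL.m_assoc PSL_cancel)
  finally have "conjugate_in \<Gamma> h (inv\<^bsub>\<Gamma>\<^esub> h)"
    unfolding conjugate_in_Gamma using c(1) PSL.m_inv_consistent[OF subgroup hG] by auto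
  then show False using nconj by blast
qed

text \<open>A full orbit under G, which makes the path metric invariant. The length L will be a
  multiple of \<open>ln \<mu>\<close>, so that segments fit end to end along the axis of h.\<close>

definition axis_segments :: "(real^2^2) set \<Rightarrow> real \<Rightarrow> (complex \<times> complex) set" where
  "axis_segments k L = (\<lambda>c. (act c (act k (imag_axis 0)), act c (act k (imag_axis L)))) ` G"

lemma axis_segments_shortcut_set:
  assumes "k \<in> carrier PSL2R" "L \<ge> 2"
  shows "shortcut_set L (axis_segments k L)"
  using assms by (auto simp: shortcut_set_def axis_segments_def act_HP G_PSL hdist_act hdist_axis)

lemma act_pairs_axis_segments:
  assumes k: "k \<in> carrier PSL2R" and g: "g \<in> G"
  shows "act_pairs g (axis_segments k L) = axis_segments k L"
proof -
  have HP: "act k (imag_axis p) \<in> HP" for p using k by (simp add: act_HP)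
  have eq: "act_pairs g (axis_segments k L) = (\<lambda>c. (act c (act k (imag_axis 0)), act c (act k (imag_axis L)))) ` ((\<lambda>c. g \<cdot> c) ` G)"
    unfolding act_pairs_def axis_segments_def image_image
    by (intro image_cong) (auto simp: act_mult G_PSL g HP)
  have "(\<lambda>c. g \<cdot> c) ` G = G"
  proof (intro equalityI subsetI)
    fix c assume c: "c \<in> G"
    then have "c = g \<cdot> (pinv g \<cdot> c)" using g G_PSL by (simp flip: PSL.m_assoc)
    then show "c \<in> (\<lambda>c. g \<cdot> c) ` G" 
      by (rule image_eqI) (intro mult_G inv_G g c)
  qed (auto intro: mult_G g)
  then show ?thesis unfolding eq by (simp add: axis_segments_def)
qed

lemma asym_invariant:
  assumes "k \<in> carrier PSL2R" "L \<ge> 2" "g \<in> G" "x \<in> HP" "y \<in> HP"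
  shows "asym L (axis_segments k L) (act g x) (act g y) = asym L (axis_segments k L) x y"
  using sdist_act[OF axis_segments_shortcut_set[OF assms(1,2)] G_PSL[OF assms(3)]]
    assms act_pairs_axis_segments[OF assms(1,3), of L]
  by (simp add: asym_def)

text \<open>The potential is the position of the foot on the axis l. A shortcut advances it by less
  than its cost L - 1, because the tolerance 1 in \<open>aligned\<close> equals the discount;
  ordinary moves are covered since projection does not increase distances.\<close>

lemma sdist_along_not_aligned:
  assumes k: "k \<in> carrier PSL2R" and L: "real N * \<tau> \<ge> 2" and l: "l \<in> carrier PSL2R"
    and na: "\<not> aligned k \<tau> l N" and x: "x \<in> HP" and y: "y \<in> HP"
  shows "foot (act (pinv l) y) - foot (act (pinv l) x)
    \<le> sdist (real N * \<tau>) (axis_segments k (real N * \<tau>)) x y"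
proof (rule sdist_ge_potential[OF axis_segments_shortcut_set[OF k L] x y])
  have il: "pinv l \<in> carrier PSL2R" using l by simp
  fix u v assume st: "move (axis_segments k (real N * \<tau>)) u v"
  show "foot (act (pinv l) v) - foot (act (pinv l) u)
    \<le> move_cost (real N * \<tau>) (axis_segments k (real N * \<tau>)) u v"
  proof (cases "(u, v) \<in> axis_segments k (real N * \<tau>)")
    case True
    then show ?thesis using na by (auto simp: move_cost_def axis_segments_def aligned_def not_le)
  next
    case False
    have uv: "u \<in> HP" "v \<in> HP" using st by (auto simp: move_def)
    show ?thesis
      using hdist_ge_foot[OF act_HP[OF il uv(1)] act_HP[OF il uv(2)]] False hdist_act[OF il uv]
      by (simp add: move_cost_def)
  qed
qed

text \<open>The three reasons for which the value at g will vanish: a fixed point, arbitrarily small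
  displacements, or an axis along which shortcuts gain nothing in either direction.\<close>

definition tame :: "(real^2^2) set \<Rightarrow> real \<Rightarrow> (real^2^2) set \<Rightarrow> nat \<Rightarrow> bool" where
  "tame k \<tau> g N \<longleftrightarrow> elliptic g \<or> (\<exists>l s. parabolic_along l s g) \<or>
     (\<exists>l \<nu>. hyperbolic_along l \<nu> g \<and> \<not> aligned k \<tau> l N \<and> \<not> aligned k \<tau> (l \<cdot> inversion) N)"

lemma eventually_not_aligned:
  assumes "k \<in> carrier PSL2R" "l \<in> carrier PSL2R" "\<tau> \<ge> 0" "\<exists>N. \<not> aligned k \<tau> l N"
  shows "eventually (\<lambda>N. \<not> aligned k \<tau> l N) sequentially"
  using aligned_mono[OF assms(1-3)] assms(4) unfolding eventually_sequentially by blast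

text \<open>The reversed axis of g is the axis of its inverse, which is not conjugate to a power of
  h either, since the powers of h are closed under inversion.\<close>

lemma eventually_tame:
  assumes prim: "primitive_element \<Gamma> h" and h: "hyperbolic_along k \<mu> h" and g: "g \<in> G"
    and nconj: "\<And>n::int. \<not> conjugate_in \<Gamma> g (h [^]\<^bsub>\<Gamma>\<^esub> n)"
  shows "eventually (tame k (ln \<mu>) g) sequentially"
proof (cases "elliptic g \<or> (\<exists>l s. parabolic_along l s g)")
  case True
  then have "tame k (ln \<mu>) g = (\<lambda>_. True)" by (auto simp: tame_def fun_eq_iff)
  then show ?thesis by simp
next
  case False
  then obtain l \<nu> where l: "hyperbolic_along l \<nu> g" using trichotomy[OF G_PSL[OF g]] by blast
  have hG: "h \<in> G" using prim by (simp add: primitive_element_def)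
  note hP = G_PSL[OF hG] and gP = G_PSL[OF g]
  have k: "k \<in> carrier PSL2R" "ln \<mu> \<ge> 0" using h by (auto simp: hyperbolic_along_def)
  have lP: "l \<in> carrier PSL2R" using l by (simp add: hyperbolic_along_def)
  have "\<not> conjugate_in \<Gamma> (pinv g) (h [^]\<^bsub>\<Gamma>\<^esub> n)" for n :: int
  proof
    assume "conjugate_in \<Gamma> (pinv g) (h [^]\<^bsub>\<Gamma>\<^esub> n)"
    then obtain c where c: "c \<in> G" "c \<cdot> pinv g \<cdot> pinv c = h \<^bold>^ n"
      by (auto simp: conjugate_in_Gamma int_pow_Gamma[OF hG])
    have "c \<cdot> g \<cdot> pinv c
        = pinv (c \<cdot> pinv g \<cdot> pinv c)"
      using G_PSL[OF c(1)] gP by (simp add: PSL.inv_mult_group PSL.m_assoc)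
    also have "\<dots> = h \<^bold>^ (- n)" unfolding c(2) using hP by (simp add: PSL.int_pow_neg)
    finally have "conjugate_in \<Gamma> g (h [^]\<^bsub>\<Gamma>\<^esub> (- n))"
      using c(1) by (auto simp: conjugate_in_Gamma int_pow_Gamma[OF hG])
    then show False using nconj by blast
  qed
  then have "\<exists>N. \<not> aligned k (ln \<mu>) (l \<cdot> inversion) N"
    by (rule not_aligned_of_not_conjugate[OF prim h inv_G[OF g] hyperbolic_along_inv[OF gP l]])
  then have "eventually (\<lambda>N. \<not> aligned k (ln \<mu>) (l \<cdot> inversion) N) sequentially"
    by (rule eventually_not_aligned[OF k(1) _ k(2), rotated]) (simp add: lP)
  moreover have "eventually (\<lambda>N. \<not> aligned k (ln \<mu>) l N) sequentially"
    by (rule eventually_not_aligned[OF k(1) lP k(2) not_aligned_of_not_conjugate[OF prim h g l nconj]])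
  ultimately show ?thesis
    by eventually_elim (use l in \<open>auto simp: tame_def\<close>)
qed

lemma foot_inversion_conj:
  assumes "l \<in> carrier PSL2R" "z \<in> HP"
  shows "foot (act (pinv (l \<cdot> inversion)) z) = - foot (act (pinv l) z)"
  using assms by (simp add: PSL.inv_mult_group act_mult foot_inversion act_HP)

lemma hdist_pow_le:
  assumes g: "g \<in> carrier PSL2R" and x: "x \<in> HP"
  shows "hdist x (act (g \<^bold>^ (n::nat)) x) \<le> real n * hdist x (act g x)"
proof (induction n)
  case (Suc n)
  have gn: "g \<^bold>^ n \<in> carrier PSL2R" using g by simp
  have "hdist x (act (g \<^bold>^ Suc n) x)
     \<le> hdist x (act (g \<^bold>^ n) x) + hdist (act (g \<^bold>^ n) x) (act (g \<^bold>^ n) (act g x))"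
    using g x hdist_triangle[OF x act_HP[OF gn x] act_HP[OF gn act_HP[OF g x]]] by (simp add: act_mult)
  also have "\<dots> \<le> real n * hdist x (act g x) + hdist x (act g x)"
    using Suc hdist_act[OF gn x act_HP[OF g x]] by simp
  finally show ?case by (simp add: algebra_simps)
qed simp

lemma elliptic_pow_fixes:
  assumes "g \<in> carrier PSL2R" "z \<in> HP" "act g z = z"
  shows "act (g \<^bold>^ (n::nat)) z = z"
  using assms by (induction n) (auto simp: act_mult)

text \<open>In the coordinate l, a point at height t is moved by a distance with hyperbolic cosine 1
  + s^2 / (2 t^2), which tends to 1.\<close>

lemma parabolic_small_displacement:
  assumes par: "parabolic_along l s g" and \<epsilon>: "\<epsilon> > 0"
  obtains x where "x \<in> HP" "hdist x (act g x) < \<epsilon>"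
proof -
  have l: "l \<in> carrier PSL2R" using par by (simp add: parabolic_along_def)
  have "cosh \<epsilon> > 1" using \<epsilon> by (metis cosh_0 cosh_real_nonneg_less_iff less_eq_real_def order_refl)
  define t where "t = sqrt (s\<^sup>2 / (cosh \<epsilon> - 1)) + 1"
  have c: "cosh \<epsilon> - 1 > 0" using \<open>cosh \<epsilon> > 1\<close> by simp
  have "sqrt (s\<^sup>2 / (cosh \<epsilon> - 1)) \<ge> 0" using c by simp
  then have t: "t > 0" unfolding t_def by linarith
  have "s\<^sup>2 / (cosh \<epsilon> - 1) = (sqrt (s\<^sup>2 / (cosh \<epsilon> - 1)))\<^sup>2" using c by simp
  also have "\<dots> < t\<^sup>2" unfolding t_def using c by (intro power_strict_mono) auto
  finally have "s\<^sup>2 < (cosh \<epsilon> - 1) * t\<^sup>2" using c by (simp add: pos_divide_less_eq mult.commute)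
  then have s2: "s\<^sup>2 / (2 * t * t) < cosh \<epsilon> - 1"
  proof -
    have "(cosh \<epsilon> - 1) * (2 * t * t) = 2 * ((cosh \<epsilon> - 1) * t\<^sup>2)" by (simp add: power2_eq_square)
    moreover have "(cosh \<epsilon> - 1) * t\<^sup>2 > 0" using c t by simp
    ultimately have "s\<^sup>2 < (cosh \<epsilon> - 1) * (2 * t * t)"
      using \<open>s\<^sup>2 < (cosh \<epsilon> - 1) * t\<^sup>2\<close> by linarith
    then show ?thesis using t by (simp add: pos_divide_less_eq)
  qed
  define w where "w = \<i> * of_real t"
  have w: "w \<in> HP" using t by (simp add: w_def HP_def)
  have "hcosh w (w + of_real s) = 1 + s\<^sup>2 / (2 * t * t)"
    by (simp add: hcosh_def w_def)
  then have "cosh (hdist w (w + of_real s)) < cosh \<epsilon>"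
    using s2 w by (simp add: cosh_hdist)
  then have "hdist w (w + of_real s) < \<epsilon>"
    using \<epsilon> hdist_nonneg[OF w HP_translate[OF w]] by (meson cosh_real_nonneg_less_iff less_imp_le)
  moreover have "hdist (act l w) (act g (act l w)) = hdist w (w + of_real s)"
    using par w l by (simp add: parabolic_along_def hdist_act)
  ultimately show thesis using that[of "act l w"] w l by (simp add: act_HP)
qed

text \<open>With x on the axis of h and y its image under the power n N, n shortcuts end to end lead
  from x to y at cost n (L - 1), while the way back costs at least n L. The asymmetry is at most -n,
  so the value at h cannot be 0.\<close>

lemma hyperbolic_case:
  assumes prim: "primitive_element \<Gamma> h" and h: "hyperbolic_along k \<mu> h"
    and nconj: "\<not> conjugate_in \<Gamma> h (inv\<^bsub>\<Gamma>\<^esub> h)"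
    and S: "finite S" "S \<subseteq> G"
    and S_nconj: "\<And>g n. g \<in> S \<Longrightarrow> \<not> conjugate_in \<Gamma> g (h [^]\<^bsub>\<Gamma>\<^esub> (n::int))"
  shows "\<exists>r. homogeneous_quasi_morphism \<Gamma> r \<and> r h \<noteq> 0 \<and> (\<forall>g\<in>S. r g = 0)"
proof -
  have hG: "h \<in> G" using prim by (simp add: primitive_element_def)
  note hP = G_PSL[OF hG]
  define \<tau> where "\<tau> = ln \<mu>"
  have k: "k \<in> carrier PSL2R" and \<tau>: "\<tau> > 0" using h by (auto simp: hyperbolic_along_def \<tau>_def)
  have kf: "k \<cdot> inversion \<in> carrier PSL2R" using k by simp
  have "eventually (\<lambda>N. \<forall>g\<in>S. tame k \<tau> g N) sequentially"
    unfolding \<tau>_def using S eventually_tame[OF prim h _ S_nconj]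
    by (intro eventually_ball_finite) auto
  moreover have "eventually (\<lambda>N. \<not> aligned k \<tau> (k \<cdot> inversion) N) sequentially"
    using not_aligned_inverse[OF hG h nconj] \<tau> unfolding \<tau>_def
    by (intro eventually_not_aligned k kf) auto
  moreover have "eventually (\<lambda>N. real N \<ge> 2 / \<tau>) sequentially"
    by (rule eventually_sequentiallyI[of "nat \<lceil>2 / \<tau>\<rceil>"]) linarith
  ultimately have "eventually (\<lambda>N. (\<forall>g\<in>S. tame k \<tau> g N) \<and> \<not> aligned k \<tau> (k \<cdot> inversion) N \<and> real N \<ge> 2 / \<tau>) sequentially"
    by eventually_elim simp
  then obtain N where N: "\<forall>g\<in>S. tame k \<tau> g N" "\<not> aligned k \<tau> (k \<cdot> inversion) N" "real N \<ge> 2 / \<tau>"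
    by (auto simp: eventually_sequentially)
  define L where "L = real N * \<tau>"
  have L: "L \<ge> 2" using N(3) \<tau> by (simp add: L_def field_simps)
  define E where "E = axis_segments k L"
  have SE: "shortcut_set L E" unfolding E_def by (rule axis_segments_shortcut_set[OF k L])
  have lower: "foot (act (pinv l) y) - foot (act (pinv l) x) \<le> sdist L E x y"
    if "l \<in> carrier PSL2R" "\<not> aligned k \<tau> l N" "x \<in> HP" "y \<in> HP" for l x y
    using sdist_along_not_aligned[OF k L[unfolded L_def] that] by (simp add: L_def E_def)
  have inv: "asym L E (act g x) (act g y) = asym L E x y" if "g \<in> G" "x \<in> HP" "y \<in> HP" for g x y
    using asym_invariant[OF k L that] by (simp add: E_def)
  obtain r where r: "homogeneous_quasi_morphism \<Gamma> r"
    and bound: "\<And>g x. g \<in> G \<Longrightarrow> x \<in> HP \<Longrightarrow>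
      \<exists>B. \<forall>n::nat. \<bar>asym L E x (act (g \<^bold>^ n) x) - real n * r g\<bar> \<le> B"
  proof (rule quasi_cocycle_homogenization[of "asym L E" "3 * defect L", OF inv asym_cocycle[OF SE]])
    fix r assume "homogeneous_quasi_morphism \<Gamma> r"
      "\<And>g x. g \<in> G \<Longrightarrow> x \<in> HP \<Longrightarrow>
        \<exists>B. \<forall>n::nat. \<bar>asym L E x (act (g \<^bold>^ n) x) - real n * r g\<bar> \<le> B"
    then show thesis by (rule that)
  qed
  have "r g = 0" if g: "g \<in> S" for g
  proof -
    have gG: "g \<in> G" using g S by blast
    note gP = G_PSL[OF gG]
    have zero: "r g = 0" if x: "x \<in> HP" and z: "\<And>n::nat. asym L E x (act (g \<^bold>^ n) x) = 0" for x
    proof -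
      obtain B where B: "\<forall>n::nat. \<bar>asym L E x (act (g \<^bold>^ n) x) - real n * r g\<bar> \<le> B"
        using bound[OF gG x] ..
      have "\<bar>real n * r g\<bar> \<le> B + real n * 0" for n :: nat
        using B[rule_format, of n] z[of n] by simp
      then have "\<bar>r g\<bar> \<le> 0" by (rule zero_of_linear_bound)
      then show ?thesis by simp
    qed
    consider "elliptic g" | l s where "parabolic_along l s g"
      | l \<nu> where "hyperbolic_along l \<nu> g" "\<not> aligned k \<tau> l N" "\<not> aligned k \<tau> (l \<cdot> inversion) N"
      using N(1) g by (auto simp: tame_def)
    then show ?thesis
    proof cases
      case 1
      then obtain z where z: "z \<in> HP" "act g z = z" by (auto simp: elliptic_def)
      then show ?thesis using zero[OF z(1)] elliptic_pow_fixes[OF gP z] by (simp add: asym_def)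
    next
      case 2
      \<comment> \<open>The asymmetry is bounded by the distance, so the value at g is bounded by
        the displacement of every point.\<close>
      have "\<bar>r g\<bar> \<le> hdist x (act g x)" if x: "x \<in> HP" for x
      proof -
        obtain B where B: "\<forall>n::nat. \<bar>asym L E x (act (g \<^bold>^ n) x) - real n * r g\<bar> \<le> B"
          using bound[OF gG x] ..
        show ?thesis
        proof (rule zero_of_linear_bound[of _ B])
          fix n :: nat
          define y where "y = act (g \<^bold>^ n) x"
          have y: "y \<in> HP" using gP x by (simp add: y_def act_HP)
          have "\<bar>asym L E x y\<bar> \<le> hdist x y"
            using sdist_nonneg[OF SE x y] sdist_nonneg[OF SE y x] sdist_le_hdist[OF SE x y] sdist_le_hdist[OF SE y x]
            by (simp add: asym_def hdist_commute[of y x])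
          then show "\<bar>real n * r g\<bar> \<le> B + real n * hdist x (act g x)"
            using B[rule_format, of n] hdist_pow_le[OF gP x, of n] by (simp add: y_def)
        qed
      qed
      then have small: "\<bar>r g\<bar> \<le> hdist x (act g x)" if "x \<in> HP" for x using that by blast
      show ?thesis
      proof (rule ccontr)
        assume "r g \<noteq> 0"
        then obtain x where "x \<in> HP" "hdist x (act g x) < \<bar>r g\<bar>"
          using parabolic_small_displacement[OF 2, of "\<bar>r g\<bar>"] by auto
        then show False using small[of x] by simp
      qed
    next
      case 3
      have l: "l \<in> carrier PSL2R" and \<nu>: "\<nu> > 1" using 3 by (auto simp: hyperbolic_along_def)
      have lf: "l \<cdot> inversion \<in> carrier PSL2R" using l by simp
      define x where "x = act l (imag_axis 0)"
      have x: "x \<in> HP" by (simp add: x_def act_HP l)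
      show ?thesis
      proof (rule zero[OF x])
        fix n :: nat
        have y: "act (g \<^bold>^ n) x = act l (imag_axis (real n * ln \<nu>))"
          using hyperbolic_along_int_pow[OF gP 3(1) axis_HP[of 0], of "int n"]
          by (simp add: x_def imag_axis_def int_pow_int mult.commute)
        define y where "y = act l (imag_axis (real n * ln \<nu>))"
        have yHP: "y \<in> HP" by (simp add: y_def act_HP l)
        have d: "hdist x y = real n * ln \<nu>" "hdist y x = real n * ln \<nu>"
          using \<nu> by (simp_all add: x_def y_def hdist_act l hdist_axis)
        \<comment> \<open>Lower bounds in both directions meet the upper bound given by the
          hyperbolic distance; hence the path metric is symmetric on this pair.\<close>
        have "real n * ln \<nu> \<le> sdist L E x y"
          using lower[OF l 3(2) x yHP] by (simp add: x_def y_def l)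
        moreover have "real n * ln \<nu> \<le> sdist L E y x"
          using lower[OF lf 3(3) yHP x] by (simp add: foot_inversion_conj l x yHP) (simp add: x_def y_def l)
        ultimately have "asym L E x y = 0"
          using sdist_le_hdist[OF SE x yHP] sdist_le_hdist[OF SE yHP x] d by (simp add: asym_def)
        then show "asym L E x (act (g \<^bold>^ n) x) = 0" by (simp add: y y_def)
      qed
    qed
  qed
  moreover have "r h \<noteq> 0"
  proof
    assume rh: "r h = 0"
    define x where "x = act k (imag_axis 0)"
    have x: "x \<in> HP" by (simp add: x_def act_HP k)
    define y where "y n = act (h \<^bold>^ (n * N)) x" for n :: nat
    have yk: "y n = act k (imag_axis (real n * L))" for n
      using hyperbolic_along_int_pow[OF hP h axis_HP[of 0], of "int (n * N)", unfolded int_pow_int]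
      by (simp add: y_def x_def imag_axis_def L_def \<tau>_def mult_ac)
    have y: "y n \<in> HP" for n by (simp add: yk act_HP k)
    have seg: "(y n, y (Suc n)) \<in> E" for n
    proof -
      define c where "c = h \<^bold>^ (int (n * N))"
      have c: "c \<in> G" using hG by (simp add: c_def int_pow_G)
      have "act c (act k (imag_axis p)) = act k (imag_axis (real n * L + p))" for p
        using hyperbolic_along_int_pow[OF hP h axis_HP[of p], of "int (n * N)"]
        by (simp add: c_def imag_axis_def L_def \<tau>_def exp_add mult_ac)
      from this[of 0] this[of L] have "y n = act c (act k (imag_axis 0))" "y (Suc n) = act c (act k (imag_axis L))"
        by (simp_all add: yk algebra_simps)
      then show ?thesis using c by (simp add: E_def axis_segments_def)
    qed
    have up: "sdist L E x (y n) \<le> real n * (L - 1)" for n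
    proof (induction n)
      case 0
      then show ?case using sdist_le_hdist[OF SE x x] by (simp add: y_def)
    next
      case (Suc n)
      then show ?case
        using sdist_triangle[OF SE x y[of n] y[of "Suc n"]] sdist_shortcut[OF SE seg[of n]]
        by (simp add: algebra_simps)
    qed
    \<comment> \<open>The potential on the reversed axis increases by n L on the way back.\<close>
    have down: "real n * L \<le> sdist L E (y n) x" for n
      using lower[OF kf N(2) y[of n] x] by (simp add: foot_inversion_conj k x y) (simp add: x_def yk k)
    obtain B where B: "\<forall>n::nat. \<bar>asym L E x (act (h \<^bold>^ n) x) - real n * r h\<bar> \<le> B"
      using bound[OF hG x] ..
    obtain n :: nat where n: "B < n" using reals_Archimedean2 by blast
    have "asym L E x (y n) \<le> - real n" using up[of n] down[of n] by (simp add: asym_def algebra_simps)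
    moreover have "\<bar>asym L E x (y n)\<bar> \<le> B" using B[rule_format, of "n * N"] by (simp add: rh y_def)
    ultimately show False using n by simp
  qed
  ultimately show ?thesis using r by blast
qed

end

subsection \<open>Displacement in horoballs\<close>

text \<open>The denominator c z + d of a Moebius map with lower row v. The height of z seen from the
  cusp of v is Im z divided by its squared modulus.\<close>

definition linear_form :: "real \<times> real \<Rightarrow> complex \<Rightarrow> complex" where
  "linear_form v z = of_real (fst v) * z + of_real (snd v)"

text \<open>For v and w the lower rows of M and N of determinant one, this is the lower left entry
  of M times the inverse of N.\<close>

definition row_det :: "real \<times> real \<Rightarrow> real \<times> real \<Rightarrow> real" where
  "row_det v w = fst v * snd w - snd v * fst w"

text \<open>For every matrix \<open>M\<close> with lower row \<open>v\<close>, \<open>shift v x y\<close> is the difference of the real parts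
  of \<open>M x\<close> and \<open>M y\<close>, that is, the horocyclic displacement seen from the cusp of \<open>v\<close>.\<close>

definition shift :: "real \<times> real \<Rightarrow> complex \<Rightarrow> complex \<Rightarrow> real" where
  "shift v x y = Re ((x - y) / (linear_form v x * linear_form v y))"

text \<open>Opposite vectors represent the same cusp and are exempt. The bound \<gamma> expresses
  that the horoballs of different cusps are uniformly separated.\<close>

definition separated :: "real \<Rightarrow> (real \<times> real) set \<Rightarrow> bool" where
  "separated \<gamma> V \<longleftrightarrow> \<gamma> > 0 \<and> 0 \<notin> V \<and> (\<forall>v\<in>V. \<forall>w\<in>V. v \<noteq> w \<longrightarrow> v \<noteq> - w \<longrightarrow> \<gamma> \<le> \<bar>row_det v w\<bar>)"

lemma lin_nonzero: "v \<noteq> 0 \<Longrightarrow> z \<in> HP \<Longrightarrow> linear_form v z \<noteq> 0"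
  by (cases v) (auto simp: linear_form_def HP_def complex_eq_iff zero_prod_def)

lemma shift_add:
  assumes v: "v \<noteq> 0" and "x \<in> HP" "y \<in> HP" "z \<in> HP"
  shows "shift v x z = shift v x y + shift v y z"
proof -
  have n: "linear_form v x \<noteq> 0" "linear_form v y \<noteq> 0" "linear_form v z \<noteq> 0" using lin_nonzero[OF v] assms by auto
  have "(x - z) * linear_form v y = (x - y) * linear_form v z + (y - z) * linear_form v x"
    by (simp add: linear_form_def algebra_simps)
  then have "(x - z) / (linear_form v x * linear_form v z) = (x - y) / (linear_form v x * linear_form v y) + (y - z) / (linear_form v y * linear_form v z)"
    using n by (simp add: divide_simps)
  then show ?thesis by (simp add: shift_def)
qed

lemma shift_commute: "shift v y x = - shift v x y"
  unfolding shift_def by (metis minus_diff_eq minus_divide_left mult.commute uminus_complex.simps(1))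

lemma abs_shift_le: "\<bar>shift v x y\<bar> \<le> cmod (x - y) / (cmod (linear_form v x) * cmod (linear_form v y))"
  unfolding shift_def using abs_Re_le_cmod[of "(x - y) / (linear_form v x * linear_form v y)"]
  by (simp add: norm_divide norm_mult)

definition soft_threshold :: "real \<Rightarrow> real \<Rightarrow> real" where
  "soft_threshold T t = (if t > T then t - T else if t < - T then t + T else 0)"

lemma soft_eq_0: "T \<ge> 0 \<Longrightarrow> \<bar>t\<bar> \<le> T \<Longrightarrow> soft_threshold T t = 0"
  by (auto simp: soft_threshold_def)

text \<open>The function is odd and 1-Lipschitz, as a cut-off with a jump would not be. The defect
  is therefore controlled by each of the three displacements, in particular by the smallest.\<close>

lemma soft_defect:
  assumes "T \<ge> 0"
  shows "\<bar>soft_threshold T (a + b) - soft_threshold T a - soft_threshold T b\<bar> \<le> 3 * T"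
    "\<bar>soft_threshold T (a + b) - soft_threshold T a - soft_threshold T b\<bar> \<le> 2 * \<bar>a\<bar>"
    "\<bar>soft_threshold T (a + b) - soft_threshold T a - soft_threshold T b\<bar> \<le> 2 * \<bar>b\<bar>"
    "\<bar>soft_threshold T (a + b) - soft_threshold T a - soft_threshold T b\<bar> \<le> 2 * \<bar>a + b\<bar>"
    "\<bar>a\<bar> \<le> T \<Longrightarrow> \<bar>b\<bar> \<le> T \<Longrightarrow> \<bar>a + b\<bar> \<le> T \<Longrightarrow> soft_threshold T (a + b) - soft_threshold T a - soft_threshold T b = 0"
  using assms by (auto simp: soft_threshold_def abs_if)

text \<open>The sum over all cusps from the overview. Its index set omits only zero terms and is
  finite by \<open>separated_finite_shift\<close>.\<close>

definition drift :: "real \<Rightarrow> (real \<times> real) set \<Rightarrow> complex \<Rightarrow> complex \<Rightarrow> real" where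
  "drift T V x y = (\<Sum>v | v \<in> V \<and> \<bar>shift v x y\<bar> > T. soft_threshold T (shift v x y))"

text \<open>A three-term identity for determinants. It prevents the forms of two separated cusps
  from both being small at two distant points.\<close>

lemma det2_bound: "\<bar>row_det v w\<bar> * cmod (z - x) \<le> cmod (linear_form w z) * cmod (linear_form v x) + cmod (linear_form v z) * cmod (linear_form w x)"
proof -
  have "of_real (row_det v w) * (z - x) = linear_form v z * linear_form w x - linear_form w z * linear_form v x"
    by (simp add: row_det_def linear_form_def algebra_simps)
  then have "\<bar>row_det v w\<bar> * cmod (z - x) = cmod (linear_form v z * linear_form w x - linear_form w z * linear_form v x)"
    by (metis norm_mult norm_of_real)
  also have "\<dots> \<le> cmod (linear_form v z * linear_form w x) + cmod (linear_form w z * linear_form v x)" by (rule norm_triangle_ineq4)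
  finally show ?thesis by (simp add: norm_mult)
qed

text \<open>Induction along increasing n. Adding the largest element x costs at most K n(m)^2, and
  the sum below it is at most 2 K n(x)^2, which is at most half of K n(m)^2 because n
  doubles.\<close>

lemma geometric_sum_bound:
  fixes n e :: "'a \<Rightarrow> real"
  assumes fin: "finite S" and K: "K \<ge> 0"
    and S: "S \<subseteq> F" and m: "m \<in> F" "m \<notin> S" "\<And>v. v \<in> S \<Longrightarrow> n v \<le> n m"
    and pos: "\<And>v. v \<in> F \<Longrightarrow> n v > 0"
    and lac: "\<And>v w. v \<in> F \<Longrightarrow> w \<in> F \<Longrightarrow> v \<noteq> w \<Longrightarrow> n v \<le> n w \<Longrightarrow> 2 * n v \<le> n w"
    and e: "\<And>v w. v \<in> F \<Longrightarrow> w \<in> F \<Longrightarrow> v \<noteq> w \<Longrightarrow> n v \<le> n w \<Longrightarrow> e v \<le> K * (n w)\<^sup>2"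
  shows "sum e S \<le> 2 * K * (n m)\<^sup>2"
  using fin S m
proof (induction S arbitrary: m rule: finite_ranking_induct[of _ _ n])
  case empty
  then show ?case using K by simp
next
  case (insert x S)
  show ?case
  proof (cases "x \<in> S")
    case True
    then show ?thesis using insert by (simp add: insert_absorb)
  next
    case False
    have x: "x \<in> F" "x \<noteq> m" "n x \<le> n m" using insert(4-7) by auto
    have "(2 * n x)\<^sup>2 \<le> (n m)\<^sup>2" using lac[OF x(1) insert(5) x(2,3)] pos[OF x(1)] by (intro power_mono) auto
    then have nx: "4 * (n x)\<^sup>2 \<le> (n m)\<^sup>2" by (simp add: power_mult_distrib)
    have "sum e S \<le> 2 * K * (n x)\<^sup>2" using insert(2,4) False x(1) by (intro insert(3)) auto
    moreover have "e x \<le> K * (n m)\<^sup>2" by (rule e[OF x(1) insert(5) x(2,3)])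
    moreover have "K * (4 * (n x)\<^sup>2) \<le> K * (n m)\<^sup>2" using nx K by (rule mult_left_mono)
    moreover have "K * (4 * (n x)\<^sup>2) = 4 * (K * (n x)\<^sup>2)" "2 * K * (n x)\<^sup>2 = 2 * (K * (n x)\<^sup>2)"
      "2 * K * (n m)\<^sup>2 = 2 * (K * (n m)\<^sup>2)" by simp_all
    moreover have "sum e (insert x S) = e x + sum e S" using insert(1) False by simp
    moreover have "K * (n m)\<^sup>2 \<ge> 0" using K by simp
    ultimately show ?thesis by linarith
  qed
qed

text \<open>If \<open>z\<close> is far from both \<open>x\<close> and \<open>y\<close> in every horoball of \<open>F\<close>, these horoballs lie
  behind each other along the way from \<open>z\<close>, the values \<open>cmod (linear_form v z)\<close> grow
  geometrically, and the differences between \<open>x\<close> and \<open>y\<close> decay geometrically.\<close>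

lemma defect_sum_bound:
  assumes fin: "finite F" and z: "z \<in> HP" and \<gamma>: "\<gamma> > 0" and T: "T * \<gamma> \<ge> 8" and F0: "0 \<notin> F"
    and x: "x \<in> HP" and y: "y \<in> HP"
    and sep: "\<And>v w. v \<in> F \<Longrightarrow> w \<in> F \<Longrightarrow> v \<noteq> w \<Longrightarrow> \<gamma> \<le> \<bar>row_det v w\<bar>"
    and far: "\<And>v. v \<in> F \<Longrightarrow> T / 2 \<le> \<bar>shift v x z\<bar>" "\<And>v. v \<in> F \<Longrightarrow> T / 2 \<le> \<bar>shift v y z\<bar>"
    and e: "\<And>v. v \<in> F \<Longrightarrow> e v \<le> 2 * \<bar>shift v x y\<bar>" "\<And>v. v \<in> F \<Longrightarrow> e v \<le> 3 * T"
  shows "sum e F \<le> 3 * T + 64 / (T * \<gamma>\<^sup>2)"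
proof (cases "F = {}")
  case True
  have T0: "T > 0" using T \<gamma> by (smt (verit) mult_nonpos_nonneg)
  then show ?thesis using True by simp
next
  case False
  have T0: "T > 0" using T \<gamma> by (smt (verit) mult_nonpos_nonneg)
  define n where "n v = cmod (linear_form v z)" for v
  have npos: "n v > 0" if "v \<in> F" for v
    using that F0 z lin_nonzero[of v z] by (auto simp: n_def)
  \<comment> \<open>A large displacement from u to z means that the form is small at u or z,
    relative to their distance.\<close>
  have close: "n v * cmod (linear_form v u) \<le> 2 * cmod (u - z) / T" "u \<noteq> z"
    if "v \<in> F" "u \<in> HP" "T / 2 \<le> \<bar>shift v u z\<bar>" for v u
  proof -
    have pos: "cmod (linear_form v u) > 0" using that F0 lin_nonzero[of v u] by auto
    have "T / 2 \<le> cmod (u - z) / (cmod (linear_form v u) * n v)"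
      using that(3) abs_shift_le[of v u z] unfolding n_def by linarith
    then show le: "n v * cmod (linear_form v u) \<le> 2 * cmod (u - z) / T"
      using T0 pos npos[OF that(1)] by (simp add: field_simps)
    then show "u \<noteq> z" using mult_pos_pos[OF npos[OF that(1)] pos] by auto
  qed
  have cx: "n v * cmod (linear_form v x) \<le> 2 * cmod (x - z) / T" if "v \<in> F" for v
    by (rule close(1)[OF that x far(1)[OF that]])
  have cy: "n v * cmod (linear_form v y) \<le> 2 * cmod (y - z) / T" if "v \<in> F" for v
    by (rule close(1)[OF that y far(2)[OF that]])
  obtain f where "f \<in> F" using False by blast
  then have xz: "cmod (x - z) > 0" and yz: "cmod (y - z) > 0"
    using close(2)[OF _ x far(1)] close(2)[OF _ y far(2)] by auto
  have pair: "\<gamma> * cmod (u - z) \<le> n w * cmod (linear_form v u) + n v * (2 * cmod (u - z) / T / n w)"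
    if "v \<in> F" "w \<in> F" "v \<noteq> w" "n w * cmod (linear_form w u) \<le> 2 * cmod (u - z) / T" for u v w
  proof -
    have "\<gamma> * cmod (u - z) \<le> \<bar>row_det v w\<bar> * cmod (z - u)"
      using sep[OF that(1-3)] by (simp add: norm_minus_commute mult_right_mono)
    also have "\<dots> \<le> n w * cmod (linear_form v u) + n v * cmod (linear_form w u)"
      using det2_bound[of v w z u] by (simp add: n_def)
    also have "cmod (linear_form w u) \<le> 2 * cmod (u - z) / T / n w"
      using that(4) by (subst pos_le_divide_eq[OF npos[OF that(2)]]) (simp add: mult.commute)
    then have "n v * cmod (linear_form w u) \<le> n v * (2 * cmod (u - z) / T / n w)"
      using npos[OF that(1)] by (intro mult_left_mono) auto
    finally show ?thesis by simp
  qed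
  \<comment> \<open>The second term of \<open>pair\<close> is absorbed: with n v \<le> n w and T
    \<gamma> \<ge> 4 it is at most half of the left side.\<close>
  have ge: "cmod (linear_form v u) \<ge> \<gamma> * cmod (u - z) / (2 * n w)"
    if "v \<in> F" "w \<in> F" "v \<noteq> w" "n v \<le> n w" "n w * cmod (linear_form w u) \<le> 2 * cmod (u - z) / T" for u v w
  proof -
    have "n v * (2 * cmod (u - z) / T / n w) = (n v / n w) * (2 * cmod (u - z) / T)" by simp
    also have "\<dots> \<le> 1 * (2 * cmod (u - z) / T)"
      using that(4) npos[OF that(2)] T0 by (intro mult_right_mono) auto
    also have "\<dots> \<le> \<gamma> * cmod (u - z) / 2"
    proof -
      have "4 \<le> \<gamma> * T" using T by (simp add: mult.commute)
      then have "4 * cmod (u - z) \<le> \<gamma> * T * cmod (u - z)" by (intro mult_right_mono) auto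
      then show ?thesis using T0 by (simp add: field_simps)
    qed
    finally have "\<gamma> * cmod (u - z) / 2 \<le> n w * cmod (linear_form v u)" using pair[OF that(1-3,5)] by linarith
    then show ?thesis using npos[OF that(2)] by (simp add: field_simps)
  qed
  \<comment> \<open>Combining \<open>ge\<close> and \<open>cx\<close> gives n v * (\<gamma> T) \<le>
    4 n w; here the full hypothesis T \<gamma> \<ge> 8 is what produces the factor 2.\<close>
  have lac: "2 * n v \<le> n w" if "v \<in> F" "w \<in> F" "v \<noteq> w" "n v \<le> n w" for v w
  proof -
    have "\<gamma> * cmod (x - z) / (2 * n w) \<le> cmod (linear_form v x)"
      by (rule ge[OF that cx[OF that(2)]])
    then have "n v * (\<gamma> * cmod (x - z) / (2 * n w)) \<le> 2 * cmod (x - z) / T"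
      using cx[OF that(1)] mult_left_mono[of _ _ "n v"] npos[OF that(1)] by (meson less_imp_le order_trans)
    then have "n v * \<gamma> * T * cmod (x - z) \<le> 4 * n w * cmod (x - z)"
      using npos[OF that(2)] T0 by (simp add: field_simps)
    then have "n v * (\<gamma> * T) \<le> 4 * n w" using xz by (simp add: mult.assoc)
    moreover have "n v * 8 \<le> n v * (\<gamma> * T)"
      using T npos[OF that(1)] by (intro mult_left_mono) (auto simp: mult.commute)
    ultimately show ?thesis by simp
  qed
  have "\<exists>m\<in>F. \<forall>v\<in>F. n v \<le> n m"
    using Max_in[of "n ` F"] Max_ge[of "n ` F"] fin False by fastforce
  then obtain m where m: "m \<in> F" "\<And>v. v \<in> F \<Longrightarrow> n v \<le> n m" by blast
  note mpos = npos[OF m(1)]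
  \<comment> \<open>The forms of m are small at x and at y, which forces x and y to be close to each
    other.\<close>
  have xy: "cmod (x - y) \<le> 4 * cmod (x - z) * cmod (y - z) / (T * (n m)\<^sup>2)"
  proof -
    have "(x - y) * linear_form m z = (x - z) * linear_form m y - (y - z) * linear_form m x"
      by (simp add: linear_form_def algebra_simps)
    then have "cmod (x - y) * n m = cmod ((x - z) * linear_form m y - (y - z) * linear_form m x)"
      by (metis norm_mult n_def)
    also have "\<dots> \<le> cmod (x - z) * cmod (linear_form m y) + cmod (y - z) * cmod (linear_form m x)"
      using norm_triangle_ineq4[of "(x - z) * linear_form m y" "(y - z) * linear_form m x"] by (simp add: norm_mult)
    finally have "cmod (x - y) * n m * n m \<le> (cmod (x - z) * cmod (linear_form m y) + cmod (y - z) * cmod (linear_form m x)) * n m"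
      using mpos by (intro mult_right_mono) auto
    also have "\<dots> = cmod (x - z) * (n m * cmod (linear_form m y)) + cmod (y - z) * (n m * cmod (linear_form m x))"
      by (simp add: algebra_simps)
    also have "\<dots> \<le> cmod (x - z) * (2 * cmod (y - z) / T) + cmod (y - z) * (2 * cmod (x - z) / T)"
      using cx[OF m(1)] cy[OF m(1)] by (intro add_mono mult_left_mono) auto
    also have "\<dots> = 4 * cmod (x - z) * cmod (y - z) / T" by (simp add: field_simps)
    finally show ?thesis using mpos T0 by (simp add: field_simps power2_eq_square)
  qed
  \<comment> \<open>A factor 2 from the bound on e, 4 from \<open>xy\<close>, and 4 from the two
    halves in A and B.\<close>
  define K where "K = 32 / (T * \<gamma>\<^sup>2 * (n m)\<^sup>2)"
  have eK: "e v \<le> K * (n w)\<^sup>2" if "v \<in> F" "w \<in> F" "v \<noteq> w" "n v \<le> n w" for v w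
  proof -
    define A where "A = \<gamma> * cmod (x - z) / (2 * n w)"
    define B where "B = \<gamma> * cmod (y - z) / (2 * n w)"
    have A: "A > 0" "A \<le> cmod (linear_form v x)" using ge[OF that cx[OF that(2)]] xz \<gamma> npos[OF that(2)] by (auto simp: A_def)
    have B: "B > 0" "B \<le> cmod (linear_form v y)" using ge[OF that cy[OF that(2)]] yz \<gamma> npos[OF that(2)] by (auto simp: B_def)
    have "e v \<le> 2 * (cmod (x - y) / (cmod (linear_form v x) * cmod (linear_form v y)))"
      using e(1)[OF that(1)] abs_shift_le[of v x y] by simp
    also have "\<dots> \<le> 2 * (cmod (x - y) / (A * B))"
      using A B by (intro mult_left_mono divide_left_mono mult_mono mult_pos_pos) auto
    also have "\<dots> \<le> 2 * ((4 * cmod (x - z) * cmod (y - z) / (T * (n m)\<^sup>2)) / (A * B))"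
      using xy A B by (intro mult_left_mono divide_right_mono) auto
    also have "\<dots> = K * (n w)\<^sup>2"
      using xz yz \<gamma> npos[OF that(2)] mpos T0 by (simp add: A_def B_def K_def field_simps power2_eq_square)
    finally show ?thesis .
  qed
  \<comment> \<open>The cusp m has nothing above it and is estimated separately by 3 T.\<close>
  have "sum e (F - {m}) \<le> 2 * K * (n m)\<^sup>2"
    using fin T0 \<gamma> m npos lac eK
    by (intro geometric_sum_bound[where F = F]) (auto simp: K_def)
  also have "\<dots> = 64 / (T * \<gamma>\<^sup>2)" using mpos by (simp add: K_def)
  finally have "sum e (F - {m}) \<le> 64 / (T * \<gamma>\<^sup>2)" .
  moreover have "sum e F = e m + sum e (F - {m})" using fin m(1) by (simp add: sum.remove)
  ultimately show ?thesis using e(2)[OF m(1)] by simp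
qed

text \<open>For w near v, \<open>row_det v w\<close> equals the determinant of v with w - v and is
  small, against the separation.\<close>

lemma separated_finite_bounded:
  assumes sep: "separated \<gamma> V"
  shows "finite {v \<in> V. \<bar>fst v\<bar> \<le> B \<and> \<bar>snd v\<bar> \<le> B}"
proof (rule ccontr)
  let ?S = "{v \<in> V. \<bar>fst v\<bar> \<le> B \<and> \<bar>snd v\<bar> \<le> B}"
  assume inf: "infinite ?S"
  have \<gamma>: "\<gamma> > 0" using sep by (simp add: separated_def)
  have "bounded ?S"
  proof (rule boundedI)
    fix v assume "v \<in> ?S"
    then show "norm v \<le> B + B" using norm_Pair_le[of "fst v" "snd v"] by auto
  qed
  define C where "C = \<bar>B\<bar> + 1"
  have C: "C > 0" by (simp add: C_def)
  obtain v where v: "v \<in> ?S" "infinite (?S \<inter> ball v (\<gamma> / (2 * C)))"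
    using infinite_bounded_accumulates[OF \<open>bounded ?S\<close> inf, of "\<gamma> / (2 * C)"] \<gamma> C by auto
  then have "infinite (?S \<inter> ball v (\<gamma> / (2 * C)) - {v, - v})" by simp
  then obtain w where w: "w \<in> ?S" "w \<in> ball v (\<gamma> / (2 * C))" "w \<noteq> v" "w \<noteq> - v"
    using infinite_imp_nonempty by blast
  have d: "norm (w - v) < \<gamma> / (2 * C)" using w(2) by (simp add: dist_norm norm_minus_commute)
  have "\<bar>fst (w - v)\<bar> \<le> norm (w - v)" "\<bar>snd (w - v)\<bar> \<le> norm (w - v)"
    using norm_fst_le[of "fst (w - v)" "snd (w - v)"] norm_snd_le[of "snd (w - v)" "fst (w - v)"]
    unfolding prod.collapse real_norm_def by blast+
  moreover have "\<bar>fst v\<bar> \<le> C" "\<bar>snd v\<bar> \<le> C" using v(1) by (auto simp: C_def)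
  ultimately have "\<bar>fst v * snd (w - v)\<bar> \<le> C * norm (w - v)" "\<bar>snd v * fst (w - v)\<bar> \<le> C * norm (w - v)"
    unfolding abs_mult using C by (auto intro!: mult_mono)
  moreover have "row_det v w = fst v * snd (w - v) - snd v * fst (w - v)"
    by (simp add: row_det_def algebra_simps)
  ultimately have "\<bar>row_det v w\<bar> \<le> 2 * C * norm (w - v)" by linarith
  also have "\<dots> < \<gamma>" using d C by (simp add: field_simps)
  finally have "\<bar>row_det v w\<bar> < \<gamma>" .
  moreover have "\<gamma> \<le> \<bar>row_det v w\<bar>" 
  proof -
    have "v \<noteq> w" "v \<noteq> - w" using w(3,4) by auto
    then show ?thesis using sep v(1) w(1) by (simp add: separated_def)
  qed
  ultimately show False by simp
qed

lemma separated_finite_lin: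
  assumes sep: "separated \<gamma> V" and z: "z \<in> HP"
  shows "finite {v \<in> V. cmod (linear_form v z) \<le> B}"
proof (rule finite_subset)
  define C where "C = \<bar>B\<bar> / Im z * (1 + cmod z) + \<bar>B\<bar>"
  have Im: "Im z > 0" using z by (simp add: HP_def)
  show "{v \<in> V. cmod (linear_form v z) \<le> B} \<subseteq> {v \<in> V. \<bar>fst v\<bar> \<le> C \<and> \<bar>snd v\<bar> \<le> C}"
  proof clarify
    fix c d assume "(c, d) \<in> V" and le: "cmod (linear_form (c, d) z) \<le> B"
    have "\<bar>c\<bar> * Im z \<le> cmod (linear_form (c, d) z)"
      using abs_Im_le_cmod[of "linear_form (c, d) z"] Im by (simp add: linear_form_def abs_mult)
    then have c: "\<bar>c\<bar> \<le> \<bar>B\<bar> / Im z" using le Im by (simp add: field_simps)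
    have "\<bar>d\<bar> \<le> cmod (linear_form (c, d) z) + cmod (of_real c * z)"
      using norm_triangle_ineq4[of "linear_form (c, d) z" "of_real c * z"] by (simp add: linear_form_def)
    also have "\<dots> \<le> \<bar>B\<bar> + \<bar>B\<bar> / Im z * cmod z"
      using le mult_right_mono[OF c norm_ge_zero[of z]] by (intro add_mono) (auto simp: norm_mult)
    finally have d: "\<bar>d\<bar> \<le> \<bar>B\<bar> + \<bar>B\<bar> / Im z * cmod z" .
    have pos: "\<bar>B\<bar> / Im z \<ge> 0" "\<bar>B\<bar> / Im z * cmod z \<ge> 0" using Im by simp_all
    have "C = \<bar>B\<bar> / Im z + \<bar>B\<bar> / Im z * cmod z + \<bar>B\<bar>" unfolding C_def distrib_left by simp
    then show "\<bar>fst (c, d)\<bar> \<le> C \<and> \<bar>snd (c, d)\<bar> \<le> C"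
      using c d pos unfolding fst_conv snd_conv by linarith
  qed
  show "finite {v \<in> V. \<bar>fst v\<bar> \<le> C \<and> \<bar>snd v\<bar> \<le> C}" by (rule separated_finite_bounded[OF sep])
qed

text \<open>A displacement above T forces one of the two forms to be at most sqrt (|x - y| /
  T).\<close>

lemma separated_finite_shift:
  assumes sep: "separated \<gamma> V" and x: "x \<in> HP" and y: "y \<in> HP" and T: "T > 0"
  shows "finite {v \<in> V. \<bar>shift v x y\<bar> > T}"
proof (rule finite_subset)
  define B where "B = sqrt (cmod (x - y) / T)"
  show "{v \<in> V. \<bar>shift v x y\<bar> > T} \<subseteq> {v \<in> V. cmod (linear_form v x) \<le> B} \<union> {v \<in> V. cmod (linear_form v y) \<le> B}"
  proof (rule ccontr)
    assume "\<not> ?thesis"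
    then obtain v where v: "v \<in> V" "\<bar>shift v x y\<bar> > T" "cmod (linear_form v x) > B" "cmod (linear_form v y) > B"
      by force
    have B0: "B \<ge> 0" using T by (simp add: B_def)
    have "cmod (x - y) / T = B * B" using T by (simp add: B_def)
    also have "\<dots> \<le> cmod (linear_form v x) * cmod (linear_form v y)" using v B0 by (intro mult_mono) auto
    finally have "cmod (x - y) \<le> T * (cmod (linear_form v x) * cmod (linear_form v y))" using T by (simp add: field_simps)
    moreover have "cmod (linear_form v x) * cmod (linear_form v y) > 0" using v B0 by (intro mult_pos_pos) auto
    ultimately have "cmod (x - y) / (cmod (linear_form v x) * cmod (linear_form v y)) \<le> T"
      by (simp only: pos_divide_le_eq)
    then show False using v(2) abs_shift_le[of v x y] by simp
  qed
  show "finite ({v \<in> V. cmod (linear_form v x) \<le> B} \<union> {v \<in> V. cmod (linear_form v y) \<le> B})"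
    using separated_finite_lin[OF sep] x y by simp
qed

text \<open>The bound of \<open>defect_sum_bound\<close> for six classes of rows: three choices of
  the smallest displacement and two choices of sign.\<close>

definition drift_defect :: "real \<Rightarrow> real \<Rightarrow> real" where
  "drift_defect \<gamma> T = 6 * (3 * T + 64 / (T * \<gamma>\<^sup>2))"

text \<open>The cusps that contribute are sorted by the side of the triangle with the smallest
  displacement. The opposite vertex is then far from both ends of that side, which is the situation
  of \<open>defect_sum_bound\<close>.\<close>

lemma drift_cocycle:
  assumes sep: "separated \<gamma> V" and T: "T * \<gamma> \<ge> 8"
    and x: "x \<in> HP" and y: "y \<in> HP" and z: "z \<in> HP"
  shows "\<bar>drift T V x z - drift T V x y - drift T V y z\<bar> \<le> drift_defect \<gamma> T"
proof -
  have \<gamma>: "\<gamma> > 0" and V0: "0 \<notin> V" using sep by (auto simp: separated_def)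
  have T0: "T > 0" using T \<gamma> by (smt (verit) mult_nonpos_nonneg)
  define F where "F = {v \<in> V. \<bar>shift v x z\<bar> > T} \<union> {v \<in> V. \<bar>shift v x y\<bar> > T} \<union> {v \<in> V. \<bar>shift v y z\<bar> > T}"
  have fin: "finite F" unfolding F_def using separated_finite_shift[OF sep _ _ T0] x y z by simp
  have FV: "F \<subseteq> V" by (auto simp: F_def)
  have ext: "drift T V u w = (\<Sum>v\<in>F. soft_threshold T (shift v u w))"
    if "{v \<in> V. \<bar>shift v u w\<bar> > T} \<subseteq> F" for u w
    unfolding drift_def using that fin FV T0 by (intro sum.mono_neutral_left) (auto intro!: soft_eq_0)
  define e where "e v = \<bar>soft_threshold T (shift v x z) - soft_threshold T (shift v x y) - soft_threshold T (shift v y z)\<bar>" for v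
  have "drift T V x z - drift T V x y - drift T V y z
      = (\<Sum>v\<in>F. soft_threshold T (shift v x z) - soft_threshold T (shift v x y) - soft_threshold T (shift v y z))"
    by (subst (1 2 3) ext) (auto simp: F_def sum_subtractf)
  also have "\<bar>\<dots>\<bar> \<le> sum e F" unfolding e_def by (rule sum_abs)
  finally have total: "\<bar>drift T V x z - drift T V x y - drift T V y z\<bar> \<le> sum e F" .
  have add: "shift v x z = shift v x y + shift v y z" if "v \<in> F" for v
    using shift_add[of v x y z] that V0 FV x y z by auto
  \<comment> \<open>A half-plane that contains exactly one of v and - v, so that distinct rows in it
    belong to different cusps.\<close>
  define P where "P v \<longleftrightarrow> fst v > 0 \<or> (fst v = 0 \<and> snd v > 0)" for v :: "real \<times> real"
  define F1 where "F1 = {v \<in> F. \<bar>shift v x y\<bar> \<le> \<bar>shift v x z\<bar> \<and> \<bar>shift v x y\<bar> \<le> \<bar>shift v y z\<bar>}"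
  define F2 where "F2 = {v \<in> F. \<bar>shift v y z\<bar> \<le> \<bar>shift v x z\<bar> \<and> \<bar>shift v y z\<bar> \<le> \<bar>shift v x y\<bar>}"
  define F3 where "F3 = {v \<in> F. \<bar>shift v x z\<bar> \<le> \<bar>shift v x y\<bar> \<and> \<bar>shift v x z\<bar> \<le> \<bar>shift v y z\<bar>}"
  have sepP: "\<gamma> \<le> \<bar>row_det v w\<bar>" if "v \<in> F" "w \<in> F" "v \<noteq> w" "P v = P w" for v w
  proof -
    have "v \<noteq> 0" using that V0 FV by auto
    then have "v \<noteq> - w" using that(4) by (auto simp: P_def prod_eq_iff)
    then show ?thesis using sep that FV by (auto simp: separated_def)
  qed
  have e0: "e v \<ge> 0" for v by (simp add: e_def)
  have eb: "e v \<le> 3 * T" "e v \<le> 2 * \<bar>shift v x y\<bar>" "e v \<le> 2 * \<bar>shift v y z\<bar>" "e v \<le> 2 * \<bar>shift v x z\<bar>"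
    if "v \<in> F" for v
    using soft_defect(1-4)[OF less_imp_le[OF T0], of "shift v x y" "shift v y z"]
    unfolding e_def add[OF that] by auto
  have large: "\<bar>shift v x z\<bar> > T \<or> \<bar>shift v x y\<bar> > T \<or> \<bar>shift v y z\<bar> > T" if "v \<in> F" for v
    using that by (auto simp: F_def)
  \<comment> \<open>The largest of the three exceeds T and is at most the sum of the other two;
    hence the middle one is at least T/2.\<close>
  have arith: "T / 2 \<le> \<bar>b\<bar> \<and> T / 2 \<le> \<bar>a + b\<bar>"
    if "\<bar>a\<bar> \<le> \<bar>b\<bar>" "\<bar>a\<bar> \<le> \<bar>a + b\<bar>" "\<bar>a\<bar> > T \<or> \<bar>b\<bar> > T \<or> \<bar>a + b\<bar> > T" for a b :: real
    using that by linarith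
  have half: "sum e {v \<in> F'. P v = b} \<le> 3 * T + 64 / (T * \<gamma>\<^sup>2)"
    if F': "F' \<subseteq> F" and HP: "u \<in> HP" "w \<in> HP" "t \<in> HP"
      and min: "\<And>v. v \<in> F' \<Longrightarrow> \<bar>shift v u w\<bar> \<le> \<bar>shift v w t\<bar> \<and> \<bar>shift v u w\<bar> \<le> \<bar>shift v u t\<bar>"
      and big: "\<And>v. v \<in> F' \<Longrightarrow> \<bar>shift v u w\<bar> > T \<or> \<bar>shift v w t\<bar> > T \<or> \<bar>shift v u t\<bar> > T"
      and bd: "\<And>v. v \<in> F' \<Longrightarrow> e v \<le> 2 * \<bar>shift v u w\<bar>" for F' b u w t
  proof (rule defect_sum_bound[OF _ HP(3) \<gamma> T _ HP(1,2)])
    show "finite {v \<in> F'. P v = b}" using finite_subset[OF F' fin] by simp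
    show "0 \<notin> {v \<in> F'. P v = b}" using F' FV V0 by auto
    show "\<gamma> \<le> \<bar>row_det v w\<bar>" if "v \<in> {v \<in> F'. P v = b}" "w \<in> {v \<in> F'. P v = b}" "v \<noteq> w" for v w
      using that F' by (intro sepP) auto
    fix v assume v: "v \<in> {v \<in> F'. P v = b}"
    then have vF: "v \<in> F'" "v \<in> F" "v \<noteq> 0" using F' FV V0 by auto
    have "shift v u t = shift v u w + shift v w t" by (rule shift_add[OF vF(3) HP])
    then show "T / 2 \<le> \<bar>shift v u t\<bar>" "T / 2 \<le> \<bar>shift v w t\<bar>"
      using arith[of "shift v u w" "shift v w t"] min[OF vF(1)] big[OF vF(1)] by auto
    show "e v \<le> 2 * \<bar>shift v u w\<bar>" "e v \<le> 3 * T" using bd[OF vF(1)] eb(1)[OF vF(2)] by auto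
  qed
  have comm: "\<bar>shift v y x\<bar> = \<bar>shift v x y\<bar>" "\<bar>shift v z x\<bar> = \<bar>shift v x z\<bar>" "\<bar>shift v z y\<bar> = \<bar>shift v y z\<bar>" for v
    by (simp_all only: shift_commute[of v y x] shift_commute[of v z x] shift_commute[of v z y] abs_minus_cancel)
  define M where "M = 3 * T + 64 / (T * \<gamma>\<^sup>2)"
  have F123: "F1 \<subseteq> F" "F2 \<subseteq> F" "F3 \<subseteq> F" by (auto simp: F1_def F2_def F3_def)
  have "sum e {v \<in> F1. P v = b} \<le> M" for b
    unfolding M_def
  proof (rule half[OF F123(1) x y z])
    fix v assume "v \<in> F1"
    then show "\<bar>shift v x y\<bar> \<le> \<bar>shift v y z\<bar> \<and> \<bar>shift v x y\<bar> \<le> \<bar>shift v x z\<bar>"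
      "\<bar>shift v x y\<bar> > T \<or> \<bar>shift v y z\<bar> > T \<or> \<bar>shift v x z\<bar> > T" "e v \<le> 2 * \<bar>shift v x y\<bar>"
      using large[of v] eb(2)[of v] by (simp_all add: F1_def) blast
  qed
  note m1 = this[of True] this[of False]
  have "sum e {v \<in> F2. P v = b} \<le> M" for b
    unfolding M_def
  proof (rule half[OF F123(2) y z x])
    fix v assume "v \<in> F2"
    then show "\<bar>shift v y z\<bar> \<le> \<bar>shift v z x\<bar> \<and> \<bar>shift v y z\<bar> \<le> \<bar>shift v y x\<bar>"
      "\<bar>shift v y z\<bar> > T \<or> \<bar>shift v z x\<bar> > T \<or> \<bar>shift v y x\<bar> > T" "e v \<le> 2 * \<bar>shift v y z\<bar>"
      using large[of v] eb(3)[of v] by (simp_all add: F2_def comm) blast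
  qed
  note m2 = this[of True] this[of False]
  have "sum e {v \<in> F3. P v = b} \<le> M" for b
    unfolding M_def
  proof (rule half[OF F123(3) x z y])
    fix v assume "v \<in> F3"
    then show "\<bar>shift v x z\<bar> \<le> \<bar>shift v z y\<bar> \<and> \<bar>shift v x z\<bar> \<le> \<bar>shift v x y\<bar>"
      "\<bar>shift v x z\<bar> > T \<or> \<bar>shift v z y\<bar> > T \<or> \<bar>shift v x y\<bar> > T" "e v \<le> 2 * \<bar>shift v x z\<bar>"
      using large[of v] eb(4)[of v] by (simp_all add: F3_def comm) blast
  qed
  note m3 = this[of True] this[of False]
  have split: "sum e F' = sum e {v \<in> F'. P v = True} + sum e {v \<in> F'. P v = False}" if "F' \<subseteq> F" for F'
  proof -
    have "F' = {v \<in> F'. P v = True} \<union> {v \<in> F'. P v = False}" by auto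
    moreover have "{v \<in> F'. P v = True} \<inter> {v \<in> F'. P v = False} = {}" by auto
    moreover have "finite F'" using finite_subset[OF that fin] .
    ultimately show ?thesis
      using sum.union_disjoint[of "{v \<in> F'. P v = True}" "{v \<in> F'. P v = False}" e] by (metis finite_Un)
  qed
  have "sum e F \<le> sum e F1 + sum e F2 + sum e F3"
  proof -
    have fins: "finite F1" "finite F2" "finite F3" using fin by (simp_all add: F1_def F2_def F3_def)
    \<comment> \<open>Ties make the three sets overlap, which is harmless because e is
      nonnegative.\<close>
    have "F = F1 \<union> F2 \<union> F3"
    proof (rule Set.set_eqI)
      fix v show "v \<in> F \<longleftrightarrow> v \<in> F1 \<union> F2 \<union> F3"
        unfolding F1_def F2_def F3_def by simp linarith
    qed
    then have "sum e F \<le> sum e (F1 \<union> F2) + sum e F3"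
      using sum.union_inter[of "F1 \<union> F2" F3 e] fins sum_nonneg[of "(F1 \<union> F2) \<inter> F3" e, OF e0] by simp
    also have "sum e (F1 \<union> F2) \<le> sum e F1 + sum e F2"
      using sum.union_inter[of F1 F2 e] fins sum_nonneg[of "F1 \<inter> F2" e, OF e0] by simp
    finally show ?thesis by simp
  qed
  then have "sum e F \<le> drift_defect \<gamma> T"
    unfolding drift_defect_def M_def[symmetric]
    using m1 m2 m3 split[OF F123(1)] split[OF F123(2)] split[OF F123(3)] by linarith
  then show ?thesis using total by simp
qed

subsection \<open>The case of a parabolic element\<close>

lemma separated_lower_bound:
  assumes sep: "separated \<gamma> V"
  obtains m where "m > 0" "\<And>v. v \<in> V \<Longrightarrow> m \<le> \<bar>fst v\<bar> + \<bar>snd v\<bar>"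
proof -
  define F where "F = {v \<in> V. \<bar>fst v\<bar> \<le> 1 \<and> \<bar>snd v\<bar> \<le> 1}"
  define N where "N = insert 1 ((\<lambda>v. \<bar>fst v\<bar> + \<bar>snd v\<bar>) ` F)"
  have fin: "finite N" using separated_finite_bounded[OF sep, of 1] by (simp add: N_def F_def)
  have pos: "\<bar>fst v\<bar> + \<bar>snd v\<bar> > 0" if "v \<in> V" for v
  proof -
    have "v \<noteq> 0" using sep that by (auto simp: separated_def)
    then have "fst v \<noteq> 0 \<or> snd v \<noteq> 0" by (auto simp: prod_eq_iff)
    then show ?thesis by auto
  qed
  have "\<And>x. x \<in> N \<Longrightarrow> x > 0" using pos by (auto simp: N_def F_def)
  then have "Min N > 0" using fin by (simp add: N_def)
  moreover have "Min N \<le> \<bar>fst v\<bar> + \<bar>snd v\<bar>" if v: "v \<in> V" for v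
  proof (cases "v \<in> F")
    case True
    then show ?thesis using fin by (intro Min_le) (auto simp: N_def)
  next
    case False
    then have "\<bar>fst v\<bar> + \<bar>snd v\<bar> \<ge> 1" using v by (auto simp: F_def)
    moreover have "Min N \<le> 1" using fin by (intro Min_le) (auto simp: N_def)
    ultimately show ?thesis by simp
  qed
  ultimately show thesis by (rule that)
qed

text \<open>For c, d nonzero the cusp of (c, d) is not an end of the imaginary axis, and the
  displacement along that axis is bounded independently of t.\<close>

lemma shift_vertical_le:
  assumes t: "t > 0" and cd: "c \<noteq> 0" "d \<noteq> 0"
  shows "\<bar>shift (c, d) \<i> (of_real t * \<i>)\<bar> \<le> 1 / \<bar>c * d\<bar>"
proof -
  define N where "N = (c\<^sup>2 + d\<^sup>2) * (c\<^sup>2 * t\<^sup>2 + d\<^sup>2)"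
  have N: "N \<ge> (c * d)\<^sup>2 * (1 + t\<^sup>2)"
  proof -
    have "N = (c * d)\<^sup>2 * (1 + t\<^sup>2) + ((c\<^sup>2 * t)\<^sup>2 + (d\<^sup>2)\<^sup>2)"
      by (simp add: N_def power2_eq_square algebra_simps)
    then show ?thesis by simp
  qed
  have pos: "(c * d)\<^sup>2 * (1 + t\<^sup>2) > 0" using cd by (intro mult_pos_pos) (auto intro: add_pos_nonneg)
  have "shift (c, d) \<i> (of_real t * \<i>) = (1 - t\<^sup>2) * (c * d) / N"
  proof -
    have "linear_form (c, d) \<i> * linear_form (c, d) (of_real t * \<i>) = Complex (d\<^sup>2 - c\<^sup>2 * t) (c * d * (1 + t))"
      by (simp add: linear_form_def complex_eq_iff power2_eq_square algebra_simps)
    moreover have "(d\<^sup>2 - c\<^sup>2 * t)\<^sup>2 + (c * d * (1 + t))\<^sup>2 = N"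
      by (simp add: N_def power2_eq_square algebra_simps)
    ultimately show ?thesis
      by (simp add: shift_def Re_divide power2_eq_square algebra_simps)
  qed
  then have "\<bar>shift (c, d) \<i> (of_real t * \<i>)\<bar> = \<bar>1 - t\<^sup>2\<bar> * \<bar>c * d\<bar> / N"
    using N pos by (simp add: abs_mult)
  also have "\<dots> \<le> (1 + t\<^sup>2) * \<bar>c * d\<bar> / ((c * d)\<^sup>2 * (1 + t\<^sup>2))"
  proof (intro frac_le mult_right_mono)
    show "\<bar>1 - t\<^sup>2\<bar> \<le> 1 + t\<^sup>2" using zero_le_power2[of t] by linarith
  qed (use N pos in auto)
  also have "\<dots> = \<bar>c * d\<bar> / (c * d)\<^sup>2"
    using add_pos_nonneg[OF zero_less_one zero_le_power2[of t]] by simp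
  also have "(c * d)\<^sup>2 = \<bar>c * d\<bar> * \<bar>c * d\<bar>" by (simp only: power2_eq_square abs_mult_self_eq)
  also have "\<bar>c * d\<bar> / (\<bar>c * d\<bar> * \<bar>c * d\<bar>) = 1 / \<bar>c * d\<bar>"
  proof -
    have "q / (q * q) = 1 / q" for q :: real by simp
    then show ?thesis .
  qed
  finally show ?thesis .
qed

text \<open>The scaling by a hyperbolic element leaves c d unchanged. It can bring |c| just below
  m/2; then |d| is at least m/2, and |c d| is bounded from below.\<close>

lemma shift_vertical_bounded:
  assumes sep: "separated \<gamma> W" and \<sigma>: "\<sigma> > 0"
    and closed: "\<And>c d n. (c, d) \<in> W \<Longrightarrow> (c * exp (of_int n * \<sigma> / 2), d * exp (- (of_int n * \<sigma> / 2))) \<in> W"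
  obtains B where "\<And>w t. w \<in> W \<Longrightarrow> t > 0 \<Longrightarrow> \<bar>shift w \<i> (of_real t * \<i>)\<bar> \<le> B"
proof -
  obtain m where m: "m > 0" "\<And>v. v \<in> W \<Longrightarrow> m \<le> \<bar>fst v\<bar> + \<bar>snd v\<bar>"
    using separated_lower_bound[OF sep] by blast
  have scaled: "m \<le> \<bar>c\<bar> * exp (of_int n * \<sigma> / 2) + \<bar>d\<bar> * exp (- (of_int n * \<sigma> / 2))" if "(c, d) \<in> W" for c d n
    using m(2)[OF closed[OF that, of n]] by (simp add: abs_mult)
  have swap: "(\<exists>n::int. \<bar>c\<bar> * exp (of_int n * \<sigma> / 2) < m / 2 \<and> m / 2 \<le> \<bar>c\<bar> * exp ((of_int n + 1) * \<sigma> / 2))" if "c \<noteq> 0" for c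
  proof -
    define u where "u = 2 * ln (m / (2 * \<bar>c\<bar>)) / \<sigma>"
    have e: "\<bar>c\<bar> * exp (u * \<sigma> / 2) = m / 2" using \<sigma> m(1) that by (simp add: u_def)
    define n where "n = \<lceil>u\<rceil> - 1"
    have n: "of_int n < u" "u \<le> of_int n + 1" unfolding n_def by linarith+
    have "exp (of_int n * \<sigma> / 2) < exp (u * \<sigma> / 2)" "exp (u * \<sigma> / 2) \<le> exp ((of_int n + 1) * \<sigma> / 2)"
      using n \<sigma> by (simp_all add: mult_right_mono)
    then have "\<bar>c\<bar> * exp (of_int n * \<sigma> / 2) < \<bar>c\<bar> * exp (u * \<sigma> / 2)"
      "\<bar>c\<bar> * exp (u * \<sigma> / 2) \<le> \<bar>c\<bar> * exp ((of_int n + 1) * \<sigma> / 2)"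
      using that by (auto intro!: mult_strict_left_mono mult_left_mono)
    then show ?thesis unfolding e by blast
  qed
  have low: "c \<noteq> 0 \<and> d \<noteq> 0 \<and> m\<^sup>2 / (4 * exp (\<sigma> / 2)) \<le> \<bar>c * d\<bar>" if W: "(c, d) \<in> W" for c d
  proof -
    \<comment> \<open>Otherwise scaling would shrink (0, d) below the lower bound m.\<close>
    have "c \<noteq> 0"
    proof
      assume c: "c = 0"
      then have "d \<noteq> 0" using m(2)[OF W] m(1) by auto
      from swap[OF this] obtain n where "\<bar>d\<bar> * exp (of_int n * \<sigma> / 2) < m / 2" by blast
      then show False using scaled[OF W, of "- n"] c m(1) by simp
    qed
    from swap[OF this] obtain n where n: "\<bar>c\<bar> * exp (of_int n * \<sigma> / 2) < m / 2"
      "m / 2 \<le> \<bar>c\<bar> * exp ((of_int n + 1) * \<sigma> / 2)" by blast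
    define p where "p = \<bar>c\<bar> * exp (of_int n * \<sigma> / 2)"
    define q where "q = \<bar>d\<bar> * exp (- (of_int n * \<sigma> / 2))"
    have pq: "p * q = \<bar>c * d\<bar>" by (simp add: p_def q_def abs_mult exp_minus)
    have "m / 2 \<le> p * exp (\<sigma> / 2)" using n(2) by (simp add: p_def exp_add[symmetric] algebra_simps add_divide_distrib)
    then have p: "m / (2 * exp (\<sigma> / 2)) \<le> p" by (simp add: pos_divide_le_eq mult_ac)
    have "p \<ge> 0" by (simp add: p_def)
    have q: "m / 2 \<le> q" using scaled[OF W, of n] n(1) by (simp add: p_def q_def)
    have "(m / (2 * exp (\<sigma> / 2))) * (m / 2) \<le> p * q" using p q m(1) \<open>p \<ge> 0\<close> by (intro mult_mono) auto
    then have "m\<^sup>2 / (4 * exp (\<sigma> / 2)) \<le> \<bar>c * d\<bar>" unfolding pq by (simp add: power2_eq_square)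
    moreover have "m\<^sup>2 / (4 * exp (\<sigma> / 2)) > 0" using m(1) by simp
    ultimately show ?thesis by auto
  qed
  show thesis
  proof (rule that)
    fix w :: "real \<times> real" and t :: real assume w: "w \<in> W" and t: "t > 0"
    obtain c d where cd: "w = (c, d)" by (cases w)
    note l = low[OF w[unfolded cd]]
    have "\<bar>shift w \<i> (of_real t * \<i>)\<bar> \<le> 1 / \<bar>c * d\<bar>" unfolding cd using shift_vertical_le[OF t] l by blast
    also have "\<dots> \<le> 1 / (m\<^sup>2 / (4 * exp (\<sigma> / 2)))" using l m(1) by (intro divide_left_mono mult_pos_pos) auto
    finally show "\<bar>shift w \<i> (of_real t * \<i>)\<bar> \<le> 1 / (m\<^sup>2 / (4 * exp (\<sigma> / 2)))" .
  qed
qed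

text \<open>By partial fractions the displacement comes from a difference of two numbers, 1/(c q)
  and 1/(c p), of modulus at most 1/c^2.\<close>

lemma shift_horizontal_le:
  assumes c: "c \<noteq> 0"
  shows "\<bar>shift (c, d) \<i> (\<i> + of_real t)\<bar> \<le> 2 / c\<^sup>2"
proof -
  have big: "\<bar>c\<bar> \<le> cmod (linear_form (c, d) (\<i> + of_real u))" for u
    using abs_Im_le_cmod[of "linear_form (c, d) (\<i> + of_real u)"] by (simp add: linear_form_def)
  have pos: "cmod (linear_form (c, d) (\<i> + of_real u)) > 0" for u using big[of u] c by linarith
  define p where "p = linear_form (c, d) \<i>" define q where "q = linear_form (c, d) (\<i> + of_real t)"
  have p: "\<bar>c\<bar> \<le> cmod p" "p \<noteq> 0" using big[of 0] pos[of 0] by (auto simp: p_def)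
  have q: "\<bar>c\<bar> \<le> cmod q" "q \<noteq> 0" using big[of t] pos[of t] by (auto simp: q_def)
  have "of_real c * (\<i> - (\<i> + of_real t)) = p - q" by (simp add: p_def q_def linear_form_def algebra_simps)
  then have "(\<i> - (\<i> + of_real t)) / (p * q) = (1 / of_real c) * (1 / q - 1 / p)"
    using p q c by (simp add: field_simps)
  then have "\<bar>shift (c, d) \<i> (\<i> + of_real t)\<bar> \<le> cmod ((1 / of_real c) * (1 / q - 1 / p))"
    using abs_Re_le_cmod by (metis p_def q_def shift_def)
  also have "\<dots> = 1 / \<bar>c\<bar> * cmod (1 / q - 1 / p)" by (simp add: norm_mult norm_divide)
  also have "\<dots> \<le> 1 / \<bar>c\<bar> * (1 / cmod q + 1 / cmod p)"
    using norm_triangle_ineq4[of "1 / q" "1 / p"] by (intro mult_left_mono) (auto simp: norm_divide)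
  also have "\<dots> \<le> 1 / \<bar>c\<bar> * (1 / \<bar>c\<bar> + 1 / \<bar>c\<bar>)"
    using p q c by (intro mult_left_mono add_mono divide_left_mono mult_pos_pos) auto
  also have "\<dots> = 2 / (\<bar>c\<bar> * \<bar>c\<bar>)" by simp
  finally show ?thesis by (simp add: power2_eq_square)
qed

text \<open>A translation reduces |d| to at most |s c|, so the lower bound on row vectors becomes a
  lower bound on |c|.\<close>

lemma shift_horizontal_bounded:
  assumes sep: "separated \<gamma> W" and s: "s \<noteq> 0"
    and closed: "\<And>c d n. (c, d) \<in> W \<Longrightarrow> (c, d + of_int n * s * c) \<in> W"
  obtains B where "\<And>c d t. (c, d) \<in> W \<Longrightarrow> c \<noteq> 0 \<Longrightarrow> \<bar>shift (c, d) \<i> (\<i> + of_real t)\<bar> \<le> B"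
proof -
  obtain m where m: "m > 0" "\<And>v. v \<in> W \<Longrightarrow> m \<le> \<bar>fst v\<bar> + \<bar>snd v\<bar>"
    using separated_lower_bound[OF sep] by blast
  define b where "b = m / (1 + \<bar>s\<bar>)"
  have b: "b > 0" using m(1) by (simp add: b_def add_pos_nonneg)
  show thesis
  proof (rule that)
    fix c d t :: real assume W: "(c, d) \<in> W" and c: "c \<noteq> 0"
    define n where "n = \<lfloor>- d / (s * c)\<rfloor>"
    have "\<bar>- d / (s * c) - of_int n\<bar> \<le> 1" unfolding n_def by linarith
    then have "\<bar>- d / (s * c) - of_int n\<bar> * \<bar>s * c\<bar> \<le> 1 * \<bar>s * c\<bar>" by (intro mult_right_mono) auto
    then have "\<bar>(- d / (s * c) - of_int n) * (s * c)\<bar> \<le> \<bar>s * c\<bar>" by (simp only: abs_mult mult_1)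
    moreover have "(- d / (s * c) - of_int n) * (s * c) = - (d + of_int n * s * c)"
      using s c by (simp add: left_diff_distrib)
    ultimately have "\<bar>- (d + of_int n * s * c)\<bar> \<le> \<bar>s * c\<bar>" by (simp only:)
    then have "\<bar>d + of_int n * s * c\<bar> \<le> \<bar>s\<bar> * \<bar>c\<bar>" by (simp only: abs_minus_cancel abs_mult)
    then have "m \<le> \<bar>c\<bar> * (1 + \<bar>s\<bar>)" using m(2)[OF closed[OF W, of n]] by (simp add: algebra_simps)
    then have "b \<le> \<bar>c\<bar>" by (simp add: b_def pos_divide_le_eq add_pos_nonneg)
    then have "b\<^sup>2 \<le> c\<^sup>2" using b by (metis abs_ge_zero less_imp_le power2_abs power_mono)
    have "\<bar>shift (c, d) \<i> (\<i> + of_real t)\<bar> \<le> 2 / c\<^sup>2" by (rule shift_horizontal_le[OF c])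
    also have "\<dots> \<le> 2 / b\<^sup>2" using \<open>b\<^sup>2 \<le> c\<^sup>2\<close> b c by (intro divide_left_mono mult_pos_pos) auto
    finally show "\<bar>shift (c, d) \<i> (\<i> + of_real t)\<bar> \<le> 2 / b\<^sup>2" .
  qed
qed

text \<open>Rows transform by right multiplication, since the forms pick up the factor 1/(r z + t),
  which cancels against the one in the difference of the images.\<close>

lemma shift_act:
  assumes 1: "p * t - q * r = 1" and x: "x \<in> HP" and y: "y \<in> HP"
  shows "shift (c, d) (act (P2 p q r t) x) (act (P2 p q r t) y) = shift (c * p + d * r, c * q + d * t) x y"
proof -
  have n: "of_real r * x + of_real t \<noteq> 0" "of_real r * y + of_real t \<noteq> 0"
    using den_nonzero[OF x 1] den_nonzero[OF y 1] by auto
  have l: "linear_form (c, d) (act (P2 p q r t) z) = linear_form (c * p + d * r, c * q + d * t) z / (of_real r * z + of_real t)"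
    if "of_real r * z + of_real t \<noteq> 0" for z
    using that unfolding act_P2 linear_form_def by (simp add: field_simps)
  show ?thesis unfolding shift_def act_diff_P2[OF x y 1] l[OF n(1)] l[OF n(2)] using n by simp
qed

definition translation :: "(real^2^2) set \<Rightarrow> real \<Rightarrow> (real^2^2) set" where
  "translation k t = k \<cdot> P2 1 t 0 1 \<cdot> pinv k"

lemma tr_carrier: "k \<in> carrier PSL2R \<Longrightarrow> translation k t \<in> carrier PSL2R"
  by (simp add: translation_def P2_carrier)

lemma act_tr: "k \<in> carrier PSL2R \<Longrightarrow> z \<in> HP \<Longrightarrow> act (translation k t) (act k z) = act k (z + of_real t)"
  by (simp add: translation_def act_mult act_HP P2_carrier) (simp add: act_P2)

lemma eq_of_act_along:
  assumes k: "k \<in> carrier PSL2R" and "X \<in> carrier PSL2R" "Y \<in> carrier PSL2R"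
    and "\<And>z. z \<in> HP \<Longrightarrow> act X (act k z) = act Y (act k z)"
  shows "X = Y"
proof (rule act_eqI[OF assms(2,3)])
  fix z assume "z \<in> HP"
  then show "act X z = act Y z"
    using assms(4)[of "act (pinv k) z"] k by (simp add: act_HP)
qed

lemma tr_add: "k \<in> carrier PSL2R \<Longrightarrow> translation k s \<cdot> translation k t = translation k (s + t)"
  by (rule eq_of_act_along[of k]) (simp_all add: tr_carrier act_mult act_tr act_HP add_ac)

lemma tr_0: "k \<in> carrier PSL2R \<Longrightarrow> translation k 0 = \<^bold>1"
  by (rule eq_of_act_along[of k]) (simp_all add: tr_carrier act_tr)

lemma inv_tr: "k \<in> carrier PSL2R \<Longrightarrow> pinv (translation k t) = translation k (- t)"
  by (rule PSL.inv_equality) (simp_all add: tr_carrier tr_add tr_0)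

lemma tr_nat_pow: "k \<in> carrier PSL2R \<Longrightarrow> translation k t \<^bold>^ (n::nat) = translation k (real n * t)"
  by (induction n) (simp_all add: tr_0 tr_add algebra_simps)

lemma tr_int_pow: "k \<in> carrier PSL2R \<Longrightarrow> translation k t \<^bold>^ (n::int) = translation k (of_int n * t)"
  by (cases n rule: int_cases2) (simp_all add: int_pow_int PSL.int_pow_neg_int tr_nat_pow inv_tr tr_carrier)

lemma parabolic_along_tr:
  assumes "X \<in> carrier PSL2R" "parabolic_along k s X"
  shows "X = translation k s"
  by (rule eq_of_act_along[of k]) (use assms in \<open>auto simp: parabolic_along_def tr_carrier act_tr\<close>)

section \<open>The rows of a cusp orbit and their separation\<close>

context fuchsian
begin

text \<open>The lower rows of the matrices in \<open>k\<^sup>-\<^sup>1 G l\<close> represent the translates of the cusp \<open>k \<infinity>\<close> in the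
  coordinate \<open>l\<close>; each translate occurs twice, as \<open>v\<close> and \<open>- v\<close>.\<close>

definition lower_rows :: "(real^2^2) set \<Rightarrow> (real^2^2) set \<Rightarrow> (real \<times> real) set" where
  "lower_rows k l = {(c, d). \<exists>a b. a * d - b * c = 1 \<and> k \<cdot> P2 a b c d \<cdot> pinv l \<in> G}"

text \<open>G absorbs the right factor. This gives both the invariance of the drift and the closure
  of the rows under elements that preserve the coordinate l.\<close>

lemma rows_mult_G:
  assumes k: "k \<in> carrier PSL2R" and l: "l \<in> carrier PSL2R" and X: "X \<in> G"
  shows "lower_rows k (X \<cdot> l) = lower_rows k l"
proof -
  have XP: "X \<in> carrier PSL2R" by (rule G_PSL[OF X])
  have "Z \<cdot> pinv (X \<cdot> l) \<in> G \<longleftrightarrow> Z \<cdot> pinv l \<in> G"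
    if Z: "Z \<in> carrier PSL2R" for Z
  proof -
    have "Z \<cdot> pinv (X \<cdot> l) = (Z \<cdot> pinv l) \<cdot> pinv X"
      using XP l Z by (simp add: PSL.inv_mult_group PSL.m_assoc)
    moreover have "Z \<cdot> pinv l = (Z \<cdot> pinv l) \<cdot> pinv X \<cdot> X"
      using XP l Z by (simp add: PSL.m_assoc)
    ultimately show ?thesis using X by (metis mult_G inv_G)
  qed
  then have "a * d - b * c = 1 \<Longrightarrow>
    k \<cdot> P2 a b c d \<cdot> pinv (X \<cdot> l) \<in> G \<longleftrightarrow>
    k \<cdot> P2 a b c d \<cdot> pinv l \<in> G" for a b c d
    using k by (simp add: P2_carrier)
  then show ?thesis by (simp add: lower_rows_def cong: conj_cong)
qed

lemma rows_act:
  assumes k: "k \<in> carrier PSL2R" and l: "l \<in> carrier PSL2R" and Y: "p * t - q * r = 1"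
    and cd: "(c, d) \<in> lower_rows k l"
  shows "(c * p + d * r, c * q + d * t) \<in> lower_rows k (l \<cdot> P2 p q r t)"
proof -
  obtain a b where 1: "a * d - b * c = 1" and G: "k \<cdot> P2 a b c d \<cdot> pinv l \<in> G"
    using cd by (auto simp: lower_rows_def)
  have "(a * p + b * r) * (c * q + d * t) - (a * q + b * t) * (c * p + d * r) = (a * d - b * c) * (p * t - q * r)"
    by (simp add: algebra_simps)
  moreover have "k \<cdot> (P2 a b c d \<cdot> P2 p q r t) \<cdot> pinv (l \<cdot> P2 p q r t)
      = k \<cdot> P2 a b c d \<cdot> pinv l"
    using k l P2_carrier[OF 1] P2_carrier[OF Y]
    by (simp add: PSL.inv_mult_group PSL.m_assoc PSL_cancel)
  ultimately have "(a * p + b * r) * (c * q + d * t) - (a * q + b * t) * (c * p + d * r) = 1 \<and>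
      k \<cdot> P2 (a * p + b * r) (a * q + b * t) (c * p + d * r) (c * q + d * t)
        \<cdot> pinv (l \<cdot> P2 p q r t) \<in> G"
    using 1 Y G by (simp add: P2_mult)
  then show ?thesis unfolding lower_rows_def mem_Collect_eq case_prod_conv by blast
qed

text \<open>Right multiplication by Y reindexes the sum; f and g are multiplication by Y and by its
  inverse.\<close>

lemma drift_act:
  assumes k: "k \<in> carrier PSL2R" and l: "l \<in> carrier PSL2R" and Y: "Y \<in> carrier PSL2R"
    and x: "x \<in> HP" and y: "y \<in> HP"
  shows "drift T (lower_rows k l) (act Y x) (act Y y) = drift T (lower_rows k (l \<cdot> Y)) x y"
proof -
  obtain p q r t where 1: "p * t - q * r = 1" and Ym: "Y = P2 p q r t" using Y by (rule PSL2R_cases)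
  define f where "f v = (fst v * p + snd v * r, fst v * q + snd v * t)" for v :: "real \<times> real"
  define g where "g v = (fst v * t + snd v * (- r), fst v * (- q) + snd v * p)" for v :: "real \<times> real"
  have det': "t * p - (- q) * (- r) = 1" using 1 by (simp add: mult.commute)
  have gf: "g (f v) = v" "f (g v) = v" for v
  proof -
    have "(c * p + d * r) * t + (c * q + d * t) * (- r) = c * (p * t - q * r)"
      "(c * p + d * r) * (- q) + (c * q + d * t) * p = d * (p * t - q * r)"
      "(c * t + d * (- r)) * p + (c * (- q) + d * p) * r = c * (p * t - q * r)"
      "(c * t + d * (- r)) * q + (c * (- q) + d * p) * t = d * (p * t - q * r)" for c d
      by (simp_all add: algebra_simps)
    then show "g (f v) = v" "f (g v) = v" by (simp_all add: f_def g_def 1)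
  qed
  have fW: "f v \<in> lower_rows k (l \<cdot> Y)" if "v \<in> lower_rows k l" for v
    using rows_act[OF k l 1, of "fst v" "snd v"] that by (simp add: f_def Ym)
  have gW: "g v \<in> lower_rows k l" if "v \<in> lower_rows k (l \<cdot> Y)" for v
  proof -
    have "g v \<in> lower_rows k (l \<cdot> Y \<cdot> P2 t (- q) (- r) p)"
      using rows_act[OF k _ det', of "l \<cdot> Y" "fst v" "snd v"] that l Y by (simp add: g_def)
    moreover have "P2 t (- q) (- r) p = pinv Y" using 1 by (simp add: Ym P2_inv)
    ultimately show ?thesis using l Y by (simp add: PSL.m_assoc)
  qed
  have sh: "shift v (act Y x) (act Y y) = shift (f v) x y" for v
    using shift_act[OF 1 x y, of "fst v" "snd v"] by (simp add: Ym f_def)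
  show ?thesis unfolding drift_def
    by (rule sum.reindex_bij_witness[of _ g f]) (auto simp: gf fW gW sh sh[of "g _"])
qed

text \<open>Translation by t moves the point of height 1 by a distance with hyperbolic cosine 1 +
  t^2/2.\<close>

lemma translations_finite:
  assumes k: "k \<in> carrier PSL2R"
  shows "finite {t. translation k t \<in> G \<and> \<bar>t\<bar> \<le> B}"
proof (rule finite_subset)
  have i: "\<i> \<in> HP" by (simp add: HP_def)
  define p where "p = act k \<i>"
  have p: "p \<in> HP" by (simp add: p_def act_HP k i)
  define D where "D = arcosh (1 + B\<^sup>2 / 2)"
  show "{t. translation k t \<in> G \<and> \<bar>t\<bar> \<le> B} \<subseteq> (\<lambda>X. Re (act (pinv k) (act X p))) ` {X \<in> G. hdist (act X p) p \<le> D}"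
  proof
    fix t assume t: "t \<in> {t. translation k t \<in> G \<and> \<bar>t\<bar> \<le> B}"
    have it: "\<i> + of_real t \<in> HP" using i by simp
    have a: "act (translation k t) p = act k (\<i> + of_real t)" by (simp add: p_def act_tr k i)
    have "t\<^sup>2 \<le> B\<^sup>2" using t by (metis (mono_tags, lifting) abs_ge_zero mem_Collect_eq power2_abs power_mono)
    then have "cosh (hdist (\<i> + of_real t) \<i>) \<le> cosh D"
      by (simp add: cosh_hdist i it D_def) (simp add: hcosh_def)
    then have "hdist (\<i> + of_real t) \<i> \<le> D"
      using hdist_nonneg[OF it i] by (subst (asm) cosh_real_nonneg_le_iff) (auto simp: D_def)
    then have "hdist (act (translation k t) p) p \<le> D" unfolding a by (simp add: p_def hdist_act k i it)
    moreover have "t = Re (act (pinv k) (act (translation k t) p))" unfolding a using k it by simp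
    ultimately show "t \<in> (\<lambda>X. Re (act (pinv k) (act X p))) ` {X \<in> G. hdist (act X p) p \<le> D}"
      using t by blast
  qed
  show "finite ((\<lambda>X. Re (act (pinv k) (act X p))) ` {X \<in> G. hdist (act X p) p \<le> D})"
    by (intro finite_imageI finite_orbit p)
qed

text \<open>By \<open>hcosh_act_ii\<close> the bound B limits the displacement of one point, so
  finitely many group elements remain, and each determines c up to sign.\<close>

lemma lower_left_finite:
  assumes k: "k \<in> carrier PSL2R"
  shows "finite {c. \<exists>a b d. a * d - b * c = 1 \<and> k \<cdot> P2 a b c d \<cdot> pinv k \<in> G \<and>
     a\<^sup>2 + b\<^sup>2 + c\<^sup>2 + d\<^sup>2 \<le> B}" (is "finite ?C")
proof (rule finite_subset)
  have i: "\<i> \<in> HP" by (simp add: HP_def)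
  define p where "p = act k \<i>"
  have p: "p \<in> HP" by (simp add: p_def act_HP k i)
  define D where "D = arcosh (max 1 (B / 2))"
  define Q where "Q X = {c. \<exists>a b d. P2 a b c d = pinv k \<cdot> X \<cdot> k}" for X
  show "?C \<subseteq> (\<Union>X\<in>{X \<in> G. hdist (act X p) p \<le> D}. Q X)"
  proof clarify
    fix a b c d :: real
    assume 1: "a * d - b * c = 1" and G: "k \<cdot> P2 a b c d \<cdot> pinv k \<in> G"
      and B: "a\<^sup>2 + b\<^sup>2 + c\<^sup>2 + d\<^sup>2 \<le> B"
    define A where "A = P2 a b c d"
    have A: "A \<in> carrier PSL2R" by (simp add: A_def P2_carrier 1)
    define X where "X = k \<cdot> A \<cdot> pinv k"
    have Ai: "act A \<i> \<in> HP" by (rule act_HP[OF A i])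
    have "act X p = act k (act A \<i>)" using k A i by (simp add: X_def p_def act_mult act_HP)
    then have d: "hdist (act X p) p = hdist (act A \<i>) \<i>" by (simp add: p_def hdist_act k Ai i)
    have "cosh (hdist (act A \<i>) \<i>) \<le> cosh D"
      using hcosh_act_ii[OF 1] B cosh_hdist[OF Ai i] by (simp add: D_def A_def)
    then have "hdist (act X p) p \<le> D"
      unfolding d using hdist_nonneg[OF Ai i] by (subst (asm) cosh_real_nonneg_le_iff) (auto simp: D_def)
    moreover have "pinv k \<cdot> X \<cdot> k = A"
      using k A by (simp add: X_def PSL.m_assoc PSL_cancel)
    then have "c \<in> Q X" unfolding Q_def A_def by blast
    ultimately show "c \<in> (\<Union>X\<in>{X \<in> G. hdist (act X p) p \<le> D}. Q X)" using G by (auto simp: X_def A_def)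
  qed
  have "finite (Q X)" for X
  proof (cases "Q X = {}")
    case False
    then obtain a0 b0 c0 d0 where "P2 a0 b0 c0 d0 = pinv k \<cdot> X \<cdot> k" by (auto simp: Q_def)
    then have "Q X \<subseteq> {c0, - c0}" unfolding Q_def by (auto simp: P2_eq_iff dest: sym)
    then show ?thesis by (rule finite_subset) simp
  qed simp
  then show "finite (\<Union>X\<in>{X \<in> G. hdist (act X p) p \<le> D}. Q X)"
    using finite_orbit[OF p p] by blast
qed

lemma adjust_into_interval:
  fixes a q :: real
  assumes "q \<noteq> 0"
  obtains i :: int where "1 \<le> a + of_int i * q" "a + of_int i * q \<le> 1 + \<bar>q\<bar>"
proof -
  define j where "j = \<lceil>(1 - a) / \<bar>q\<bar>\<rceil>"
  have "(1 - a) / \<bar>q\<bar> \<le> of_int j" "of_int j \<le> (1 - a) / \<bar>q\<bar> + 1" unfolding j_def by linarith+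
  then have j: "1 - a \<le> of_int j * \<bar>q\<bar>" "of_int j * \<bar>q\<bar> \<le> 1 - a + \<bar>q\<bar>"
    using assms by (simp_all add: field_simps)
  show thesis
  proof (cases "q > 0")
    case True
    then show thesis using j that[of j] by simp
  next
    case False
    then show thesis using j that[of "- j"] by simp
  qed
qed

text \<open>A qualitative form of Shimizu's lemma. Multiplying by translations in G on both sides
  keeps c and normalizes a and d; for |c| \<le> 1 all entries are then bounded, and only finitely
  many c remain.\<close>

lemma lower_left_bound:
  assumes k: "k \<in> carrier PSL2R" and s: "s \<noteq> 0" and h: "translation k s \<in> G"
  obtains \<gamma> where "\<gamma> > 0" "\<And>a b c d. a * d - b * c = 1 \<Longrightarrow>
    k \<cdot> P2 a b c d \<cdot> pinv k \<in> G \<Longrightarrow> c \<noteq> 0 \<Longrightarrow> \<gamma> \<le> \<bar>c\<bar>"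
proof -
  define B where "B = (1 + \<bar>s\<bar>)\<^sup>2 + (2 * \<bar>s\<bar> + s\<^sup>2)\<^sup>2 + 1 + (1 + \<bar>s\<bar>)\<^sup>2"
  define C where "C = {c. \<exists>a b d. a * d - b * c = 1 \<and> k \<cdot> P2 a b c d \<cdot> pinv k \<in> G \<and>
     a\<^sup>2 + b\<^sup>2 + c\<^sup>2 + d\<^sup>2 \<le> B}"
  define N where "N = insert 1 (abs ` (C - {0}))"
  have fin: "finite N" using lower_left_finite[OF k] by (simp add: N_def C_def)
  have "Min N > 0" using fin by (auto simp: N_def)
  moreover have "Min N \<le> \<bar>c\<bar>"
    if 1: "a * d - b * c = 1" and G: "k \<cdot> P2 a b c d \<cdot> pinv k \<in> G" and c: "c \<noteq> 0" for a b c d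
  proof (cases "\<bar>c\<bar> \<le> 1")
    case False
    moreover have "Min N \<le> 1" using fin by (intro Min_le) (auto simp: N_def)
    ultimately show ?thesis by simp
  next
    case True
    have sc: "s * c \<noteq> 0" using s c by simp
    obtain i where i: "1 \<le> a + of_int i * (s * c)" "a + of_int i * (s * c) \<le> 1 + \<bar>s * c\<bar>"
      using adjust_into_interval[OF sc] by blast
    obtain j where j: "1 \<le> d + of_int j * (s * c)" "d + of_int j * (s * c) \<le> 1 + \<bar>s * c\<bar>"
      using adjust_into_interval[OF sc] by blast
    define u where "u = of_int i * s" define v where "v = of_int j * s"
    define a' where "a' = a + u * c" define d' where "d' = d + c * v"
    define b' where "b' = (a + u * c) * v + (b + u * d)"
    have a': "1 \<le> a'" "a' \<le> 1 + \<bar>s\<bar> * \<bar>c\<bar>" using i by (simp_all add: a'_def u_def abs_mult mult.assoc)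
    have d': "1 \<le> d'" "d' \<le> 1 + \<bar>s\<bar> * \<bar>c\<bar>" using j by (simp_all add: d'_def v_def abs_mult mult_ac)
    have det': "a' * d' - b' * c = 1"
    proof -
      have "a' * d' - b' * c = a * d - b * c" by (simp add: a'_def b'_def d'_def algebra_simps)
      then show ?thesis using 1 by simp
    qed
    define A where "A = P2 a b c d"
    have A: "A \<in> carrier PSL2R" by (simp add: A_def P2_carrier 1)
    have U: "P2 1 w 0 1 \<in> carrier PSL2R" for w by (simp add: P2_carrier)
    have prod: "P2 1 u 0 1 \<cdot> A \<cdot> P2 1 v 0 1 = P2 a' b' c d'"
    proof -
      have "P2 1 u 0 1 \<cdot> A = P2 (a + u * c) (b + u * d) c d" using 1 by (simp add: A_def P2_mult)
      moreover have "(a + u * c) * d - (b + u * d) * c = 1" using 1 by (simp add: algebra_simps)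
      ultimately show ?thesis by (simp add: P2_mult a'_def b'_def d'_def add.commute)
    qed
    have "translation k u \<in> G" "translation k v \<in> G"
      using int_pow_G[OF h, of i] int_pow_G[OF h, of j] by (simp_all add: tr_int_pow k u_def v_def)
    then have "translation k u \<cdot> (k \<cdot> A \<cdot> pinv k) \<cdot> translation k v \<in> G"
      using G by (simp add: A_def mult_G)
    moreover have "translation k u \<cdot> (k \<cdot> A \<cdot> pinv k) \<cdot> translation k v
       = k \<cdot> (P2 1 u 0 1 \<cdot> A \<cdot> P2 1 v 0 1) \<cdot> pinv k"
      using k A U by (simp add: translation_def PSL.m_assoc PSL_cancel)
    ultimately have G': "k \<cdot> P2 a' b' c d' \<cdot> pinv k \<in> G" by (simp add: prod)
    have sc_le: "\<bar>s\<bar> * \<bar>c\<bar> \<le> \<bar>s\<bar>" using True by (simp add: mult_left_le)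
    have "a' * d' \<le> (1 + \<bar>s\<bar> * \<bar>c\<bar>) * (1 + \<bar>s\<bar> * \<bar>c\<bar>)" using a' d' by (intro mult_mono) auto
    moreover have "a' * d' \<ge> 1 * 1" using a' d' by (intro mult_mono) auto
    moreover have "b' * c = a' * d' - 1" using det' by simp
    \<comment> \<open>Both diagonal entries were moved into an interval that begins at 1. Hence a'
      d' - 1 is of order |c|, and b' stays bounded however small c is.\<close>
    ultimately have "\<bar>b' * c\<bar> \<le> (1 + \<bar>s\<bar> * \<bar>c\<bar>) * (1 + \<bar>s\<bar> * \<bar>c\<bar>) - 1" by linarith
    also have "\<dots> = (2 * \<bar>s\<bar> + s\<^sup>2 * \<bar>c\<bar>) * \<bar>c\<bar>" by (simp add: power2_eq_square algebra_simps)
    finally have "\<bar>b'\<bar> \<le> 2 * \<bar>s\<bar> + s\<^sup>2 * \<bar>c\<bar>" using c by (simp add: abs_mult)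
    also have "\<dots> \<le> 2 * \<bar>s\<bar> + s\<^sup>2" using True by (simp add: mult_left_le)
    finally have "b'\<^sup>2 \<le> (2 * \<bar>s\<bar> + s\<^sup>2)\<^sup>2" by (metis abs_ge_zero power2_abs power_mono)
    moreover have "a'\<^sup>2 \<le> (1 + \<bar>s\<bar>)\<^sup>2" "d'\<^sup>2 \<le> (1 + \<bar>s\<bar>)\<^sup>2" using a' d' sc_le by (intro power_mono; simp)+
    moreover have "c\<^sup>2 \<le> 1" using True by (simp add: abs_square_le_1)
    ultimately have "a'\<^sup>2 + b'\<^sup>2 + c\<^sup>2 + d'\<^sup>2 \<le> B" by (simp add: B_def)
    then have "c \<in> C" unfolding C_def using det' G' by blast
    then show ?thesis using fin c by (intro Min_le) (auto simp: N_def)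
  qed
  ultimately show thesis by (rule that)
qed

lemma conj_tr:
  assumes k: "k \<in> carrier PSL2R" and l: "l \<in> carrier PSL2R" and ad: "a * d = 1"
  shows "(k \<cdot> P2 a b 0 d \<cdot> pinv l) \<cdot> translation l t
      \<cdot> pinv (k \<cdot> P2 a b 0 d \<cdot> pinv l) = translation k (a\<^sup>2 * t)"
proof -
  define A where "A = P2 a b 0 d"
  have A: "A \<in> carrier PSL2R" by (simp add: A_def P2_carrier ad)
  have U: "P2 1 t 0 1 \<in> carrier PSL2R" by (simp add: P2_carrier)
  have "A \<cdot> P2 1 t 0 1 \<cdot> pinv A = P2 1 (a\<^sup>2 * t) 0 1"
    using ad P2_mult[of a "a * t + b" 0 d d "- b" 0 a] by (simp add: A_def P2_mult P2_inv mult.commute) (simp add: P2_eq_iff power2_eq_square algebra_simps)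
  moreover have "(k \<cdot> A \<cdot> pinv l) \<cdot> translation l t
      \<cdot> pinv (k \<cdot> A \<cdot> pinv l)
      = k \<cdot> (A \<cdot> P2 1 t 0 1 \<cdot> pinv A) \<cdot> pinv k"
    using k l A U by (simp add: translation_def PSL.inv_mult_group PSL.m_assoc PSL_cancel)
  ultimately show ?thesis by (simp add: A_def translation_def)
qed

text \<open>By \<open>conj_tr\<close> an element fixing the cusp multiplies translation lengths by
  a^2. If that were not 1, it or its inverse would shrink the smallest positive translation.\<close>

lemma fixing_cusp_unipotent:
  assumes k: "k \<in> carrier PSL2R" and s: "s \<noteq> 0" and h: "translation k s \<in> G"
    and ad: "a * d = 1" and G: "k \<cdot> P2 a b 0 d \<cdot> pinv k \<in> G"
  shows "a = 1 \<and> d = 1 \<or> a = -1 \<and> d = -1"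
proof -
  define T where "T = {t. translation k t \<in> G \<and> \<bar>t\<bar> \<le> \<bar>s\<bar>} \<inter> {0<..}"
  have fin: "finite T" unfolding T_def using translations_finite[OF k] by blast
  have "translation k (- s) \<in> G" using inv_G[OF h] by (simp add: inv_tr k)
  then have "\<bar>s\<bar> \<in> T" using h s by (auto simp: T_def abs_if)
  then have "Min T \<in> T" using fin by (intro Min_in) auto
  then have min: "translation k (Min T) \<in> G" "Min T > 0" "Min T \<le> \<bar>s\<bar>" by (auto simp: T_def)
  have no_contraction: "\<not> q\<^sup>2 < 1" if "q * q' = 1" "k \<cdot> P2 q p 0 q' \<cdot> pinv k \<in> G" for q p q'
  proof
    assume lt: "q\<^sup>2 < 1"
    have "translation k (q\<^sup>2 * Min T) \<in> G"
      using conj_tr[OF k k that(1), of p "Min T"] mult_G[OF mult_G[OF that(2) min(1)] inv_G[OF that(2)]] by simp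
    moreover have "q\<^sup>2 * Min T < Min T" using lt min(2) by simp
    moreover have "q \<noteq> 0" using that(1) by auto
    then have "q\<^sup>2 * Min T > 0" using min(2) by simp
    ultimately have "q\<^sup>2 * Min T \<in> T" using min(3) by (simp add: T_def)
    then show False using Min_le[OF fin, of "q\<^sup>2 * Min T"] \<open>q\<^sup>2 * Min T < Min T\<close> by simp
  qed
  have "pinv (k \<cdot> P2 a b 0 d \<cdot> pinv k)
      = k \<cdot> P2 d (- b) 0 a \<cdot> pinv k"
    using k ad P2_inv[of a d b 0] by (simp add: PSL.inv_mult_group P2_carrier PSL.m_assoc)
  then have "k \<cdot> P2 d (- b) 0 a \<cdot> pinv k \<in> G" using inv_G[OF G] by simp
  then have "\<not> a\<^sup>2 < 1" "\<not> d\<^sup>2 < 1" using no_contraction[of a d b] no_contraction[of d a "- b"] ad G by (auto simp: mult.commute)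
  moreover have "a\<^sup>2 * d\<^sup>2 = 1" using ad by (metis power_mult_distrib one_power2)
  ultimately have "a\<^sup>2 = 1"
    using mult_mono[of 1 "d\<^sup>2" 1 "a\<^sup>2"] mult_left_mono[of 1 "d\<^sup>2" "a\<^sup>2"] by auto
  then show ?thesis using ad by (auto simp: power2_eq_1_iff)
qed

text \<open>The quotient of two such matrices does not involve l and lies in the conjugate of G at
  the cusp; its lower left entry is \<open>row_det v w\<close>. If that is 0, the quotient is
  unipotent up to sign, so v and w agree up to sign.\<close>

lemma rows_separated:
  assumes k: "k \<in> carrier PSL2R" and s: "s \<noteq> 0" and h: "translation k s \<in> G"
  obtains \<gamma> where "\<And>l. l \<in> carrier PSL2R \<Longrightarrow> separated \<gamma> (lower_rows k l)"
proof -
  obtain \<gamma> where \<gamma>: "\<gamma> > 0" "\<And>a b c d. a * d - b * c = 1 \<Longrightarrow>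
    k \<cdot> P2 a b c d \<cdot> pinv k \<in> G \<Longrightarrow> c \<noteq> 0 \<Longrightarrow> \<gamma> \<le> \<bar>c\<bar>"
    using lower_left_bound[OF k s h] by blast
  show thesis
  proof (rule that)
    fix l assume l: "l \<in> carrier PSL2R"
    show "separated \<gamma> (lower_rows k l)" unfolding separated_def
    proof (intro conjI ballI impI)
      show "\<gamma> > 0" by (rule \<gamma>(1))
      show "0 \<notin> lower_rows k l" by (auto simp: lower_rows_def zero_prod_def)
      fix v w assume v: "v \<in> lower_rows k l" and w: "w \<in> lower_rows k l" and ne: "v \<noteq> w" "v \<noteq> - w"
      obtain a b c d where vm: "v = (c, d)" and 1: "a * d - b * c = 1"
        and vG: "k \<cdot> P2 a b c d \<cdot> pinv l \<in> G" using v by (auto simp: lower_rows_def)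
      obtain a' b' c' d' where wm: "w = (c', d')" and det': "a' * d' - b' * c' = 1"
        and wG: "k \<cdot> P2 a' b' c' d' \<cdot> pinv l \<in> G" using w by (auto simp: lower_rows_def)
      define \<alpha> where "\<alpha> = a * d' - b * c'"
      define \<beta> where "\<beta> = b * a' - a * b'"
      define \<delta> where "\<delta> = d * a' - c * b'"
      have "\<alpha> * \<delta> - \<beta> * (c * d' - d * c') = (a * d - b * c) * (a' * d' - b' * c')"
        by (simp add: \<alpha>_def \<beta>_def \<delta>_def algebra_simps)
      then have M1: "\<alpha> * \<delta> - \<beta> * (c * d' - d * c') = 1" using 1 det' by simp
      have M: "P2 a b c d \<cdot> pinv (P2 a' b' c' d') = P2 \<alpha> \<beta> (c * d' - d * c') \<delta>"
        using 1 det' P2_mult[of a d b c d' a' "- b'" "- c'"]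
        by (simp add: P2_inv \<alpha>_def \<beta>_def \<delta>_def mult.commute)
      have "(k \<cdot> P2 a b c d \<cdot> pinv l) \<cdot>
          pinv (k \<cdot> P2 a' b' c' d' \<cdot> pinv l)
        = k \<cdot> (P2 a b c d \<cdot> pinv (P2 a' b' c' d')) \<cdot> pinv k"
        using k l P2_carrier[OF 1] P2_carrier[OF det'] by (simp add: PSL.inv_mult_group PSL.m_assoc PSL_cancel)
      then have MG: "k \<cdot> P2 \<alpha> \<beta> (c * d' - d * c') \<delta> \<cdot> pinv k \<in> G"
        using mult_G[OF vG inv_G[OF wG]] by (simp add: M)
      have "c * d' - d * c' \<noteq> 0"
      proof
        assume 0: "c * d' - d * c' = 0"
        then have "\<alpha> * \<delta> = 1" using M1 by simp
        then have \<delta>: "\<delta> = 1 \<or> \<delta> = -1"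
          using fixing_cusp_unipotent[OF k s h _ MG[unfolded 0]] by auto
        have "\<delta> * c' = c * (a' * d' - b' * c') - a' * (c * d' - d * c')" by (simp add: \<delta>_def algebra_simps)
        moreover have "\<delta> * d' = d * (a' * d' - b' * c') - b' * (c * d' - d * c')" by (simp add: \<delta>_def algebra_simps)
        ultimately have "\<delta> * c' = c" "\<delta> * d' = d" using 0 det' by simp_all
        then show False using \<delta> ne vm wm by auto
      qed
      then show "\<gamma> \<le> \<bar>row_det v w\<bar>" using \<gamma>(2)[OF M1 MG] by (simp add: row_det_def vm wm)
    qed
  qed
qed

text \<open>In the coordinate l the power of g is a diagonal matrix Y, so right multiplication by Y
  preserves the rows.\<close>

lemma rows_closed_hyperbolic:
  assumes k: "k \<in> carrier PSL2R" and g: "g \<in> G" "hyperbolic_along l \<nu> g" and cd: "(c, d) \<in> lower_rows k l"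
  shows "(c * exp (of_int n * ln \<nu> / 2), d * exp (- (of_int n * ln \<nu> / 2))) \<in> lower_rows k l"
proof -
  define e where "e = exp (of_int n * ln \<nu> / 2)"
  have e: "e > 0" "1 / e = exp (- (of_int n * ln \<nu> / 2))" by (simp_all add: e_def exp_minus field_simps)
  have det': "e * (1 / e) - 0 * 0 = 1" using e(1) by simp
  have l: "l \<in> carrier PSL2R" using g by (simp add: hyperbolic_along_def)
  have gn: "g \<^bold>^ n \<in> G" by (rule int_pow_G[OF g(1)])
  define Y where "Y = P2 e 0 0 (1 / e)"
  have Y: "Y \<in> carrier PSL2R" unfolding Y_def by (rule P2_carrier[OF det'])
  have actY: "act Y z = of_real (exp (of_int n * ln \<nu>)) * z" for z
  proof -
    have "e * e = exp (of_int n * ln \<nu>)" unfolding e_def exp_add[symmetric] by simp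
    then have "exp (of_int n * ln \<nu>) = e * e" by simp
    then show ?thesis using e(1) by (simp add: Y_def act_P2)
  qed
  have "l \<cdot> Y = g \<^bold>^ n \<cdot> l"
  proof (rule act_eqI)
    show "l \<cdot> Y \<in> carrier PSL2R" "g \<^bold>^ n \<cdot> l \<in> carrier PSL2R"
      using l Y G_PSL[OF gn] by simp_all
    fix z assume z: "z \<in> HP"
    show "act (l \<cdot> Y) z = act (g \<^bold>^ n \<cdot> l) z"
      using hyperbolic_along_int_pow[OF G_PSL[OF g(1)] g(2) z, of n] l Y G_PSL[OF gn] z
      by (simp add: act_mult actY)
  qed
  then show ?thesis
    using rows_act[OF k l det' cd] rows_mult_G[OF k l gn] by (simp add: Y_def e_def e(2)[unfolded e_def])
qed

lemma rows_closed_parabolic: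
  assumes k: "k \<in> carrier PSL2R" and l: "l \<in> carrier PSL2R" and g: "translation l s \<in> G" and cd: "(c, d) \<in> lower_rows k l"
  shows "(c, d + of_int n * s * c) \<in> lower_rows k l"
proof -
  have gn: "translation l (of_int n * s) \<in> G" using int_pow_G[OF g, of n] by (simp add: tr_int_pow l)
  have det': "1 * 1 - of_int n * s * 0 = (1::real)" by simp
  have "translation l (of_int n * s) \<cdot> l = l \<cdot> P2 1 (of_int n * s) 0 1"
    using l by (simp add: translation_def P2_carrier PSL.m_assoc)
  then show ?thesis
    using rows_act[OF k l det' cd] rows_mult_G[OF k l gn] by (simp add: algebra_simps)
qed

end

lemma drift_eq_0: "(\<And>v. v \<in> V \<Longrightarrow> \<bar>shift v x y\<bar> \<le> T) \<Longrightarrow> drift T V x y = 0"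
  unfolding drift_def by (rule sum.neutral) (auto simp: not_le[symmetric])

lemma parabolic_along_pow:
  assumes "parabolic_along k s X" "X \<in> carrier PSL2R" "z \<in> HP"
  shows "act (X \<^bold>^ (n::nat)) (act k z) = act k (z + of_real (real n * s))"
proof -
  have k: "k \<in> carrier PSL2R" using assms(1) by (simp add: parabolic_along_def)
  have "X = translation k s" using parabolic_along_tr assms by blast
  then show ?thesis by (simp only: tr_nat_pow[OF k] act_tr[OF k assms(3)])
qed

section \<open>Vanishing on the finite set and growth along a parabolic element\<close>

context fuchsian
begin

text \<open>The translations at the cusp form a discrete group of reals. As s may be negative,
  \<open>discrete_real_subgroup\<close> is applied to |s| and the sign is moved into the
  exponent.\<close>

lemma primitive_parabolic_centralizer:
  assumes prim: "primitive_element \<Gamma> (translation k s)" and k: "k \<in> carrier PSL2R" and s: "s \<noteq> 0"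
    and t: "translation k t \<in> G"
  shows "\<exists>n::int. translation k t = translation k s \<^bold>^ n"
proof -
  define T where "T = {t. translation k t \<in> G}"
  have hG: "translation k s \<in> G" using prim by (simp add: primitive_element_def)
  have neg: "- u \<in> T" if "u \<in> T" for u using inv_G[of "translation k u"] that by (simp add: T_def inv_tr k)
  have diff: "u - v \<in> T" if "u \<in> T" "v \<in> T" for u v
    using mult_G[of "translation k u" "translation k (- v)"] that(1) neg[OF that(2)] by (simp add: T_def tr_add k)
  have sT: "\<bar>s\<bar> \<in> T" using hG neg[of s] by (auto simp: T_def abs_if)
  have "finite {t \<in> T. 0 < t \<and> t \<le> \<bar>s\<bar>}"
    by (rule finite_subset[OF _ translations_finite[OF k, of "\<bar>s\<bar>"]]) (auto simp: T_def)
  moreover have "\<bar>n\<bar> < 2" if b: "b \<in> T" "\<bar>s\<bar> = of_int n * b" for b and n :: int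
  proof (rule ccontr)
    assume n: "\<not> \<bar>n\<bar> < 2"
    define m where "m = (if s > 0 then n else - n)"
    have m: "s = of_int m * b" "\<bar>m\<bar> \<ge> 2" using b(2) n by (auto simp: m_def abs_if split: if_splits)
    have bG: "translation k b \<in> G" using b(1) by (simp add: T_def)
    have "translation k s = translation k b [^]\<^bsub>\<Gamma>\<^esub> m"
      using int_pow_Gamma[OF bG] m(1) by (simp add: tr_int_pow k)
    then show False using prim bG m(2) unfolding primitive_element_def by auto
  qed
  ultimately obtain n :: int where n: "t = of_int n * \<bar>s\<bar>"
    using discrete_real_subgroup[of T "\<bar>s\<bar>" t] diff sT s t by (auto simp: T_def)
  define m where "m = (if s > 0 then n else - n)"
  have "t = of_int m * s" using n by (auto simp: m_def)
  then have "translation k t = translation k s \<^bold>^ m" by (simp add: tr_int_pow k)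
  then show ?thesis by blast
qed

lemma drift_at_axis:
  assumes k: "k \<in> carrier PSL2R" and l: "l \<in> carrier PSL2R" and "x \<in> HP" "y \<in> HP"
  shows "drift T (lower_rows k \<^bold>1) (act l x) (act l y) = drift T (lower_rows k l) x y"
  using drift_act[OF k PSL.one_closed l assms(3,4)] l by simp

text \<open>From a suitable base point (a fixed point, a point on a horocycle or on the axis of g)
  the displacements under powers of g are bounded over all cusps in the orbit; every threshold
  beyond that bound removes all terms.\<close>

lemma eventually_no_drift:
  assumes prim: "primitive_element \<Gamma> (translation k s)" and k: "k \<in> carrier PSL2R" and s: "s \<noteq> 0"
    and g: "g \<in> G" and nconj: "\<And>n::int. \<not> conjugate_in \<Gamma> g (translation k s [^]\<^bsub>\<Gamma>\<^esub> n)"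
  shows "eventually (\<lambda>T. \<exists>x\<in>HP. \<forall>n::nat. drift T (lower_rows k \<^bold>1) x (act (g \<^bold>^ n) x) = 0) at_top"
proof -
  have i: "\<i> \<in> HP" by (simp add: HP_def)
  have hG: "translation k s \<in> G" using prim by (simp add: primitive_element_def)
  note gP = G_PSL[OF g]
  obtain \<gamma> where sep: "\<And>l. l \<in> carrier PSL2R \<Longrightarrow> separated \<gamma> (lower_rows k l)"
    using rows_separated[OF k s hG] by blast
  consider "elliptic g" | l \<sigma> where "parabolic_along l \<sigma> g" | l \<nu> where "hyperbolic_along l \<nu> g"
    using trichotomy[OF gP] by blast
  then show ?thesis
  proof cases
    case 1
    then obtain z where z: "z \<in> HP" "act g z = z" by (auto simp: elliptic_def)
    have "drift T V z z = 0" if "T \<ge> 0" for T V using that by (intro drift_eq_0) (simp add: shift_def)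
    then have "\<exists>x\<in>HP. \<forall>n::nat. drift T V x (act (g \<^bold>^ n) x) = 0" if "T \<ge> 0" for T V
      using that elliptic_pow_fixes[OF gP z] by (intro bexI[OF _ z(1)]) simp
    then show ?thesis by (intro eventually_mono[OF eventually_ge_at_top[of 0]]) blast
  next
    case 2
    have l: "l \<in> carrier PSL2R" and \<sigma>: "\<sigma> \<noteq> 0" using 2 by (auto simp: parabolic_along_def)
    have gtr: "g = translation l \<sigma>" by (rule parabolic_along_tr[OF gP 2])
    \<comment> \<open>A row with c = 0 would place the fixed point of g in the orbit of the cusp of
      h, and g would be conjugate to a translation at that cusp, hence to a power of h.\<close>
    have c0: "c \<noteq> 0" if cd: "(c, d) \<in> lower_rows k l" for c d
    proof
      assume c: "c = 0"
      obtain a b where ad: "a * d = 1" and XG: "k \<cdot> P2 a b 0 d \<cdot> pinv l \<in> G"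
        using cd c by (auto simp: lower_rows_def)
      define X where "X = k \<cdot> P2 a b 0 d \<cdot> pinv l"
      have X: "X \<in> G" "X \<cdot> g \<cdot> pinv X = translation k (a\<^sup>2 * \<sigma>)"
        using XG conj_tr[OF k l ad] by (simp_all add: X_def gtr)
      then have "translation k (a\<^sup>2 * \<sigma>) \<in> G" using mult_G[OF mult_G[OF X(1) g] inv_G[OF X(1)]] by simp
      then obtain n :: int where "translation k (a\<^sup>2 * \<sigma>) = translation k s \<^bold>^ n"
        using primitive_parabolic_centralizer[OF prim k s] by blast
      then have "conjugate_in \<Gamma> g (translation k s [^]\<^bsub>\<Gamma>\<^esub> n)"
        using X unfolding conjugate_in_Gamma int_pow_Gamma[OF hG] by auto
      then show False using nconj by blast
    qed
    obtain B where B: "\<And>c d t. (c, d) \<in> lower_rows k l \<Longrightarrow> c \<noteq> 0 \<Longrightarrow> \<bar>shift (c, d) \<i> (\<i> + of_real t)\<bar> \<le> B"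
      using shift_horizontal_bounded[OF sep[OF l] \<sigma> rows_closed_parabolic[OF k l g[unfolded gtr]]] by blast
    have "drift T (lower_rows k \<^bold>1) (act l \<i>) (act (g \<^bold>^ n) (act l \<i>)) = 0" if "T \<ge> B" for T and n :: nat
      unfolding parabolic_along_pow[OF 2 gP i] drift_at_axis[OF k l i HP_translate[OF i]]
    proof (rule drift_eq_0)
      fix v assume v: "v \<in> lower_rows k l"
      then show "\<bar>shift v \<i> (\<i> + of_real (real n * \<sigma>))\<bar> \<le> T"
        using B[of "fst v" "snd v" "real n * \<sigma>"] c0[of "fst v" "snd v"] that by simp
    qed
    then show ?thesis
      using act_HP[OF l i] by (intro eventually_mono[OF eventually_ge_at_top[of B]]) blast
  next
    case 3
    have l: "l \<in> carrier PSL2R" and \<nu>: "ln \<nu> > 0" using 3 by (auto simp: hyperbolic_along_def)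
    obtain B where B: "\<And>w t. w \<in> lower_rows k l \<Longrightarrow> t > 0 \<Longrightarrow> \<bar>shift w \<i> (of_real t * \<i>)\<bar> \<le> B"
      using shift_vertical_bounded[OF sep[OF l] \<nu> rows_closed_hyperbolic[OF k g 3]] by blast
    have "drift T (lower_rows k \<^bold>1) (act l \<i>) (act (g \<^bold>^ n) (act l \<i>)) = 0" if "T \<ge> B" for T and n :: nat
    proof -
      have "act (g \<^bold>^ n) (act l \<i>) = act l (of_real (exp (real n * ln \<nu>)) * \<i>)"
        using hyperbolic_along_int_pow[OF gP 3 i, of "int n", unfolded int_pow_int] by simp
      then have "drift T (lower_rows k \<^bold>1) (act l \<i>) (act (g \<^bold>^ n) (act l \<i>))
          = drift T (lower_rows k l) \<i> (of_real (exp (real n * ln \<nu>)) * \<i>)"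
        using drift_at_axis[OF k l i HP_scale[OF i]] by simp
      also have "\<dots> = 0" using B[OF _ exp_gt_zero] that by (intro drift_eq_0) (meson order_trans)
      finally show ?thesis .
    qed
    then show ?thesis
      using act_HP[OF l i] by (intro eventually_mono[OF eventually_ge_at_top[of B]]) blast
  qed
qed

lemma rows_fixing_cusp:
  assumes k: "k \<in> carrier PSL2R" and s: "s \<noteq> 0" and h: "translation k s \<in> G"
  shows "(0, d) \<in> lower_rows k k \<longleftrightarrow> d = 1 \<or> d = -1"
proof
  assume "(0, d) \<in> lower_rows k k"
  then obtain a b where "a * d = 1" "k \<cdot> P2 a b 0 d \<cdot> pinv k \<in> G"
    by (auto simp: lower_rows_def)
  then show "d = 1 \<or> d = -1" using fixing_cusp_unipotent[OF k s h] by blast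
next
  assume d: "d = 1 \<or> d = -1"
  then have "P2 d 0 0 d = \<^bold>1" by (auto simp: P2_one P2_eq_iff)
  then have "d * d - 0 * 0 = 1 \<and> k \<cdot> P2 d 0 0 d \<cdot> pinv k \<in> G"
    using d k one_G by auto
  then show "(0, d) \<in> lower_rows k k" unfolding lower_rows_def mem_Collect_eq case_prod_conv by blast
qed

text \<open>Along powers of h the cusp of h itself contributes a displacement that grows linearly,
  while the other cusps stay below the threshold.\<close>

lemma parabolic_case:
  assumes prim: "primitive_element \<Gamma> h" and par: "parabolic_along k s h"
    and S: "finite S" "S \<subseteq> G"
    and S_nconj: "\<And>g n. g \<in> S \<Longrightarrow> \<not> conjugate_in \<Gamma> g (h [^]\<^bsub>\<Gamma>\<^esub> (n::int))"
  shows "\<exists>r. homogeneous_quasi_morphism \<Gamma> r \<and> r h \<noteq> 0 \<and> (\<forall>g\<in>S. r g = 0)"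
proof -
  have i: "\<i> \<in> HP" by (simp add: HP_def)
  have hG: "h \<in> G" using prim by (simp add: primitive_element_def)
  note hP = G_PSL[OF hG]
  have k: "k \<in> carrier PSL2R" and s: "s \<noteq> 0" using par by (auto simp: parabolic_along_def)
  have htr: "h = translation k s" by (rule parabolic_along_tr[OF hP par])
  have trG: "translation k s \<in> G" using hG htr by simp
  define V where "V = lower_rows k \<^bold>1"
  obtain \<gamma> where sep: "\<And>l. l \<in> carrier PSL2R \<Longrightarrow> separated \<gamma> (lower_rows k l)"
    using rows_separated[OF k s trG] by blast
  have \<gamma>: "\<gamma> > 0" using sep[OF k] by (simp add: separated_def)
  obtain B where B: "\<And>c d t. (c, d) \<in> lower_rows k k \<Longrightarrow> c \<noteq> 0 \<Longrightarrow> \<bar>shift (c, d) \<i> (\<i> + of_real t)\<bar> \<le> B"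
    using shift_horizontal_bounded[OF sep[OF k] s rows_closed_parabolic[OF k k trG]] by blast
  have "eventually (\<lambda>T. \<forall>g\<in>S. \<exists>x\<in>HP. \<forall>n::nat. drift T V x (act (g \<^bold>^ n) x) = 0) at_top"
    unfolding V_def using S eventually_no_drift[OF prim[unfolded htr] k s _ S_nconj[unfolded htr]]
    by (intro eventually_ball_finite) auto
  moreover have "eventually (\<lambda>T. T \<ge> 8 / \<gamma>) at_top" "eventually (\<lambda>T. T \<ge> B) at_top"
    by (rule eventually_ge_at_top)+
  ultimately have "eventually (\<lambda>T. (\<forall>g\<in>S. \<exists>x\<in>HP. \<forall>n::nat. drift T V x (act (g \<^bold>^ n) x) = 0)
      \<and> T \<ge> 8 / \<gamma> \<and> T \<ge> B) at_top"
    by eventually_elim simp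
  then obtain T where T: "\<forall>g\<in>S. \<exists>x\<in>HP. \<forall>n::nat. drift T V x (act (g \<^bold>^ n) x) = 0"
    "T \<ge> 8 / \<gamma>" "T \<ge> B"
    by (auto simp: eventually_at_top_linorder)
  have T8: "T * \<gamma> \<ge> 8" using T(2) \<gamma> by (simp add: pos_divide_le_eq)
  have T0: "T > 0" using T(2) \<gamma> by (smt (verit) divide_pos_pos)
  have inv: "drift T V (act g x) (act g y) = drift T V x y" if "g \<in> G" "x \<in> HP" "y \<in> HP" for g x y
    using drift_act[OF k PSL.one_closed G_PSL[OF that(1)] that(2,3)] rows_mult_G[OF k PSL.one_closed that(1)]
      G_PSL[OF that(1)] by (simp add: V_def)
  have cocycle: "\<bar>drift T V x z - drift T V x y - drift T V y z\<bar> \<le> drift_defect \<gamma> T"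
    if "x \<in> HP" "y \<in> HP" "z \<in> HP" for x y z
    using drift_cocycle[OF sep[OF PSL.one_closed] T8 that] by (simp add: V_def)
  obtain r where r: "homogeneous_quasi_morphism \<Gamma> r"
    and bound: "\<And>g x. g \<in> G \<Longrightarrow> x \<in> HP \<Longrightarrow>
      \<exists>B. \<forall>n::nat. \<bar>drift T V x (act (g \<^bold>^ n) x) - real n * r g\<bar> \<le> B"
  proof (rule quasi_cocycle_homogenization[of "drift T V" "drift_defect \<gamma> T", OF inv cocycle])
    fix r assume "homogeneous_quasi_morphism \<Gamma> r"
      "\<And>g x. g \<in> G \<Longrightarrow> x \<in> HP \<Longrightarrow>
        \<exists>B. \<forall>n::nat. \<bar>drift T V x (act (g \<^bold>^ n) x) - real n * r g\<bar> \<le> B"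
    then show thesis by (rule that)
  qed
  have "r g = 0" if g: "g \<in> S" for g
  proof -
    obtain x where x: "x \<in> HP" and z: "\<forall>n::nat. drift T V x (act (g \<^bold>^ n) x) = 0"
      using T(1) g by blast
    obtain C where C: "\<forall>n::nat. \<bar>drift T V x (act (g \<^bold>^ n) x) - real n * r g\<bar> \<le> C"
      using bound[OF _ x, of g] g S(2) by blast
    have "\<bar>real n * r g\<bar> \<le> C + real n * 0" for n :: nat
      using C[rule_format, of n] z[rule_format, of n] by simp
    then have "\<bar>r g\<bar> \<le> 0" by (rule zero_of_linear_bound)
    then show ?thesis by simp
  qed
  moreover have "r h \<noteq> 0"
  proof
    assume rh: "r h = 0"
    obtain C where C: "\<forall>n::nat. \<bar>drift T V (act k \<i>) (act (h \<^bold>^ n) (act k \<i>)) - real n * r h\<bar> \<le> C"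
      using bound[OF hG act_HP[OF k i]] ..
    obtain n :: nat where n: "(T + \<bar>C\<bar> + 1) / \<bar>s\<bar> < n" using reals_Archimedean2 by blast
    define t where "t = real n * s"
    have t: "\<bar>t\<bar> > T + \<bar>C\<bar> + 1" using n s by (simp add: t_def abs_mult pos_divide_less_eq)
    have vert: "shift (0, d) \<i> (\<i> + of_real t) = - t" if "d = 1 \<or> d = -1" for d
      using that by (auto simp: shift_def linear_form_def)
    \<comment> \<open>Rows with c nonzero stay below B \<le> T. The two rows of the cusp of h are
      opposite, and the displacement is even in the row, so their terms add up instead of
      cancelling.\<close>
    have "{v. v \<in> lower_rows k k \<and> \<bar>shift v \<i> (\<i> + of_real t)\<bar> > T} = {(0, 1), (0, -1)}" (is "?L = ?R")
    proof
      show "?L \<subseteq> ?R"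
      proof
        fix v assume v: "v \<in> ?L"
        obtain c d where cd: "v = (c, d)" by (cases v)
        have "c = 0" using B[of c d t] v T(3) by (auto simp: cd)
        then show "v \<in> ?R" using v rows_fixing_cusp[OF k s trG] by (auto simp: cd)
      qed
      show "?R \<subseteq> ?L" using rows_fixing_cusp[OF k s trG] t T0 vert by auto
    qed
    then have "drift T (lower_rows k k) \<i> (\<i> + of_real t) = (\<Sum>v\<in>{(0, 1), (0, -1)}. soft_threshold T (shift v \<i> (\<i> + of_real t)))"
      by (simp only: drift_def)
    also have "\<dots> = 2 * soft_threshold T (- t)" using vert[of 1] vert[of "-1"] by simp
    also have "\<bar>\<dots>\<bar> = 2 * (\<bar>t\<bar> - T)"
    proof -
      have "\<bar>t\<bar> > T" using t by linarith
      then show ?thesis using T0 by (auto simp: soft_threshold_def abs_if split: if_splits)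
    qed
    finally have "\<bar>drift T V (act k \<i>) (act (h \<^bold>^ n) (act k \<i>))\<bar> = 2 * (\<bar>t\<bar> - T)"
      unfolding parabolic_along_pow[OF par hP i] V_def drift_at_axis[OF k k i HP_translate[OF i]] t_def .
    then have "2 * (\<bar>t\<bar> - T) \<le> C" using C[rule_format, of n] rh by simp
    then show False using t by simp
  qed
  ultimately show ?thesis using r by blast
qed

text \<open>All powers of an elliptic element fix the same point, and \<open>finite_orbit\<close>
  leaves only finitely many elements that do.\<close>

lemma infinite_order_not_elliptic:
  assumes h: "h \<in> G" and ord: "group.ord \<Gamma> h = 0"
  shows "\<not> elliptic h"
proof
  assume "elliptic h"
  then obtain z where z: "z \<in> HP" "act h z = z" by (auto simp: elliptic_def)
  note hP = G_PSL[OF h]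
  interpret \<Gamma>: group \<Gamma> by (rule group_Gamma)
  have "range (\<lambda>n::nat. h \<^bold>^ n) \<subseteq> {X \<in> G. hdist (act X z) z \<le> 0}"
    using nat_pow_G[OF h] elliptic_pow_fixes[OF hP z] by auto
  then have fin: "finite (range (\<lambda>n::nat. h \<^bold>^ n))"
    using finite_orbit[OF z(1) z(1)] finite_subset by blast
  have "inj (\<lambda>n::nat. h \<^bold>^ n)"
  proof (rule linorder_injI)
    fix i j :: nat assume ij: "i < j"
    show "h \<^bold>^ i \<noteq> h \<^bold>^ j"
    proof
      assume eq: "h \<^bold>^ i = h \<^bold>^ j"
      have "h \<^bold>^ i \<cdot> h \<^bold>^ (j - i) = h \<^bold>^ j"
        using ij hP by (simp add: PSL.nat_pow_mult)
      then have "h \<^bold>^ (j - i) = \<^bold>1" using eq hP by (metis PSL.l_cancel_one' PSL.nat_pow_closed)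
      then have "h [^]\<^bsub>\<Gamma>\<^esub> (j - i) = \<one>\<^bsub>\<Gamma>\<^esub>" using PSL.nat_pow_consistent[of h "j - i" G] by simp
      then show False using \<Gamma>.pow_eq_id[of h "j - i"] h ord ij by simp
    qed
  qed
  then show False using fin range_inj_infinite by blast
qed

end

theorem theorem4:
  fixes G :: "(real^2^2) set set" and h :: "(real^2^2) set" and S :: "(real^2^2) set set"
  defines "\<Gamma> \<equiv> PSL2R\<lparr>carrier := G\<rparr>"
  assumes "discrete_subgroup_PSL2R G"
    and "primitive_element \<Gamma> h"
    and "\<not> conjugate_in \<Gamma> h (inv\<^bsub>\<Gamma>\<^esub> h)"
    and "finite S" and "S \<subseteq> G"
    and "\<And>g k. g \<in> S \<Longrightarrow> \<not> conjugate_in \<Gamma> g (h [^]\<^bsub>\<Gamma>\<^esub> (k::int))"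
  shows "\<exists>r. homogeneous_quasi_morphism \<Gamma> r \<and> r h \<noteq> 0 \<and> (\<forall>g\<in>S. r g = 0)"
proof -
  interpret fuchsian G by (rule fuchsian_of_discrete[OF assms(2)])
  have h: "h \<in> G" "group.ord \<Gamma> h = 0" using assms(3) by (simp_all add: primitive_element_def \<Gamma>_def)
  consider k s where "parabolic_along k s h" | k \<mu> where "hyperbolic_along k \<mu> h"
    using trichotomy[OF G_PSL[OF h(1)]] infinite_order_not_elliptic[OF h(1)] h(2) by (auto simp: \<Gamma>_def)
  then show ?thesis
  proof cases
    case 1
    then show ?thesis using parabolic_case[of h k s S] assms(3-) unfolding \<Gamma>_def by blast
  next
    case 2
    then show ?thesis using hyperbolic_case[of h k \<mu> S] assms(3-) unfolding \<Gamma>_def by blast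
  qed
qed

end
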